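(* Let $X:\mathcal{E}\to\mathcal{R}$ and $Y:\mathcal{E}\to\mathcal{T}$ be holomorphic maps between compact Riemann surfaces of degree at least two such that $$X^*M(\mathcal{R})\cdot Y^*M(\mathcal{T})=M(\mathcal{E}).$$ Assume that there exists a point $z_0\in\mathcal{E}$ such that $\gcd(\mathrm{mult}_{z_0}X,\mathrm{mult}_{z_0}Y)>1$. Then $$X^*M(\mathcal{R})\cap Y^*M(\mathcal{T})=\mathbb{C}.$$
   Context: $M(\mathcal{R})$ denotes the field of meromorphic functions on a compact Riemann surface $\mathcal{R}$; for a non-constant holomorphic map $X:\mathcal{E}\to\mathcal{R}$, $X^*M(\mathcal{R})=\{f\circ X : f\in M(\mathcal{R})\}\subseteq M(\mathcal{E})$, and the product of two subfields denotes their compositum. $\mathrm{mult}_{z_0}X$ is the multiplicity (local degree, ramification index) of $X$ at $z_0$. $\mathbb{C}$ is identified with the constant functions. *)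

theory Defs
  imports
    "HOL-Complex_Analysis.Complex_Analysis"
    "HOL-Algebra.Generated_Fields"
begin

section \<open>Riemann surfaces\<close>

text \<open>
  The points of a surface are all the points of a Hausdorff topological type, and the complex
  structure is an atlas of charts given as pairs of a domain and a coordinate function. The values
  of the coordinate function outside the domain are irrelevant. The inverse of a chart
  is \<^term>\<open>inv_into U u\<close>.
\<close>

type_synonym 'a atlas = "('a set \<times> ('a \<Rightarrow> complex)) set"

locale riemann_surface =
  fixes A :: "'a::t2_space atlas"
  assumes connected_surface: "connected (UNIV :: 'a set)"
    and charts_cover: "\<exists>U u. (U, u) \<in> A \<and> p \<in> U"
    and chart_open: "(U, u) \<in> A \<Longrightarrow> open U \<and> open (u ` U)"
    and chart_homeomorphism: "(U, u) \<in> A \<Longrightarrow> homeomorphism U (u ` U) u (inv_into U u)"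
    and transition_holomorphic:
      "(U, u) \<in> A \<Longrightarrow> (V, v) \<in> A \<Longrightarrow> (\<lambda>w. v (inv_into U u w)) holomorphic_on u ` (U \<inter> V)"

locale compact_riemann_surface = riemann_surface A for A :: "'a::t2_space atlas" +
  assumes compact_surface: "compact (UNIV :: 'a set)"

definition chart_at :: "'a atlas \<Rightarrow> 'a \<Rightarrow> 'a set \<times> ('a \<Rightarrow> complex)" where
  "chart_at A p = (SOME c. c \<in> A \<and> p \<in> fst c)"

section \<open>Holomorphic maps\<close>

definition holomorphic_map ::
  "'a::topological_space atlas \<Rightarrow> 'b::topological_space atlas \<Rightarrow> ('a \<Rightarrow> 'b) \<Rightarrow> bool" where
  "holomorphic_map A B X \<longleftrightarrow> continuous_on UNIV X \<and>
     (\<forall>(U, u) \<in> A. \<forall>(V, v) \<in> B.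
        (\<lambda>w. v (X (inv_into U u w))) holomorphic_on u ` (U \<inter> X -` V))"

text \<open>
  The multiplicity at \<open>p\<close> is the order of vanishing at \<open>u p\<close> of the coordinate expression of the
  map minus its value there. It does not depend on the charts, and is meaningful only for
  non-constant maps.
\<close>

definition map_mult :: "'a atlas \<Rightarrow> 'b atlas \<Rightarrow> ('a \<Rightarrow> 'b) \<Rightarrow> 'a \<Rightarrow> nat" where
  "map_mult A B X p =
     (case chart_at A p of (U, u) \<Rightarrow> case chart_at B (X p) of (V, v) \<Rightarrow>
        nat (zorder (\<lambda>w. v (X (inv_into U u w)) - v (X p)) (u p)))"

text \<open>
  The number of preimages of a point, counted with multiplicity, is the same for all points of the
  target. For a constant map the fibres are empty or infinite, so the sums, and hence the degree,
  are 0; thus a map of positive degree is non-constant.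
\<close>

definition map_degree :: "'a atlas \<Rightarrow> 'b atlas \<Rightarrow> ('a \<Rightarrow> 'b) \<Rightarrow> nat" where
  "map_degree A B X = (THE d. \<forall>q. (\<Sum>p \<in> X -` {q}. map_mult A B X p) = d)"

section \<open>The field of meromorphic functions\<close>

text \<open>
  As in \<^const>\<open>nicely_meromorphic_on\<close>, a meromorphic function is represented by its unique
  complex-valued representative that is continuous away from its poles and is 0 at its poles.
  Pointwise sums and products have to be brought back to this form;
  \<open>remove_sings_surface\<close> is the analogue on a surface of \<^const>\<open>remove_sings\<close>.
\<close>

definition meromorphic_function :: "'a atlas \<Rightarrow> ('a \<Rightarrow> complex) \<Rightarrow> bool" where
  "meromorphic_function A f \<longleftrightarrow>
     (\<forall>(U, u) \<in> A. (\<lambda>w. f (inv_into U u w)) nicely_meromorphic_on u ` U)"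

definition remove_sings_surface :: "('a::t2_space \<Rightarrow> complex) \<Rightarrow> 'a \<Rightarrow> complex" where
  "remove_sings_surface f p = (if \<exists>c. (f \<longlongrightarrow> c) (at p) then Lim (at p) f else 0)"

definition meromorphic_field :: "'a::t2_space atlas \<Rightarrow> ('a \<Rightarrow> complex) ring" where
  "meromorphic_field A =
     \<lparr> carrier = {f. meromorphic_function A f},
       mult = (\<lambda>f g. remove_sings_surface (\<lambda>p. f p * g p)),
       one = (\<lambda>_. 1),
       zero = (\<lambda>_. 0),
       add = (\<lambda>f g. remove_sings_surface (\<lambda>p. f p + g p)) \<rparr>"

text \<open>
  For non-constant holomorphic \<open>X\<close>, the function \<open>f \<circ> X\<close> is again in the above form,
  because its poles are the preimages of the poles of \<open>f\<close>.
\<close>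

definition pullback_field :: "('a \<Rightarrow> 'b) \<Rightarrow> 'b::t2_space atlas \<Rightarrow> ('a \<Rightarrow> complex) set" where
  "pullback_field X B = {f \<circ> X | f. f \<in> carrier (meromorphic_field B)}"

definition compositum :: "('a, 'm) ring_scheme \<Rightarrow> 'a set \<Rightarrow> 'a set \<Rightarrow> 'a set" where
  "compositum F K L = generate_field F (K \<union> L)"

end

theory Submission
  imports Defs
begin

text \<open>
  Let \<open>h = f \<circ> X = g \<circ> Y\<close> be a non-constant element of the intersection, let \<open>d > 1\<close> be the gcd of
  the multiplicities at \<open>z0\<close> and let \<open>\<omega>\<close> be a \<open>d\<close>-th root of unity other than 1. In a local coordinate in which \<open>X\<close>
  is a power, rotation by \<open>\<omega>\<close> preserves \<open>X\<close>, hence \<open>h\<close>; likewise for \<open>Y\<close>. A local automorphism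
  preserving \<open>h\<close> is determined by its derivative at \<open>z0\<close>, so both rotations are the same map \<open>\<sigma>\<close>, and every
  function in the compositum is invariant under \<open>\<sigma>\<close> near \<open>z0\<close>.

  To contradict this one needs a meromorphic function on the surface that is not invariant under \<open>\<sigma>\<close>. It is
  obtained as \<open>\<partial>v / dh\<close> where \<open>v\<close> is harmonic away from \<open>z0\<close> with
  \<open>v = Re (1/z) + k ln \<bar>z\<bar> + O(1)\<close> at \<open>z0\<close>. Such a \<open>v\<close> comes from Schwarz's alternating method between a
  coordinate disc, where the Dirichlet problem is solved by the Poisson integral, and the complement of a smaller
  disc, where it is solved by Perron's method. A logarithmic term does no
  harm, so that \<open>k = 0\<close> need not be shown.
\<close>

section \<open>The Poisson integral\<close>

text \<open>The hypothesis on the compositum helps only if the surface carries a meromorphic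
  function that \<sigma> does not preserve. On an abstract compact surface the existence of such
  functions is the real obstacle, hence the large share of potential theory. The function is sought
  as a quotient of differentials because h already supplies one of them: since \<sigma> preserves h,
  it preserves dh, so the quotient is preserved exactly when the other differential is. Of the
  latter only the leading term at z0 matters. Pulling back dz / z^2 by a map with derivative
  \<omega> multiplies the leading coefficient by 1 / \<omega>, so a double pole rules out every
  \<omega> other than 1. A term k ln |z| in v contributes a simple pole to the differential and
  leaves this coefficient alone. That \<sigma> is determined by its derivative comes from the local
  form h = c + t^N, with N negative at a pole: in the coordinate t, a map preserving h is
  multiplication by a root of unity whose |N|-th power is 1.\<close>

definition unit_circle :: "real \<Rightarrow> complex" where
  "unit_circle t = exp (2 * of_real pi * \<i> * of_real t)"

text \<open>Equals (1 - |z|^2) / |e - z|^2 with e = \<open>unit_circle t\<close>. Keeping the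
  holomorphic kernel under the real part exhibits a Poisson integral as the real part of a
  \<open>schwarz_integral\<close>.\<close>

definition poisson_kernel :: "complex \<Rightarrow> real \<Rightarrow> real" where
  "poisson_kernel z t = Re ((unit_circle t + z) / (unit_circle t - z))"

definition poisson_integral :: "(complex \<Rightarrow> real) \<Rightarrow> complex \<Rightarrow> real" where
  "poisson_integral g z = integral {0..1} (\<lambda>t. g (unit_circle t) * poisson_kernel z t)"

definition schwarz_integral :: "(complex \<Rightarrow> real) \<Rightarrow> complex \<Rightarrow> complex" where
  "schwarz_integral g z =
     integral {0..1} (\<lambda>t. of_real (g (unit_circle t)) * ((unit_circle t + z) / (unit_circle t - z)))"

lemma norm_unit_circle [simp]: "norm (unit_circle t) = 1"
  by (simp add: unit_circle_def)

lemma continuous_on_unit_circle [continuous_intros]: "continuous_on S unit_circle"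
  unfolding unit_circle_def by (intro continuous_intros)

lemma unit_circle_neq [simp]: "norm z < 1 \<Longrightarrow> unit_circle t \<noteq> z"
  by auto

lemma continuous_on_compose_unit_circle:
  fixes g :: "complex \<Rightarrow> 'a::topological_space"
  assumes "continuous_on (sphere 0 1) g"
  shows "continuous_on S (\<lambda>t. g (unit_circle t))"
  by (rule continuous_on_compose2[OF assms continuous_on_unit_circle]) auto

lemma continuous_on_poisson_kernel:
  assumes "norm z < 1"
  shows "continuous_on S (poisson_kernel z)"
  unfolding poisson_kernel_def using assms by (intro continuous_intros) auto

text \<open>Cauchy's formula divided by 2 pi i. As \<open>unit_circle\<close> runs over [0,1] in the
  same way as \<open>circlepath\<close>, the integrals here are averages of total mass 1.\<close>

lemma has_integral_unit_circle_Cauchy: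
  assumes "continuous_on (cball 0 1) f" "f holomorphic_on ball 0 1" "norm w < 1"
  shows "((\<lambda>t. f (unit_circle t) * (unit_circle t / (unit_circle t - w))) has_integral f w) {0..1}"
proof -
  have "((\<lambda>u. f u / (u - w)) has_contour_integral (2 * of_real pi * \<i> * f w)) (circlepath 0 1)"
    by (rule Cauchy_integral_circlepath) (use assms in auto)
  then have "((\<lambda>t. f (unit_circle t) / (unit_circle t - w) * (2 * of_real pi * \<i> * unit_circle t))
     has_integral (2 * of_real pi * \<i> * f w)) {0..1}"
    unfolding has_contour_integral vector_derivative_circlepath
    by (simp add: circlepath unit_circle_def)
  from has_integral_mult_right[OF this, of "1 / (2 * of_real pi * \<i>)"]
  show ?thesis by (simp add: field_simps)
qed

lemma has_integral_unit_circle_mean: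
  assumes "continuous_on (cball 0 1) f" "f holomorphic_on ball 0 1"
  shows "((\<lambda>t. f (unit_circle t)) has_integral f 0) {0..1}"
  using has_integral_unit_circle_Cauchy[OF assms, of 0] by (simp add: unit_circle_def)

lemma integrable_unit_circle_kernel:
  assumes "continuous_on (sphere 0 1) g" "norm z < 1"
  shows "(\<lambda>t. complex_of_real (g (unit_circle t)) * ((unit_circle t + z) / (unit_circle t - z)))
           integrable_on {0..1}"
  by (rule integrable_continuous_real)
     (use assms in \<open>intro continuous_intros continuous_on_compose_unit_circle, auto\<close>)

lemma integrable_poisson:
  assumes "continuous_on (sphere 0 1) g" "norm z < 1"
  shows "(\<lambda>t. g (unit_circle t) * poisson_kernel z t) integrable_on {0..1}"
  by (rule integrable_continuous_real)
     (use assms in \<open>intro continuous_intros continuous_on_compose_unit_circle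
        continuous_on_poisson_kernel, auto\<close>)

lemma poisson_integral_eq_Re:
  assumes "continuous_on (sphere 0 1) g" "norm z < 1"
  shows "poisson_integral g z = Re (schwarz_integral g z)"
proof -
  have "((\<lambda>t. Re (complex_of_real (g (unit_circle t)) * ((unit_circle t + z) / (unit_circle t - z))))
     has_integral Re (schwarz_integral g z)) {0..1}"
    unfolding schwarz_integral_def
    by (intro has_integral_Re integrable_integral integrable_unit_circle_kernel assms)
  then show ?thesis
    unfolding poisson_integral_def poisson_kernel_def
    by (intro integral_unique) (simp del: times_divide_eq_right)
qed

lemma holomorphic_schwarz_integral:
  assumes g: "continuous_on (sphere 0 1) g"
  shows "schwarz_integral g holomorphic_on ball 0 1"
proof -
  have "(\<lambda>z. integral (cbox 0 1)
          (\<lambda>t. of_real (g (unit_circle t)) * ((unit_circle t + z) / (unit_circle t - z))))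
          holomorphic_on ball 0 1"
  proof (rule leibniz_rule_holomorphic)
    fix x :: complex and t :: real
    assume x: "x \<in> ball 0 1"
    then have "unit_circle t - x \<noteq> 0" by auto
    then show "((\<lambda>z. of_real (g (unit_circle t)) * ((unit_circle t + z) / (unit_circle t - z)))
        has_field_derivative
        of_real (g (unit_circle t)) * (2 * unit_circle t / (unit_circle t - x)^2)) (at x within ball 0 1)"
      by (auto intro!: derivative_eq_intros simp: power2_eq_square field_simps)
  next
    fix x :: complex
    assume "x \<in> ball 0 1"
    then show "(\<lambda>t. complex_of_real (g (unit_circle t)) * ((unit_circle t + x) / (unit_circle t - x)))
           integrable_on cbox 0 1"
      using integrable_unit_circle_kernel[OF g, of x] by simp
  next
    have "continuous_on (ball 0 1 \<times> cbox 0 1) (\<lambda>p. complex_of_real (g (unit_circle (snd p))) *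
             (2 * unit_circle (snd p) / (unit_circle (snd p) - fst p)\<^sup>2))"
      by (intro continuous_intros continuous_on_compose2[OF g]
            continuous_on_compose2[OF continuous_on_unit_circle[of UNIV]]) auto
    then show "continuous_on (ball 0 1 \<times> cbox 0 1) (\<lambda>(x, t). complex_of_real (g (unit_circle t)) *
             (2 * unit_circle t / (unit_circle t - x)\<^sup>2))"
      by (simp add: case_prod_unfold)
  qed auto
  then show ?thesis
    by (simp add: schwarz_integral_def[abs_def])
qed

lemma poisson_kernel_nonneg:
  assumes "norm z < 1"
  shows "poisson_kernel z t \<ge> 0"
proof -
  let ?e = "unit_circle t"
  have "Re ((?e + z) * cnj (?e - z)) = (norm ?e)\<^sup>2 - (norm z)\<^sup>2"
    unfolding cmod_power2 by (simp add: algebra_simps power2_eq_square)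
  also have "\<dots> \<ge> 0"
    using assms by (simp add: abs_square_le_1)
  finally have "Re ((?e + z) * cnj (?e - z)) \<ge> 0" .
  then show ?thesis
    unfolding poisson_kernel_def complex_div_cnj[of "?e + z"]
    by (simp add: Re_divide_of_real flip: of_real_power)
qed

text \<open>The difference is Re (2 z / (e - z)) with e on the unit circle. That the bound vanishes
  at the centre is behind both Harnack's inequality and the contraction in the alternating
  method.\<close>

lemma poisson_kernel_bound:
  assumes "norm z < 1"
  shows "\<bar>poisson_kernel z t - 1\<bar> \<le> 2 * norm z / (1 - norm z)"
proof -
  let ?e = "unit_circle t"
  have "?e - z \<noteq> 0" using assms by auto
  then have eq: "(?e + z) / (?e - z) - 1 = 2 * z / (?e - z)"
    by (simp add: field_simps)
  have "\<bar>poisson_kernel z t - 1\<bar> = \<bar>Re (2 * z / (?e - z))\<bar>"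
    unfolding poisson_kernel_def by (simp flip: eq)
  also have "\<dots> \<le> norm (2 * z / (?e - z))" by (rule abs_Re_le_cmod)
  also have "\<dots> = 2 * norm z / norm (?e - z)" by (simp add: norm_divide norm_mult)
  also have "\<dots> \<le> 2 * norm z / (1 - norm z)"
  proof (rule divide_left_mono)
    show "1 - norm z \<le> norm (?e - z)"
      using norm_triangle_ineq2[of ?e z] by simp
    show "0 < norm (?e - z) * (1 - norm z)"
      using assms by auto
  qed auto
  finally show ?thesis .
qed

text \<open>Against the kernel (e + w) / (e - w), Cauchy's formula gives 2 f(w) - f(0). On the
  circle the conjugate of that kernel agrees with (1 + cnj w z) / (1 - cnj w z), which is
  holomorphic in the disc and 1 at the centre, so it gives f(0). Half the sum of the two kernels is
  the Poisson kernel, and the result is f(w).\<close>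

lemma poisson_integral_Re:
  assumes "continuous_on (cball 0 1) f" "f holomorphic_on ball 0 1" "norm w < 1"
  shows "poisson_integral (\<lambda>z. Re (f z)) w = Re (f w)"
proof -
  have "((\<lambda>t. 2 * (f (unit_circle t) * (unit_circle t / (unit_circle t - w))) - f (unit_circle t))
     has_integral 2 * f w - f 0) {0..1}"
    by (intro has_integral_diff has_integral_mult_right has_integral_unit_circle_Cauchy
        has_integral_unit_circle_mean assms)
  then have 1: "((\<lambda>t. f (unit_circle t) * ((unit_circle t + w) / (unit_circle t - w)))
     has_integral 2 * f w - f 0) {0..1}"
    by (rule has_integral_eq_rhs[OF has_integral_eq, rotated])
       (use assms in \<open>auto simp: field_simps\<close>)
  let ?k = "\<lambda>z. (1 + cnj w * z) / (1 - cnj w * z)"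
  have nz: "1 - cnj w * z \<noteq> 0" if "norm z \<le> 1" for z
  proof
    assume "1 - cnj w * z = 0"
    then have "1 = norm (cnj w * z)" by (metis eq_iff_diff_eq_0 norm_one)
    also have "\<dots> \<le> norm w * 1" unfolding norm_mult complex_mod_cnj
      using that by (intro mult_left_mono) auto
    finally show False using assms by simp
  qed
  have "((\<lambda>t. f (unit_circle t) * ?k (unit_circle t)) has_integral f 0 * ?k 0) {0..1}"
    by (rule has_integral_unit_circle_mean)
       (use assms nz in \<open>auto intro!: continuous_intros holomorphic_intros\<close>)
  then have 2: "((\<lambda>t. f (unit_circle t) * ?k (unit_circle t)) has_integral f 0) {0..1}"
    by simp
  have k: "?k (unit_circle t) = cnj ((unit_circle t + w) / (unit_circle t - w))" for t
  proof -
    have "unit_circle t * cnj (unit_circle t) = 1"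
      by (simp add: complex_norm_square[symmetric])
    then have *: "1 = unit_circle t * cnj (unit_circle t)" ..
    have "?k (unit_circle t) = (unit_circle t * cnj (unit_circle t + w)) / (unit_circle t * cnj (unit_circle t - w))"
      by (subst (1 2) *) (simp add: algebra_simps)
    then show ?thesis by (simp add: unit_circle_def)
  qed
  have Re_mult: "Re (a * b + a * cnj b) / 2 = Re a * Re b" for a b
    by (simp add: algebra_simps)
  have "((\<lambda>t. Re (f (unit_circle t) * ((unit_circle t + w) / (unit_circle t - w)) +
                 f (unit_circle t) * ?k (unit_circle t)) / 2) has_integral Re ((2 * f w - f 0) + f 0) / 2) {0..1}"
    by (intro has_integral_divide has_integral_Re has_integral_add 1 2)
  then have "((\<lambda>t. Re (f (unit_circle t)) * poisson_kernel w t) has_integral Re (f w)) {0..1}"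
    by (simp only: k Re_mult) (simp add: poisson_kernel_def)
  then show ?thesis
    unfolding poisson_integral_def by (rule integral_unique)
qed

lemma poisson_integral_const [simp]: "norm z < 1 \<Longrightarrow> poisson_integral (\<lambda>_. c) z = c"
  using poisson_integral_Re[of "\<lambda>_. of_real c" z] by simp

lemma poisson_integral_zero:
  "poisson_integral g 0 = integral {0..1} (\<lambda>t. g (unit_circle t))"
  by (simp add: poisson_integral_def poisson_kernel_def unit_circle_def)

lemma poisson_integral_diff:
  assumes "continuous_on (sphere 0 1) f" "continuous_on (sphere 0 1) g" "norm z < 1"
  shows "poisson_integral (\<lambda>w. f w - g w) z = poisson_integral f z - poisson_integral g z"
  unfolding poisson_integral_def
  by (subst integral_diff[symmetric]) (use assms in \<open>auto intro!: integrable_poisson simp: left_diff_distrib\<close>)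

lemma poisson_integral_cmult:
  "poisson_integral (\<lambda>w. c * f w) z = c * poisson_integral f z"
  unfolding poisson_integral_def by (simp add: mult.assoc)

lemma poisson_integral_mono:
  assumes "continuous_on (sphere 0 1) f" "continuous_on (sphere 0 1) g" "norm z < 1"
    and "\<And>w. norm w = 1 \<Longrightarrow> f w \<le> g w"
  shows "poisson_integral f z \<le> poisson_integral g z"
  unfolding poisson_integral_def
  by (intro integral_le integrable_poisson assms mult_right_mono poisson_kernel_nonneg)
     (auto intro!: assms)

lemma poisson_integral_abs_le:
  assumes "continuous_on (sphere 0 1) g" "norm z < 1" "\<And>w. norm w = 1 \<Longrightarrow> \<bar>g w\<bar> \<le> M"
  shows "\<bar>poisson_integral g z\<bar> \<le> M"
proof -
  have "g w \<le> M" "- M \<le> g w" if "norm w = 1" for w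
    using assms(3)[OF that] by linarith+
  then show ?thesis
    using poisson_integral_mono[OF assms(1) _ assms(2), of "\<lambda>_. M"]
      poisson_integral_mono[OF _ assms(1) assms(2), of "\<lambda>_. -M"] assms(2)
    by fastforce
qed

text \<open>The factor is below 1 when norm z < 1/3. It becomes the contraction constant of the
  alternating method, where interior solutions are normalised at the centre.\<close>

lemma poisson_integral_center_diff:
  assumes g: "continuous_on (sphere 0 1) g" and z: "norm z < 1"
    and M: "\<And>w. norm w = 1 \<Longrightarrow> \<bar>g w\<bar> \<le> M"
  shows "\<bar>poisson_integral g z - poisson_integral g 0\<bar> \<le> 2 * norm z / (1 - norm z) * M"
proof -
  have "poisson_integral g z - poisson_integral g 0 =
      integral {0..1} (\<lambda>t. g (unit_circle t) * poisson_kernel z t - g (unit_circle t) * poisson_kernel 0 t)"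
    unfolding poisson_integral_def
    by (intro integral_diff[symmetric] integrable_poisson assms) auto
  also have "\<dots> = integral {0..1} (\<lambda>t. g (unit_circle t) * (poisson_kernel z t - 1))"
    by (simp add: poisson_kernel_def algebra_simps unit_circle_def)
  also have "norm \<dots> \<le> (2 * norm z / (1 - norm z) * M) * (1 - 0)"
  proof (rule integral_bound)
    fix t :: real
    have "norm (g (unit_circle t) * (poisson_kernel z t - 1)) \<le> M * (2 * norm z / (1 - norm z))"
      unfolding norm_mult using M[of "unit_circle t"] poisson_kernel_bound[OF z, of t]
      by (intro mult_mono) auto
    then show "norm (g (unit_circle t) * (poisson_kernel z t - 1)) \<le> 2 * norm z / (1 - norm z) * M"
      by (simp add: mult_ac)
  qed (auto intro!: continuous_on_mult continuous_on_diff continuous_on_const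
        continuous_on_compose_unit_circle g continuous_on_poisson_kernel z)
  finally show ?thesis by simp
qed

text \<open>By \<open>poisson_kernel_bound\<close> the kernel is at most 1 + 2 |z| / (1 - |z|),
  which is the quotient in front; multiplying by nonnegative boundary values keeps this bound under
  the integral.\<close>

lemma poisson_integral_harnack:
  assumes g: "continuous_on (sphere 0 1) g" and z: "norm z < 1"
    and nonneg: "\<And>w. norm w = 1 \<Longrightarrow> 0 \<le> g w"
  shows "poisson_integral g z \<le> (1 + norm z) / (1 - norm z) * poisson_integral g 0"
proof -
  have k: "poisson_kernel z t \<le> (1 + norm z) / (1 - norm z)" for t
  proof -
    have "poisson_kernel z t \<le> 1 + 2 * norm z / (1 - norm z)"
      using poisson_kernel_bound[OF z, of t] by linarith
    also have "\<dots> = (1 + norm z) / (1 - norm z)" using z by (simp add: field_simps)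
    finally show ?thesis .
  qed
  have le: "g (unit_circle t) * poisson_kernel z t \<le> (1 + norm z) / (1 - norm z) * g (unit_circle t)" for t
    using mult_left_mono[OF k nonneg[of "unit_circle t"]] by (simp only: mult.commute norm_unit_circle)
  have "poisson_integral g z \<le> integral {0..1} (\<lambda>t. (1 + norm z) / (1 - norm z) * g (unit_circle t))"
    unfolding poisson_integral_def
    by (intro integral_le integrable_poisson g z integrable_continuous_real
        continuous_on_mult_left[OF continuous_on_compose_unit_circle[OF g]])
       (use le in auto)
  then show ?thesis by (simp add: poisson_integral_zero)
qed

text \<open>
  Korovkin's argument for the boundary values: \<open>\<bar>g w - g z0\<bar>\<close> is dominated
  by \<open>\<epsilon> + C \<bar>w - z0\<bar>\<^sup>2\<close>, which agrees on the unit circle with a harmonic function that is \<open>\<epsilon>\<close> at \<open>z0\<close>.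
\<close>

lemma dominated_by_square:
  fixes g :: "'a::metric_space \<Rightarrow> real"
  assumes S: "compact S" and g: "continuous_on S g" and z0: "z0 \<in> S" and e: "e > 0"
  obtains C where "C \<ge> 0" "\<And>w. w \<in> S \<Longrightarrow> \<bar>g w - g z0\<bar> \<le> e + C * (dist w z0)\<^sup>2"
proof -
  obtain d where d: "d > 0" "\<And>w. w \<in> S \<Longrightarrow> dist w z0 < d \<Longrightarrow> \<bar>g w - g z0\<bar> < e"
    using g z0 e unfolding continuous_on_iff dist_real_def by metis
  obtain M where M: "\<And>w. w \<in> S \<Longrightarrow> \<bar>g w\<bar> \<le> M"
    using compact_imp_bounded[OF compact_continuous_image[OF g S]]
    unfolding bounded_iff by auto
  have M0: "M \<ge> 0" using M[OF z0] by linarith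
  show thesis
  proof (rule that[of "2 * M / d\<^sup>2"])
    show "2 * M / d\<^sup>2 \<ge> 0" using M0 by simp
    fix w assume w: "w \<in> S"
    show "\<bar>g w - g z0\<bar> \<le> e + 2 * M / d\<^sup>2 * (dist w z0)\<^sup>2"
    proof (cases "dist w z0 < d")
      case True
      have "0 \<le> 2 * M / d\<^sup>2 * (dist w z0)\<^sup>2" using M0 by simp
      then show ?thesis using d(2)[OF w True] by linarith
    next
      case False
      then have "d\<^sup>2 \<le> (dist w z0)\<^sup>2" using d by (intro power_mono) auto
      then have "2 * M * 1 \<le> 2 * M * ((dist w z0)\<^sup>2 / d\<^sup>2)"
        using M0 d by (intro mult_left_mono) auto
      then show ?thesis using M[OF w] M[OF z0] e by simp
    qed
  qed
qed

text \<open>On a circle the squared distance becomes the real part of an affine function of w, hence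
  harmonic boundary data. Used on the unit circle and, through \<open>barrier_circle\<close>, on the
  circle of radius r.\<close>

lemma norm_diff_circle:
  assumes "norm w = r" "norm z = r"
  shows "(dist w z)\<^sup>2 = 2 * r\<^sup>2 - 2 * Re (w * cnj z)"
proof -
  have "(dist w z)\<^sup>2 = (norm w)\<^sup>2 + (norm z)\<^sup>2 - 2 * Re (w * cnj z)"
    unfolding dist_norm cmod_power2 by (simp add: algebra_simps power2_eq_square)
  then show ?thesis using assms by simp
qed

lemma poisson_integral_boundary:
  assumes g: "continuous_on (sphere 0 1) g" and z0: "norm z0 = 1" and e: "e > 0"
  shows "\<forall>\<^sub>F z in nhds z0. norm z < 1 \<longrightarrow> \<bar>poisson_integral g z - g z0\<bar> < e"
proof -
  obtain C where C: "C \<ge> 0" "\<And>w. norm w = 1 \<Longrightarrow> \<bar>g w - g z0\<bar> \<le> e / 2 + C * (dist w z0)\<^sup>2"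
    using dominated_by_square[OF compact_sphere g, of z0 "e/2"] z0 e by auto
  \<comment> \<open>On the unit circle \<open>?b\<close> is e/2 + C |w - z0|^2 by
    \<open>norm_diff_circle\<close>. Its extension to the disc is the real part of an affine
    function and takes the value e/2 at \<open>z0\<close>.\<close>
  let ?k = "\<lambda>z. of_real (e / 2) + of_real C * (2 - 2 * (z * cnj z0))"
  let ?b = "\<lambda>z. Re (?k z)"
  have bd: "\<bar>poisson_integral g z - g z0\<bar> \<le> ?b z" if z: "norm z < 1" for z
  proof -
    have b: "\<bar>g w - g z0\<bar> \<le> ?b w" if "norm w = 1" for w
      using C(2)[OF that] norm_diff_circle[OF that z0] by (simp add: mult.assoc)
    have cb: "continuous_on (sphere 0 1) ?b" by (intro continuous_intros)
    have P: "poisson_integral ?b z = ?b z"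
      by (rule poisson_integral_Re) (use z in \<open>auto intro!: continuous_intros holomorphic_intros\<close>)
    have "poisson_integral g z - g z0 = poisson_integral (\<lambda>w. g w - g z0) z"
      using z by (subst poisson_integral_diff) (use g in auto)
    moreover have "poisson_integral (\<lambda>w. g w - g z0) z \<le> poisson_integral ?b z"
      by (rule poisson_integral_mono) (use g z cb b in \<open>auto intro!: continuous_intros simp: abs_le_iff\<close>)
    moreover have "poisson_integral (\<lambda>w. (-1) * (g w - g z0)) z \<le> poisson_integral ?b z"
      by (rule poisson_integral_mono) (use g z cb b in \<open>auto intro!: continuous_intros simp: abs_le_iff\<close>)
    ultimately show ?thesis using P by (simp only: poisson_integral_cmult)
  qed
  have "z0 * cnj z0 = 1" using z0 by (simp flip: complex_norm_square)
  then have b0: "?b z0 < e" using e by simp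
  have cont: "isCont ?b z0" by (intro isCont_Re isCont_add isCont_mult isCont_diff) auto
  have "\<forall>\<^sub>F z in nhds z0. ?b z < e"
    using order_tendstoD(2)[OF isContD[OF cont] b0] b0 by (simp add: eventually_nhds_conv_at)
  then show ?thesis
    by eventually_elim (use bd in fastforce)
qed

lemma continuous_on_poisson_extension:
  assumes g: "continuous_on (sphere 0 1) g"
  shows "continuous_on (cball 0 1) (\<lambda>z. if norm z < 1 then poisson_integral g z else g z)"
    (is "continuous_on _ ?h")
  unfolding continuous_on_def
proof
  fix z0 :: complex assume z0: "z0 \<in> cball 0 1"
  show "(?h \<longlongrightarrow> ?h z0) (at z0 within cball 0 1)"
  proof (cases "norm z0 < 1")
    case True
    have "(\<lambda>z. Re (schwarz_integral g z)) \<midarrow>z0\<rightarrow> Re (schwarz_integral g z0)"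
      using holomorphic_on_imp_continuous_on[OF holomorphic_schwarz_integral[OF g]] True
      by (intro tendsto_intros) (auto simp: continuous_on_eq_continuous_at isCont_def)
    then have "?h \<midarrow>z0\<rightarrow> ?h z0"
    proof (rule Lim_transform_eventually[THEN tendsto_eq_rhs])
      have "\<forall>\<^sub>F z in at z0. z \<in> ball 0 1"
        using True by (intro eventually_at_in_open') auto
      then show "\<forall>\<^sub>F z in at z0. Re (schwarz_integral g z) = ?h z"
        by eventually_elim (simp add: poisson_integral_eq_Re[OF g])
    qed (simp add: True poisson_integral_eq_Re[OF g])
    then show ?thesis by (rule filterlim_mono) (simp_all add: at_le)
  next
    case False
    then have n0: "norm z0 = 1" using z0 by auto
    show ?thesis
    proof (rule tendstoI)
      fix e :: real assume e: "e > 0"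
      have 1: "\<forall>\<^sub>F z in at z0 within cball 0 1. norm z < 1 \<longrightarrow> \<bar>poisson_integral g z - g z0\<bar> < e"
        using poisson_integral_boundary[OF g n0 e] eventually_nhds_conv_at
          eventually_at_filter by (metis (mono_tags, lifting) eventually_mono)
      have "(g \<longlongrightarrow> g z0) (at z0 within sphere 0 1)"
        using g n0 by (auto simp: continuous_on_def)
      then have "\<forall>\<^sub>F z in at z0 within sphere 0 1. dist (g z) (g z0) < e"
        using e by (rule tendstoD)
      then have "\<forall>\<^sub>F z in at z0 within cball 0 1. norm z = 1 \<longrightarrow> dist (g z) (g z0) < e"
        unfolding eventually_at_filter by eventually_elim auto
      with 1 show "\<forall>\<^sub>F z in at z0 within cball 0 1. dist (?h z) (?h z0) < e"
        unfolding eventually_at_filter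
        by eventually_elim (use n0 in \<open>auto simp: dist_real_def\<close>)
    qed
  qed
qed

section \<open>Harmonic and subharmonic functions on a Riemann surface\<close>

text \<open>Local statements are phrased with filters throughout. This transport serves both the
  charts of the atlas and the rescaled coordinates of discs.\<close>

lemma homeomorphism_eventually_nhds:
  fixes k :: "'a::t2_space \<Rightarrow> 'b::t2_space"
  assumes "homeomorphism S T k d" "open S" "open T" "p \<in> S"
  shows "eventually P (nhds p) \<longleftrightarrow> eventually (\<lambda>w. P (d w)) (nhds (k p))"
proof
  have dk: "d (k p) = p" and kp: "k p \<in> T"
    using assms by (auto simp: homeomorphism_def)
  have "isCont d (k p)"
    using assms(1,3) kp by (auto simp: homeomorphism_def continuous_on_eq_continuous_at)
  then have d: "(d \<longlongrightarrow> d (k p)) (nhds (k p))"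
    unfolding isCont_def tendsto_at_iff_tendsto_nhds .
  have "isCont k p"
    using assms by (auto simp: homeomorphism_def continuous_on_eq_continuous_at)
  then have k: "(k \<longlongrightarrow> k p) (nhds p)"
    unfolding isCont_def tendsto_at_iff_tendsto_nhds .
  show "eventually (\<lambda>w. P (d w)) (nhds (k p))" if "eventually P (nhds p)"
    using that d unfolding dk by (rule eventually_compose_filterlim)
  show "eventually P (nhds p)" if "eventually (\<lambda>w. P (d w)) (nhds (k p))"
  proof -
    have "\<forall>\<^sub>F q in nhds p. P (d (k q))"
      using that k by (rule eventually_compose_filterlim)
    moreover have "\<forall>\<^sub>F q in nhds p. q \<in> S"
      using assms by (intro eventually_nhds_in_open)
    ultimately show ?thesis
      by eventually_elim (use assms(1) in \<open>auto simp: homeomorphism_def\<close>)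
  qed
qed

lemma homeomorphism_eventually_at:
  fixes k :: "'a::t2_space \<Rightarrow> 'b::t2_space"
  assumes "homeomorphism S T k d" "open S" "open T" "p \<in> S"
  shows "eventually P (at p) \<longleftrightarrow> eventually (\<lambda>w. P (d w)) (at (k p))"
proof -
  have "d w = p \<longleftrightarrow> w = k p" if "w \<in> T" for w
    using assms(1,4) that by (metis homeomorphism_def)
  moreover have "\<forall>\<^sub>F w in nhds (k p). w \<in> T"
    using assms by (intro eventually_nhds_in_open) (auto simp: homeomorphism_def)
  ultimately have "(\<forall>\<^sub>F w in nhds (k p). d w \<noteq> p \<longrightarrow> P (d w)) \<longleftrightarrow>
      (\<forall>\<^sub>F w in nhds (k p). w \<noteq> k p \<longrightarrow> P (d w))"
    by (intro eventually_subst) (auto elim!: eventually_mono)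
  then show ?thesis
    unfolding eventually_at_filter using homeomorphism_eventually_nhds[OF assms] by simp
qed

lemma homeomorphism_open_image:
  assumes "homeomorphism S T k d" "open S" "open T" "B \<subseteq> S" "open B"
  shows "open (k ` B)"
proof -
  have "openin (top_of_set T) (k ` B)"
    using assms by (intro homeomorphism_imp_open_map[OF assms(1)])
      (metis inf.absorb_iff2 openin_open_Int)
  then show ?thesis using assms(3) openin_open_trans by blast
qed

lemma eventually_analytic_at:
  assumes "f analytic_on {z}"
  shows "\<forall>\<^sub>F w in nhds z. f analytic_on {w}"
proof -
  obtain S where S: "open S" "z \<in> S" "f holomorphic_on S"
    using assms by (auto simp: analytic_at)
  then have "\<forall>\<^sub>F w in nhds z. w \<in> S" by (intro eventually_nhds_in_open)
  then show ?thesis by eventually_elim (use S in \<open>auto simp: analytic_at\<close>)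
qed

text \<open>The maximum modulus principle is applied to exp F, whose modulus is exp (Re F).\<close>

lemma Re_analytic_local_max:
  assumes F: "F analytic_on {z}" and max: "\<forall>\<^sub>F w in nhds z. Re (F w) \<le> Re (F z)"
  shows "\<forall>\<^sub>F w in nhds z. Re (F w) = Re (F z)"
proof -
  obtain S where S: "open S" "z \<in> S" "F holomorphic_on S"
    using F by (auto simp: analytic_at)
  obtain T where T: "open T" "z \<in> T" "\<And>w. w \<in> T \<Longrightarrow> Re (F w) \<le> Re (F z)"
    using max by (auto simp: eventually_nhds)
  obtain r where r: "r > 0" "ball z r \<subseteq> S \<inter> T"
    using S T by (meson IntI open_Int open_contains_ball)
  have "(\<lambda>w. exp (F w)) constant_on ball z r"
  proof (rule maximum_modulus_principle[of _ _ "ball z r" z])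
    show "(\<lambda>w. exp (F w)) holomorphic_on ball z r"
      using S r by (intro holomorphic_intros) (auto intro: holomorphic_on_subset)
  qed (use r T in auto)
  then have "norm (exp (F w)) = norm (exp (F z))" if "w \<in> ball z r" for w
    using that r by (metis centre_in_ball constant_on_def)
  then have eq: "Re (F w) = Re (F z)" if "w \<in> ball z r" for w
    using that by simp
  have "\<forall>\<^sub>F w in nhds z. w \<in> ball z r" using r by (intro eventually_nhds_in_open) auto
  then show ?thesis by (rule eventually_mono) (rule eq)
qed

text \<open>If F - G had a nonzero derivative at z, it would be open near z and take a value with
  positive real part. The lemma makes F' a function of the harmonic function Re F alone, which is
  what \<open>diff_quot\<close> rests on.\<close>

lemma Re_eq_imp_deriv_eq:
  assumes F: "F analytic_on {z}" and G: "G analytic_on {z}"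
    and eq: "\<forall>\<^sub>F w in nhds z. Re (F w) = Re (G w)"
  shows "deriv F z = deriv G z"
proof (rule ccontr)
  assume ne: "deriv F z \<noteq> deriv G z"
  define D where "D w = F w - G w" for w
  have "D analytic_on {z}" unfolding D_def using F G by (intro analytic_intros)
  then obtain S where S: "open S" "z \<in> S" "D holomorphic_on S" by (auto simp: analytic_at)
  obtain T where T: "open T" "z \<in> T" "\<And>w. w \<in> T \<Longrightarrow> Re (D w) = 0"
    using eq by (auto simp: eventually_nhds D_def)
  have hol: "D holomorphic_on S \<inter> T" using S(3) by (rule holomorphic_on_subset) auto
  have "(D has_field_derivative deriv F z - deriv G z) (at z)"
    unfolding D_def by (intro DERIV_diff analytic_derivI F G)
  then have "deriv D z = deriv F z - deriv G z" by (rule DERIV_imp_deriv)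
  then have dD: "deriv D z \<noteq> 0" using ne by simp
  obtain r where r: "r > 0" "ball z r \<subseteq> S \<inter> T" "inj_on D (ball z r)"
    by (rule has_complex_derivative_locally_injective[OF hol _ _ dD]) (use S T in auto)
  have "open (D ` ball z r)"
    by (rule open_mapping_thm3[OF holomorphic_on_subset[OF hol r(2)] open_ball r(3)])
  then obtain e where e: "e > 0" "ball (D z) e \<subseteq> D ` ball z r"
    using open_contains_ball_eq[of "D ` ball z r" "D z"] r(1) by auto
  have "D z + of_real (e / 2) \<in> ball (D z) e" using e(1) by (simp add: dist_norm)
  then obtain w where w: "w \<in> ball z r" "D z + of_real (e / 2) = D w" using e(2) by blast
  have "Re (D z) + e / 2 = Re (D w)" unfolding w(2)[symmetric] by simp
  then show False using T(3)[of w] T(3)[of z] T(2) w(1) r(2) e(1) by auto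
qed

section \<open>Charts and harmonic functions\<close>

context riemann_surface
begin

lemma chart_inv_into: "(U, u) \<in> A \<Longrightarrow> p \<in> U \<Longrightarrow> inv_into U u (u p) = p"
  using chart_homeomorphism by (auto simp: homeomorphism_def)

lemma chart_inv_into': "(U, u) \<in> A \<Longrightarrow> w \<in> u ` U \<Longrightarrow> u (inv_into U u w) = w"
  by (rule f_inv_into_f)

lemma chart_eventually_nhds:
  assumes "(U, u) \<in> A" "p \<in> U"
  shows "eventually P (nhds p) \<longleftrightarrow> eventually (\<lambda>w. P (inv_into U u w)) (nhds (u p))"
  using homeomorphism_eventually_nhds[OF chart_homeomorphism[OF assms(1)]] chart_open[OF assms(1)] assms(2)
  by blast

lemma chart_eventually_at:
  assumes "(U, u) \<in> A" "p \<in> U"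
  shows "eventually P (at p) \<longleftrightarrow> eventually (\<lambda>w. P (inv_into U u w)) (at (u p))"
  using homeomorphism_eventually_at[OF chart_homeomorphism[OF assms(1)]] chart_open[OF assms(1)] assms(2)
  by blast

lemma chart_open_image:
  assumes "(U, u) \<in> A" "B \<subseteq> U" "open B"
  shows "open (u ` B)"
  using homeomorphism_open_image[OF chart_homeomorphism[OF assms(1)]] chart_open[OF assms(1)] assms
  by blast

lemma transition_analytic:
  assumes "(U, u) \<in> A" "(V, v) \<in> A" "p \<in> U" "p \<in> V"
  shows "(\<lambda>w. v (inv_into U u w)) analytic_on {u p}"
  unfolding analytic_at
  using transition_holomorphic[OF assms(1,2)] chart_open_image[OF assms(1), of "U \<inter> V"]
    chart_open[OF assms(1)] chart_open[OF assms(2)] assms(3,4)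
  by (intro exI[of _ "u ` (U \<inter> V)"]) auto

lemma chart_isCont:
  assumes "(U, u) \<in> A" "p \<in> U"
  shows "isCont u p"
  using chart_homeomorphism[OF assms(1)] chart_open[OF assms(1)] assms(2)
  by (auto simp: homeomorphism_def continuous_on_eq_continuous_at)

text \<open>Local real parts are used in place of Laplace's equation: holomorphic transition maps
  act on them by composition, and F is also what gets differentiated in \<open>diff_quot\<close>.
  One chart suffices here; \<open>harmonic_atE\<close> moves to any other.\<close>

definition harmonic_at :: "('a \<Rightarrow> real) \<Rightarrow> 'a \<Rightarrow> bool" where
  "harmonic_at f p \<longleftrightarrow> (\<exists>(U, u)\<in>A. p \<in> U \<and>
     (\<exists>F. F analytic_on {u p} \<and> (\<forall>\<^sub>F q in nhds p. f q = Re (F (u q)))))"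

lemma harmonic_atI:
  assumes "(U, u) \<in> A" "p \<in> U" "F analytic_on {u p}" "\<forall>\<^sub>F q in nhds p. f q = Re (F (u q))"
  shows "harmonic_at f p"
  using assms unfolding harmonic_at_def by blast

lemma harmonic_atE:
  assumes "harmonic_at f p" "(U, u) \<in> A" "p \<in> U"
  obtains F where "F analytic_on {u p}" "\<forall>\<^sub>F q in nhds p. f q = Re (F (u q))"
proof -
  obtain V v G where G: "(V, v) \<in> A" "p \<in> V" "G analytic_on {v p}"
      "\<forall>\<^sub>F q in nhds p. f q = Re (G (v q))"
    using assms(1) unfolding harmonic_at_def by auto
  let ?F = "G \<circ> (\<lambda>w. v (inv_into U u w))"
  have "?F analytic_on {u p}"
    by (rule analytic_on_compose[OF transition_analytic])
       (use G assms(2,3) chart_inv_into in auto)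
  moreover have "\<forall>\<^sub>F q in nhds p. q \<in> U"
    using assms chart_open by (intro eventually_nhds_in_open) auto
  with G(4) have "\<forall>\<^sub>F q in nhds p. f q = Re (?F (u q))"
    by eventually_elim (use assms(2) chart_inv_into in auto)
  ultimately show thesis by (rule that)
qed

lemma harmonic_at_cong:
  assumes "\<forall>\<^sub>F q in nhds p. f q = g q"
  shows "harmonic_at f p \<longleftrightarrow> harmonic_at g p"
proof -
  have "harmonic_at g p" if f: "harmonic_at f p" and fg: "\<forall>\<^sub>F q in nhds p. f q = g q" for f g
  proof -
    obtain U u where U: "(U, u) \<in> A" "p \<in> U" using charts_cover by blast
    obtain F where F: "F analytic_on {u p}" "\<forall>\<^sub>F q in nhds p. f q = Re (F (u q))"
      using harmonic_atE[OF f U] by blast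
    have "\<forall>\<^sub>F q in nhds p. g q = Re (F (u q))"
      using F(2) fg by eventually_elim auto
    then show ?thesis using harmonic_atI U F by blast
  qed
  from this[of f g] this[of g f] show ?thesis using assms by (auto simp: eq_commute)
qed

lemma harmonic_at_const [simp]: "harmonic_at (\<lambda>_. c) p"
proof -
  obtain U u where U: "(U, u) \<in> A" "p \<in> U" using charts_cover by blast
  show ?thesis by (rule harmonic_atI[OF U, of "\<lambda>_. of_real c"]) auto
qed

lemma harmonic_at_add:
  assumes "harmonic_at f p" "harmonic_at g p"
  shows "harmonic_at (\<lambda>q. f q + g q) p"
proof -
  obtain U u where U: "(U, u) \<in> A" "p \<in> U" using charts_cover by blast
  obtain F where F: "F analytic_on {u p}" "\<forall>\<^sub>F q in nhds p. f q = Re (F (u q))"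
    using harmonic_atE[OF assms(1) U] by blast
  obtain G where G: "G analytic_on {u p}" "\<forall>\<^sub>F q in nhds p. g q = Re (G (u q))"
    using harmonic_atE[OF assms(2) U] by blast
  show ?thesis
    by (rule harmonic_atI[OF U, of "\<lambda>w. F w + G w"])
       (use F G in \<open>auto intro!: analytic_intros elim: eventually_elim2\<close>)
qed

lemma harmonic_at_uminus:
  assumes "harmonic_at f p"
  shows "harmonic_at (\<lambda>q. - f q) p"
proof -
  obtain U u where U: "(U, u) \<in> A" "p \<in> U" using charts_cover by blast
  obtain F where F: "F analytic_on {u p}" "\<forall>\<^sub>F q in nhds p. f q = Re (F (u q))"
    using harmonic_atE[OF assms(1) U] by blast
  show ?thesis
    by (rule harmonic_atI[OF U, of "\<lambda>w. - F w"])
       (use F in \<open>auto intro!: analytic_intros elim: eventually_mono\<close>)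
qed

lemma harmonic_at_diff:
  assumes "harmonic_at f p" "harmonic_at g p"
  shows "harmonic_at (\<lambda>q. f q - g q) p"
  using harmonic_at_add[OF assms(1) harmonic_at_uminus[OF assms(2)]] by simp

lemma harmonic_at_isCont:
  assumes "harmonic_at f p"
  shows "isCont f p"
proof -
  obtain U u where U: "(U, u) \<in> A" "p \<in> U" using charts_cover by blast
  obtain F where F: "F analytic_on {u p}" "\<forall>\<^sub>F q in nhds p. f q = Re (F (u q))"
    using harmonic_atE[OF assms(1) U] by blast
  have "isCont (\<lambda>q. Re (F (u q))) p"
    by (intro isCont_Re isCont_o2[OF chart_isCont[OF U]] analytic_at_imp_isCont F)
  then show ?thesis using isCont_cong[OF F(2)] by simp
qed

lemma harmonic_at_local_max:
  assumes "harmonic_at f p" "\<forall>\<^sub>F q in nhds p. f q \<le> f p"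
  shows "\<forall>\<^sub>F q in nhds p. f q = f p"
proof -
  obtain U u where U: "(U, u) \<in> A" "p \<in> U" using charts_cover by blast
  obtain F where F: "F analytic_on {u p}" "\<forall>\<^sub>F q in nhds p. f q = Re (F (u q))"
    using harmonic_atE[OF assms(1) U] by blast
  have fp: "f p = Re (F (u p))" using F(2) eventually_nhds_x_imp_x by blast
  have inU: "\<forall>\<^sub>F w in nhds (u p). w \<in> u ` U"
    using chart_open[OF U(1)] U by (intro eventually_nhds_in_open) auto
  have ev: "\<forall>\<^sub>F w in nhds (u p). f (inv_into U u w) = Re (F w)"
    using F(2)[unfolded chart_eventually_nhds[OF U]] inU
    by eventually_elim (use U chart_inv_into'[OF U(1)] in simp)
  have "\<forall>\<^sub>F w in nhds (u p). Re (F w) \<le> Re (F (u p))"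
    using assms(2)[unfolded chart_eventually_nhds[OF U]] ev by eventually_elim (simp add: fp)
  then have "\<forall>\<^sub>F w in nhds (u p). Re (F w) = Re (F (u p))"
    using Re_analytic_local_max F(1) by blast
  with ev have "\<forall>\<^sub>F w in nhds (u p). f (inv_into U u w) = f p"
    by eventually_elim (simp add: fp)
  then show ?thesis using chart_eventually_nhds[OF U, of "\<lambda>q. f q = f p"] by simp
qed

text \<open>
  Subharmonicity is defined by comparison with harmonic functions at interior maxima. This
  condition is local and is visibly preserved by maxima and by Poisson modification.
\<close>

definition subharmonic_at :: "('a \<Rightarrow> real) \<Rightarrow> 'a \<Rightarrow> bool" where
  "subharmonic_at f p \<longleftrightarrow> (\<forall>g. harmonic_at g p \<longrightarrow>
     (\<forall>\<^sub>F q in nhds p. f q - g q \<le> f p - g p) \<longrightarrow> (\<forall>\<^sub>F q in nhds p. f q - g q = f p - g p))"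

lemma subharmonic_atD:
  assumes "subharmonic_at f p" "harmonic_at g p" "\<forall>\<^sub>F q in nhds p. f q - g q \<le> f p - g p"
  shows "\<forall>\<^sub>F q in nhds p. f q - g q = f p - g p"
  using assms unfolding subharmonic_at_def by blast

lemma harmonic_imp_subharmonic: "harmonic_at f p \<Longrightarrow> subharmonic_at f p"
  unfolding subharmonic_at_def using harmonic_at_local_max[OF harmonic_at_diff] by blast

text \<open>A harmonic function that h - g has a local maximum against also dominates f in the same
  way, and h is squeezed between. Maxima, Poisson modifications and functions glued along a circle
  are all reduced to this.\<close>

lemma subharmonic_at_touch:
  assumes f: "subharmonic_at f p" and le: "\<forall>\<^sub>F q in nhds p. f q \<le> h q" and eq: "h p = f p"
  shows "subharmonic_at h p"
  unfolding subharmonic_at_def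
proof (intro allI impI)
  fix g assume g: "harmonic_at g p" "\<forall>\<^sub>F q in nhds p. h q - g q \<le> h p - g p"
  from g(2) le have "\<forall>\<^sub>F q in nhds p. f q - g q \<le> f p - g p"
    by eventually_elim (simp add: eq)
  then have "\<forall>\<^sub>F q in nhds p. f q - g q = f p - g p" using subharmonic_atD f g(1) by blast
  with g(2) le show "\<forall>\<^sub>F q in nhds p. h q - g q = h p - g p"
    by eventually_elim (use eq in linarith)
qed

lemma subharmonic_at_cong:
  assumes "\<forall>\<^sub>F q in nhds p. f q = g q" "subharmonic_at f p"
  shows "subharmonic_at g p"
  using assms(1) eventually_nhds_x_imp_x[OF assms(1)]
  by (intro subharmonic_at_touch[OF assms(2)]) (auto elim: eventually_mono)

lemma subharmonic_at_max:
  assumes "subharmonic_at f p" "subharmonic_at g p"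
  shows "subharmonic_at (\<lambda>q. max (f q) (g q)) p"
proof (cases "f p \<le> g p")
  case True
  then show ?thesis by (intro subharmonic_at_touch[OF assms(2)]) auto
next
  case False
  then show ?thesis by (intro subharmonic_at_touch[OF assms(1)]) auto
qed

text \<open>If the bound failed, the set of maximum points would be nonempty, closed, contained in W
  and, by \<open>max\<close>, open, so it would be the whole surface, against
  \<open>W \<noteq> UNIV\<close>. The condition \<open>max\<close> is stated for f itself so that a
  subharmonic function minus a harmonic one can be inserted directly.\<close>

lemma maximum_principle:
  assumes K: "compact (K :: 'a set)" and W: "open W" "W \<subseteq> K" "W \<noteq> UNIV" and f: "continuous_on K f"
    and max: "\<And>p. p \<in> W \<Longrightarrow> \<forall>\<^sub>F q in nhds p. f q \<le> f p \<Longrightarrow> \<forall>\<^sub>F q in nhds p. f q = f p"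
    and bd: "\<And>p. p \<in> K - W \<Longrightarrow> f p \<le> B" and q: "q \<in> K"
  shows "f q \<le> (B :: real)"
proof (rule ccontr)
  assume not: "\<not> f q \<le> B"
  obtain m where m: "m \<in> K" "\<And>x. x \<in> K \<Longrightarrow> f x \<le> f m"
    using continuous_attains_sup[OF K _ f] q by blast
  let ?M = "{x \<in> K. f x = f m}"
  have MW: "?M \<subseteq> W" using not m(2)[OF q] bd by force
  have "closed ?M"
    by (rule continuous_closed_preimage_constant[OF f compact_imp_closed[OF K]])
  moreover have "open ?M"
    unfolding open_subopen[of ?M]
  proof
    fix p assume p: "p \<in> ?M"
    then have pW: "p \<in> W" using MW by blast
    have inW: "\<forall>\<^sub>F x in nhds p. x \<in> W" using pW W by (intro eventually_nhds_in_open)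
    then have "\<forall>\<^sub>F x in nhds p. f x \<le> f p"
      by eventually_elim (use m W p in auto)
    then have "\<forall>\<^sub>F x in nhds p. f x = f p" using max[OF pW] by blast
    with inW have "\<forall>\<^sub>F x in nhds p. x \<in> ?M"
      by eventually_elim (use p W in auto)
    then show "\<exists>T. open T \<and> p \<in> T \<and> T \<subseteq> ?M"
      unfolding eventually_nhds by auto
  qed
  ultimately have "?M = {} \<or> ?M = UNIV"
    using connected_surface connected_clopen[of "UNIV :: 'a set"] by auto
  then show False using m MW W by blast
qed

end

text \<open>The radius 2 leaves room around the closed unit disc, on whose boundary Poisson data are
  prescribed. The coordinate \<kappa> is an affine rescaling of a chart rather than a chart of the
  atlas; \<delta> is its inverse.\<close>

locale coordinate_disc = riemann_surface A for A :: "'a::t2_space atlas" +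
  fixes V :: "'a set" and \<kappa> :: "'a \<Rightarrow> complex" and \<delta> :: "complex \<Rightarrow> 'a"
  assumes disc_homeo: "homeomorphism V (ball 0 2) \<kappa> \<delta>"
    and disc_open: "open V"
    and disc_chart: "\<exists>(U, u)\<in>A. V \<subseteq> U \<and> (\<exists>a \<rho>. \<rho> > 0 \<and> (\<forall>q\<in>V. u q = a + of_real \<rho> * \<kappa> q))"

lemma (in riemann_surface) coordinate_disc_exists:
  assumes U: "(U, u) \<in> A" "p \<in> U" and \<Omega>: "open \<Omega>" "p \<in> \<Omega>"
  obtains V \<kappa> \<delta> \<rho> where "coordinate_disc A V \<kappa> \<delta>" "V \<subseteq> \<Omega>" "\<delta> 0 = p" "V \<subseteq> U" "\<rho> > 0"
    "\<And>q. q \<in> V \<Longrightarrow> u q = u p + of_real \<rho> * \<kappa> q"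
proof -
  have "open (u ` (U \<inter> \<Omega>))" using chart_open_image[OF U(1)] \<Omega> chart_open[OF U(1)] by blast
  then obtain e where e: "e > 0" "ball (u p) e \<subseteq> u ` (U \<inter> \<Omega>)"
    using U \<Omega> open_contains_ball_eq[of "u ` (U \<inter> \<Omega>)" "u p"] by blast
  \<comment> \<open>With this scale the disc of radius 2 in \<kappa> corresponds to the ball of
    radius e around \<open>u p\<close>.\<close>
  define \<rho> where "\<rho> = e / 2"
  have \<rho>: "\<rho> > 0" using e by (simp add: \<rho>_def)
  define T where "T = ball (u p) e"
  define \<kappa> where "\<kappa> q = (u q - u p) / of_real \<rho>" for q
  define \<delta> where "\<delta> z = inv_into U u (u p + of_real \<rho> * z)" for z
  define V where "V = inv_into U u ` T"
  have TU: "T \<subseteq> u ` U" using e by (auto simp: T_def)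
  have h: "homeomorphism U (u ` U) u (inv_into U u)" using chart_homeomorphism U by blast
  have VU: "V \<subseteq> U" using h TU by (auto simp: V_def homeomorphism_def)
  have uV: "u q \<in> T" if "q \<in> V" for q
    using that h TU by (auto simp: V_def homeomorphism_def)
  have T: "u p + of_real \<rho> * z \<in> T \<longleftrightarrow> z \<in> ball 0 2" for z
    using \<rho> by (auto simp: T_def dist_norm norm_mult \<rho>_def)
  have \<delta>V: "\<delta> z \<in> V" if "z \<in> ball 0 2" for z
    using that T by (auto simp: \<delta>_def V_def)
  have \<kappa>\<delta>: "\<kappa> (\<delta> z) = z" if "z \<in> ball 0 2" for z
  proof -
    have "u p + of_real \<rho> * z \<in> u ` U" using that T TU by blast
    then have "u (\<delta> z) = u p + of_real \<rho> * z" unfolding \<delta>_def by (rule f_inv_into_f)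
    then show ?thesis using \<rho> by (simp add: \<kappa>_def)
  qed
  have u_eq: "u q = u p + of_real \<rho> * \<kappa> q" for q using \<rho> by (simp add: \<kappa>_def)
  have \<kappa>V: "\<kappa> q \<in> ball 0 2" if "q \<in> V" for q
    using uV[OF that] T[of "\<kappa> q"] u_eq[of q] by auto
  have \<delta>\<kappa>: "\<delta> (\<kappa> q) = q" if "q \<in> V" for q
    using that VU chart_inv_into[OF U(1), of q] by (auto simp: \<delta>_def simp flip: u_eq)
  have hom: "homeomorphism V (ball 0 2) \<kappa> \<delta>"
  proof (rule homeomorphismI)
    show "continuous_on V \<kappa>"
      unfolding \<kappa>_def using VU h \<rho>
      by (intro continuous_intros continuous_on_subset[OF homeomorphism_cont1[OF h]]) auto
    show "continuous_on (ball 0 2) \<delta>"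
      unfolding \<delta>_def
      by (rule continuous_on_compose2[OF homeomorphism_cont2[OF h]])
         (use T TU in \<open>auto intro!: continuous_intros\<close>)
  qed (use \<delta>V \<kappa>V \<kappa>\<delta> \<delta>\<kappa> in auto)
  have openV: "open V"
    unfolding V_def
    by (rule homeomorphism_open_image[OF homeomorphism_symD[OF h]])
       (use chart_open[OF U(1)] TU in \<open>auto simp: T_def\<close>)
  have "coordinate_disc A V \<kappa> \<delta>"
    by unfold_locales (use hom openV U VU \<rho> u_eq in blast)+
  moreover have "V \<subseteq> \<Omega>"
  proof
    fix q assume q: "q \<in> V"
    then have "u q \<in> u ` (U \<inter> \<Omega>)" using uV e by (auto simp: T_def)
    then obtain x where "x \<in> U \<inter> \<Omega>" "u q = u x" by auto
    then show "q \<in> \<Omega>" using q VU chart_inv_into[OF U(1)] by (metis IntD1 IntD2 subsetD)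
  qed
  moreover have "\<delta> 0 = p" using U chart_inv_into by (simp add: \<delta>_def)
  ultimately show thesis using that VU \<rho> u_eq by blast
qed

section \<open>Poisson modification in a coordinate disc\<close>

context coordinate_disc
begin

lemma delta_kappa [simp]: "q \<in> V \<Longrightarrow> \<delta> (\<kappa> q) = q"
  using disc_homeo by (auto simp: homeomorphism_def)

lemma kappa_delta [simp]: "norm z < 2 \<Longrightarrow> \<kappa> (\<delta> z) = z"
  using disc_homeo by (auto simp: homeomorphism_def)

lemma delta_in [simp]: "norm z < 2 \<Longrightarrow> \<delta> z \<in> V"
  using disc_homeo by (auto simp: homeomorphism_def)

lemma kappa_norm [simp]: "q \<in> V \<Longrightarrow> norm (\<kappa> q) < 2"
  using disc_homeo by (auto simp: homeomorphism_def)

lemma delta_eq_iff [simp]: "norm z < 2 \<Longrightarrow> norm w < 2 \<Longrightarrow> \<delta> z = \<delta> w \<longleftrightarrow> z = w"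
  using kappa_delta by metis

lemma delta_in_image_iff: "norm z < 2 \<Longrightarrow> S \<subseteq> ball 0 2 \<Longrightarrow> \<delta> z \<in> \<delta> ` S \<longleftrightarrow> z \<in> S"
  using delta_eq_iff by fastforce

lemma continuous_on_delta: "S \<subseteq> ball 0 2 \<Longrightarrow> continuous_on S \<delta>"
  using disc_homeo continuous_on_subset by (auto simp: homeomorphism_def)

lemma continuous_on_kappa: "S \<subseteq> V \<Longrightarrow> continuous_on S \<kappa>"
  using disc_homeo continuous_on_subset by (auto simp: homeomorphism_def)

lemma open_delta: "open S \<Longrightarrow> S \<subseteq> ball 0 2 \<Longrightarrow> open (\<delta> ` S)"
  using homeomorphism_open_image[OF homeomorphism_symD[OF disc_homeo]] disc_open by blast

lemma compact_delta: "compact S \<Longrightarrow> S \<subseteq> ball 0 2 \<Longrightarrow> compact (\<delta> ` S)"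
  using compact_continuous_image[OF continuous_on_delta] by blast

lemma closed_delta: "compact S \<Longrightarrow> S \<subseteq> ball 0 2 \<Longrightarrow> closed (\<delta> ` S)"
  using compact_imp_closed compact_delta by blast

lemma delta_eventually_nhds:
  assumes "norm z < 2"
  shows "eventually P (nhds (\<delta> z)) \<longleftrightarrow> eventually (\<lambda>x. P (\<delta> x)) (nhds z)"
  using homeomorphism_eventually_nhds[OF disc_homeo disc_open _ delta_in[OF assms]] assms by simp

lemma disc_neq_UNIV: "S \<subseteq> ball 0 2 \<Longrightarrow> z \<notin> S \<Longrightarrow> norm z < 2 \<Longrightarrow> \<delta> ` S \<noteq> UNIV"
  using delta_in_image_iff by blast

text \<open>As \<kappa> is affine in a chart, harmonicity can be tested with analytic functions of
  the disc coordinate.\<close>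

lemma harmonic_at_delta:
  assumes z: "norm z < 2"
  shows "harmonic_at f (\<delta> z) \<longleftrightarrow> (\<exists>F. F analytic_on {z} \<and> (\<forall>\<^sub>F x in nhds z. f (\<delta> x) = Re (F x)))"
proof -
  obtain U u a \<rho> where U: "(U, u) \<in> A" "V \<subseteq> U" "\<rho> > 0" "\<And>q. q \<in> V \<Longrightarrow> u q = a + of_real \<rho> * \<kappa> q"
    using disc_chart by auto
  have p: "\<delta> z \<in> U" using U z by auto
  have in2: "\<forall>\<^sub>F x in nhds z. x \<in> ball 0 2" using z by (intro eventually_nhds_in_open) auto
  have ud: "u (\<delta> x) = a + of_real \<rho> * x" if "x \<in> ball 0 2" for x using that U by auto
  show ?thesis
  proof
    assume "harmonic_at f (\<delta> z)"
    then obtain F where F: "F analytic_on {u (\<delta> z)}" "\<forall>\<^sub>F q in nhds (\<delta> z). f q = Re (F (u q))"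
      using harmonic_atE[OF _ U(1) p] by blast
    have "(F \<circ> (\<lambda>x. a + of_real \<rho> * x)) analytic_on {z}"
      by (rule analytic_on_compose) (use F(1) ud z in \<open>auto intro!: analytic_intros\<close>)
    moreover have "\<forall>\<^sub>F x in nhds z. f (\<delta> x) = Re ((F \<circ> (\<lambda>x. a + of_real \<rho> * x)) x)"
      using F(2)[unfolded delta_eventually_nhds[OF z]] in2
      by eventually_elim (simp add: ud)
    ultimately show "\<exists>F. F analytic_on {z} \<and> (\<forall>\<^sub>F x in nhds z. f (\<delta> x) = Re (F x))" by blast
  next
    assume "\<exists>F. F analytic_on {z} \<and> (\<forall>\<^sub>F x in nhds z. f (\<delta> x) = Re (F x))"
    then obtain F where F: "F analytic_on {z}" "\<forall>\<^sub>F x in nhds z. f (\<delta> x) = Re (F x)" by blast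
    show "harmonic_at f (\<delta> z)"
    proof (rule harmonic_atI[OF U(1) p])
      show "(F \<circ> (\<lambda>w. (w - a) / of_real \<rho>)) analytic_on {u (\<delta> z)}"
        by (rule analytic_on_compose) (use F(1) ud z U in \<open>auto intro!: analytic_intros\<close>)
      show "\<forall>\<^sub>F q in nhds (\<delta> z). f q = Re ((F \<circ> (\<lambda>w. (w - a) / of_real \<rho>)) (u q))"
        unfolding delta_eventually_nhds[OF z] using F(2) in2
        by eventually_elim (use ud U in simp)
    qed
  qed
qed

lemma harmonic_at_deltaI:
  assumes "open S" "z \<in> S" "norm z < 2" "F holomorphic_on S" "\<And>x. x \<in> S \<Longrightarrow> norm x < 2 \<Longrightarrow> f (\<delta> x) = Re (F x)"
  shows "harmonic_at f (\<delta> z)"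
proof -
  have "F analytic_on {z}" using assms by (auto simp: analytic_at)
  moreover have "\<forall>\<^sub>F x in nhds z. x \<in> S \<inter> ball 0 2" using assms by (intro eventually_nhds_in_open) auto
  then have "\<forall>\<^sub>F x in nhds z. f (\<delta> x) = Re (F x)" by eventually_elim (use assms in auto)
  ultimately show ?thesis using harmonic_at_delta[OF assms(3)] by blast
qed

definition poisson_mod :: "('a \<Rightarrow> real) \<Rightarrow> 'a \<Rightarrow> real" where
  "poisson_mod f q = (if q \<in> \<delta> ` ball 0 1 then poisson_integral (f \<circ> \<delta>) (\<kappa> q) else f q)"

lemma poisson_mod_delta: "norm z < 1 \<Longrightarrow> poisson_mod f (\<delta> z) = poisson_integral (f \<circ> \<delta>) z"
  by (auto simp: poisson_mod_def)

lemma poisson_mod_sphere: "norm z = 1 \<Longrightarrow> poisson_mod f (\<delta> z) = f (\<delta> z)"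
  using delta_in_image_iff[of z "ball 0 1"] by (auto simp: poisson_mod_def)

lemma continuous_on_comp_delta:
  assumes "continuous_on (\<delta> ` cball 0 1) f"
  shows "continuous_on (sphere 0 1) (f \<circ> \<delta>)" "continuous_on (sphere 0 1) (\<lambda>z. f (\<delta> z))"
proof -
  have "\<delta> ` sphere 0 1 \<subseteq> \<delta> ` cball 0 1" by (intro image_mono) auto
  then show "continuous_on (sphere 0 1) (f \<circ> \<delta>)"
    by (intro continuous_on_compose continuous_on_delta continuous_on_subset[OF assms]) auto
  then show "continuous_on (sphere 0 1) (\<lambda>z. f (\<delta> z))"
    by (simp add: o_def)
qed

lemma continuous_poisson_mod:
  assumes K: "closed K" "\<delta> ` cball 0 1 \<subseteq> K" and f: "continuous_on K f"
  shows "continuous_on K (poisson_mod f)"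
proof -
  have f': "continuous_on (\<delta> ` cball 0 1) f" using f K continuous_on_subset by blast
  have 1: "continuous_on (\<delta> ` cball 0 1) (poisson_mod f)"
  proof (rule continuous_on_eq)
    show "continuous_on (\<delta> ` cball 0 1)
        (\<lambda>q. if norm (\<kappa> q) < 1 then poisson_integral (f \<circ> \<delta>) (\<kappa> q) else (f \<circ> \<delta>) (\<kappa> q))"
      by (rule continuous_on_compose2[OF
            continuous_on_poisson_extension[OF continuous_on_comp_delta(1)[OF f']] continuous_on_kappa])
         auto
    fix q assume "q \<in> \<delta> ` cball 0 1"
    then obtain z where "q = \<delta> z" "norm z \<le> 1" by auto
    then show "(if norm (\<kappa> q) < 1 then poisson_integral (f \<circ> \<delta>) (\<kappa> q) else (f \<circ> \<delta>) (\<kappa> q)) = poisson_mod f q"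
      by (cases "norm z < 1") (auto simp: poisson_mod_delta poisson_mod_sphere)
  qed
  have 2: "continuous_on (K - \<delta> ` ball 0 1) (poisson_mod f)"
    by (rule continuous_on_eq[OF continuous_on_subset[OF f]]) (auto simp: poisson_mod_def)
  have "continuous_on (\<delta> ` cball 0 1 \<union> (K - \<delta> ` ball 0 1)) (poisson_mod f)"
    by (rule continuous_on_closed_Un) (use 1 2 K in \<open>auto intro!: closed_delta closed_Diff open_delta\<close>)
  moreover have "\<delta> ` cball 0 1 \<union> (K - \<delta> ` ball 0 1) = K"
    using K by (auto simp: image_iff)
  ultimately show ?thesis by simp
qed

lemma harmonic_poisson_mod:
  assumes f: "continuous_on (\<delta> ` cball 0 1) f" and z: "norm z < 1"
  shows "harmonic_at (poisson_mod f) (\<delta> z)"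
proof (rule harmonic_at_deltaI)
  show "schwarz_integral (f \<circ> \<delta>) holomorphic_on ball 0 1"
    by (rule holomorphic_schwarz_integral[OF continuous_on_comp_delta(1)[OF f]])
qed (use z poisson_integral_eq_Re[OF continuous_on_comp_delta(1)[OF f]] in \<open>auto simp: poisson_mod_delta\<close>)

text \<open>The modification is harmonic in the open disc, so subtracting it from f leaves a
  function to which the maximum principle applies, and the difference vanishes on the bounding
  circle.\<close>

lemma poisson_mod_ge:
  assumes f: "continuous_on (\<delta> ` cball 0 1) f"
    and sub: "\<And>p. p \<in> \<delta> ` ball 0 1 \<Longrightarrow> subharmonic_at f p"
  shows "f q \<le> poisson_mod f q"
proof (cases "q \<in> \<delta> ` ball 0 1")
  case True
  have "f q - poisson_mod f q \<le> 0"
  proof (rule maximum_principle)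
    show "compact (\<delta> ` cball 0 1)" by (rule compact_delta) auto
    show "open (\<delta> ` ball 0 1)" by (rule open_delta) auto
    show "\<delta> ` ball 0 1 \<subseteq> \<delta> ` cball 0 1" by (intro image_mono) auto
    show "\<delta> ` ball 0 1 \<noteq> UNIV" by (rule disc_neq_UNIV[of _ 1]) auto
    show "continuous_on (\<delta> ` cball 0 1) (\<lambda>q. f q - poisson_mod f q)"
      by (intro continuous_intros f continuous_poisson_mod closed_delta) auto
    show "q \<in> \<delta> ` cball 0 1" using True by auto
    fix p assume p: "p \<in> \<delta> ` cball 0 1 - \<delta> ` ball 0 1"
    then show "f p - poisson_mod f p \<le> 0" by (auto simp: poisson_mod_def)
  next
    fix p assume p: "p \<in> \<delta> ` ball 0 1"
      and "\<forall>\<^sub>F q in nhds p. f q - poisson_mod f q \<le> f p - poisson_mod f p"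
    then show "\<forall>\<^sub>F q in nhds p. f q - poisson_mod f q = f p - poisson_mod f p"
      using subharmonic_atD[OF sub[OF p]] harmonic_poisson_mod[OF f] by auto
  qed
  then show ?thesis by simp
qed (simp add: poisson_mod_def)

text \<open>In the open disc the modification is harmonic. At all other points, those of the
  bounding circle included, it touches f from above.\<close>

lemma subharmonic_poisson_mod:
  assumes f: "continuous_on (\<delta> ` cball 0 1) f"
    and sub: "\<And>p. p \<in> \<delta> ` ball 0 1 \<Longrightarrow> subharmonic_at f p" and p: "subharmonic_at f p"
  shows "subharmonic_at (poisson_mod f) p"
proof (cases "p \<in> \<delta> ` ball 0 1")
  case True
  then show ?thesis using harmonic_poisson_mod[OF f] harmonic_imp_subharmonic by auto
next
  case False
  then show ?thesis
    by (intro subharmonic_at_touch[OF p]) (use poisson_mod_ge[OF f sub] in \<open>auto simp: poisson_mod_def\<close>)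
qed

end

section \<open>The Dirichlet problem outside a disc\<close>

text \<open>Takes the place of a limit of a sequence of harmonic functions: uniform approximation by
  real parts already makes g reproduce itself under the Poisson integral. It is applied to the
  Perron supremum on a disc of half the radius.\<close>

lemma poisson_uniform_approx:
  assumes approx: "\<And>e. e > 0 \<Longrightarrow> \<exists>F. continuous_on (cball 0 1) F \<and> F holomorphic_on ball 0 1 \<and>
      (\<forall>z. norm z \<le> 1 \<longrightarrow> \<bar>g z - Re (F z)\<bar> \<le> e)"
  shows "continuous_on (cball 0 1) g"
    and "norm z < 1 \<Longrightarrow> poisson_integral g z = g z"
proof -
  show cont: "continuous_on (cball 0 1) g"
    unfolding continuous_on_iff
  proof (intro ballI allI impI)
    fix x :: complex and e :: real assume x: "x \<in> cball 0 1" and e: "e > 0"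
    obtain F where F: "continuous_on (cball 0 1) F" "\<And>z. norm z \<le> 1 \<Longrightarrow> \<bar>g z - Re (F z)\<bar> \<le> e / 4"
      using approx[of "e / 4"] e by auto
    obtain d where d: "d > 0" "\<And>y. y \<in> cball 0 1 \<Longrightarrow> dist y x < d \<Longrightarrow> dist (F y) (F x) < e / 4"
      using F(1) x e unfolding continuous_on_iff by (metis divide_pos_pos zero_less_numeral)
    show "\<exists>d>0. \<forall>y\<in>cball 0 1. dist y x < d \<longrightarrow> dist (g y) (g x) < e"
    proof (intro exI[of _ d] conjI ballI impI d(1))
      fix y :: complex assume y: "y \<in> cball 0 1" "dist y x < d"
      have "\<bar>Re (F y) - Re (F x)\<bar> < e / 4"
        using d(2)[OF y] abs_Re_le_cmod[of "F y - F x"] by (simp add: dist_norm)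
      then show "dist (g y) (g x) < e"
        using F(2)[of x] F(2)[of y] x y e unfolding dist_real_def abs_less_iff abs_le_iff by auto
    qed
  qed
  then have gs: "continuous_on (sphere 0 1) g" by (rule continuous_on_subset) auto
  assume z: "norm z < 1"
  have "\<bar>poisson_integral g z - g z\<bar> \<le> 0 + e" if e: "e > 0" for e :: real
  proof -
    obtain F where F: "continuous_on (cball 0 1) F" "F holomorphic_on ball 0 1"
        "\<And>z. norm z \<le> 1 \<Longrightarrow> \<bar>g z - Re (F z)\<bar> \<le> e / 2"
      using approx[of "e / 2"] e by auto
    have Fs: "continuous_on (sphere 0 1) (\<lambda>z. Re (F z))"
      by (intro continuous_intros continuous_on_subset[OF F(1)]) auto
    have "poisson_integral g z - Re (F z) = poisson_integral (\<lambda>w. g w - Re (F w)) z"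
      by (simp add: poisson_integral_diff[OF gs Fs z] poisson_integral_Re[OF F(1,2) z])
    moreover have "\<bar>poisson_integral (\<lambda>w. g w - Re (F w)) z\<bar> \<le> e / 2"
      by (rule poisson_integral_abs_le) (use F(3) z in \<open>auto intro!: continuous_on_diff gs Fs\<close>)
    ultimately show ?thesis using F(3)[of z] z by linarith
  qed
  then have "\<bar>poisson_integral g z - g z\<bar> \<le> 0" by (rule field_le_epsilon)
  then show "poisson_integral g z = g z" by simp
qed

text \<open>The exterior of the disc of radius r and the unit disc overlap in the annulus between r
  and 1, on which the alternating method compares the two solutions.\<close>

locale disc_exterior = coordinate_disc A V \<kappa> \<delta> + compact_riemann_surface A
  for A :: "'a::t2_space atlas" and V \<kappa> \<delta> +
  fixes r :: real
  assumes r_pos: "0 < r" and r_less: "r < 1"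
begin

definition ext :: "'a set" where "ext = - \<delta> ` cball 0 r"
definition cl_ext :: "'a set" where "cl_ext = - \<delta> ` ball 0 r"

lemma open_ext: "open ext"
  unfolding ext_def using r_less by (intro open_Compl closed_delta) auto

lemma closed_cl_ext: "closed cl_ext"
  unfolding cl_ext_def using r_less by (intro closed_Compl open_delta) auto

lemma compact_cl_ext: "compact cl_ext"
  using compact_Int_closed[OF compact_surface closed_cl_ext] by simp

lemma ext_subset: "ext \<subseteq> cl_ext"
  unfolding ext_def cl_ext_def by auto

lemma ext_neq_UNIV: "ext \<noteq> UNIV"
proof -
  have "\<delta> 0 \<in> \<delta> ` cball 0 r" using r_pos by auto
  then show ?thesis unfolding ext_def by blast
qed

lemma delta_in_cl_ext: "norm z < 2 \<Longrightarrow> \<delta> z \<in> cl_ext \<longleftrightarrow> r \<le> norm z"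
  unfolding cl_ext_def using r_less by (auto simp: delta_in_image_iff subset_iff)

lemma delta_in_ext: "norm z < 2 \<Longrightarrow> \<delta> z \<in> ext \<longleftrightarrow> r < norm z"
  unfolding ext_def using r_less by (auto simp: delta_in_image_iff subset_iff)

lemma boundaryE:
  assumes "p \<in> cl_ext - ext"
  obtains z where "p = \<delta> z" "norm z = r"
  using assms unfolding ext_def cl_ext_def by force

definition perron_family :: "(complex \<Rightarrow> real) \<Rightarrow> ('a \<Rightarrow> real) set" where
  "perron_family \<phi> = {f. continuous_on cl_ext f \<and> (\<forall>p\<in>ext. subharmonic_at f p) \<and>
     (\<forall>z. norm z = r \<longrightarrow> f (\<delta> z) \<le> \<phi> z)}"

lemma perron_familyD:
  assumes "f \<in> perron_family \<phi>"
  shows "continuous_on cl_ext f" "\<And>p. p \<in> ext \<Longrightarrow> subharmonic_at f p"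
    "\<And>z. norm z = r \<Longrightarrow> f (\<delta> z) \<le> \<phi> z"
  using assms unfolding perron_family_def by blast+

definition perron :: "(complex \<Rightarrow> real) \<Rightarrow> 'a \<Rightarrow> real" where
  "perron \<phi> p = (SUP f\<in>perron_family \<phi>. f p)"

lemma exterior_maximum_principle:
  assumes "continuous_on cl_ext f" "\<And>p. p \<in> ext \<Longrightarrow> subharmonic_at f p"
    and "\<And>z. norm z = r \<Longrightarrow> f (\<delta> z) \<le> M" and "p \<in> cl_ext"
  shows "f p \<le> M"
proof (rule maximum_principle[OF compact_cl_ext open_ext ext_subset ext_neq_UNIV assms(1) _ _ assms(4)])
  fix p assume "p \<in> ext" "\<forall>\<^sub>F q in nhds p. f q \<le> f p"
  then show "\<forall>\<^sub>F q in nhds p. f q = f p"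
    using subharmonic_atD[OF assms(2), of p "\<lambda>_. 0"] by simp
next
  fix p assume "p \<in> cl_ext - ext"
  then show "f p \<le> M" by (rule boundaryE) (use assms(3) in auto)
qed

lemma annulus_maximum_principle:
  assumes cont: "continuous_on (\<delta> ` (cball 0 1 - ball 0 r)) f"
    and sub: "\<And>z. r < norm z \<Longrightarrow> norm z < 1 \<Longrightarrow> subharmonic_at f (\<delta> z)"
    and harm: "\<And>z. r < norm z \<Longrightarrow> norm z < 1 \<Longrightarrow> harmonic_at h (\<delta> z)"
    and conth: "continuous_on (\<delta> ` (cball 0 1 - ball 0 r)) h"
    and inner: "\<And>z. norm z = r \<Longrightarrow> f (\<delta> z) \<le> h (\<delta> z)"
    and outer: "\<And>z. norm z = 1 \<Longrightarrow> f (\<delta> z) \<le> h (\<delta> z)"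
    and z: "r \<le> norm z" "norm z \<le> 1"
  shows "f (\<delta> z) \<le> h (\<delta> z)"
proof -
  have "f (\<delta> z) - h (\<delta> z) \<le> 0"
  proof (rule maximum_principle[where K = "\<delta> ` (cball 0 1 - ball 0 r)" and W = "\<delta> ` (ball 0 1 - cball 0 r)"
        and f = "\<lambda>p. f p - h p"])
    show "compact (\<delta> ` (cball 0 1 - ball 0 r))"
      by (intro compact_delta compact_diff) auto
    show "open (\<delta> ` (ball 0 1 - cball 0 r))"
      by (intro open_delta open_Diff) auto
    show "\<delta> ` (ball 0 1 - cball 0 r) \<subseteq> \<delta> ` (cball 0 1 - ball 0 r)"
      by (intro image_mono) auto
    show "\<delta> ` (ball 0 1 - cball 0 r) \<noteq> UNIV"
      by (rule disc_neq_UNIV[of _ 0]) (use r_pos in auto)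
    show "continuous_on (\<delta> ` (cball 0 1 - ball 0 r)) (\<lambda>p. f p - h p)"
      by (intro continuous_on_diff cont conth)
    show "\<delta> z \<in> \<delta> ` (cball 0 1 - ball 0 r)" using z by auto
  next
    fix p assume p: "p \<in> \<delta> ` (ball 0 1 - cball 0 r)"
      and "\<forall>\<^sub>F q in nhds p. f q - h q \<le> f p - h p"
    then show "\<forall>\<^sub>F q in nhds p. f q - h q = f p - h p"
      using subharmonic_atD[OF sub harm] by auto
  next
    fix p assume "p \<in> \<delta> ` (cball 0 1 - ball 0 r) - \<delta> ` (ball 0 1 - cball 0 r)"
    then obtain w where "p = \<delta> w" "norm w = r \<or> norm w = 1" by force
    then show "f p - h p \<le> 0" using inner outer by auto
  qed
  then show ?thesis by simp
qed

lemma perron_family_max: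
  assumes "f \<in> perron_family \<phi>" "g \<in> perron_family \<phi>"
  shows "(\<lambda>p. max (f p) (g p)) \<in> perron_family \<phi>"
  using assms unfolding perron_family_def by (auto intro: continuous_on_max subharmonic_at_max)

lemma perron_family_poisson_mod:
  assumes D: "coordinate_disc A V' \<kappa>' \<delta>'" "V' \<subseteq> ext" and f: "f \<in> perron_family \<phi>"
  shows "coordinate_disc.poisson_mod \<kappa>' \<delta>' f \<in> perron_family \<phi>"
proof -
  interpret D: coordinate_disc A V' \<kappa>' \<delta>' by fact
  have sub: "\<delta>' ` cball 0 1 \<subseteq> ext" using D(2) by (auto intro!: subsetD[OF D(2)] D.delta_in)
  then have sub': "\<delta>' ` cball 0 1 \<subseteq> cl_ext" using ext_subset by auto
  note fc = perron_familyD(1)[OF f] and fs = perron_familyD(2)[OF f] and fb = perron_familyD(3)[OF f]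
  have fc': "continuous_on (\<delta>' ` cball 0 1) f" using fc sub' continuous_on_subset by blast
  have "continuous_on cl_ext (D.poisson_mod f)"
    by (rule D.continuous_poisson_mod[OF closed_cl_ext sub' fc])
  moreover have "subharmonic_at (D.poisson_mod f) p" if "p \<in> ext" for p
    by (rule D.subharmonic_poisson_mod[OF fc' fs fs[OF that]])
       (use sub image_mono[OF ball_subset_cball, of \<delta>' 0 1] in blast)
  moreover have "D.poisson_mod f (\<delta> z) \<le> \<phi> z" if z: "norm z = r" for z
  proof -
    have "\<delta> z \<notin> ext" using z r_less delta_in_ext by auto
    then have "\<delta> z \<notin> \<delta>' ` ball 0 1"
      using sub image_mono[OF ball_subset_cball, of \<delta>' 0 1] by blast
    then show ?thesis using fb[OF z] by (simp add: D.poisson_mod_def)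
  qed
  ultimately show ?thesis by (auto simp: perron_family_def)
qed

text \<open>Exterior counterpart of the majorant used for the Poisson integral: harmonic away from
  0, zero at \<open>z0\<close>, nonnegative for norm z \<ge> r, and proportional to the squared
  distance from \<open>z0\<close> on the circle of radius r (\<open>barrier_circle\<close>). On the
  unit circle it is at least 1 - r, so a multiple of it exceeds any given bound there.\<close>

definition barrier :: "complex \<Rightarrow> complex \<Rightarrow> real" where
  "barrier z0 z = 1 - Re (z0 / z)"

lemma barrier_ge:
  assumes "norm z0 = r" "r \<le> norm z"
  shows "0 \<le> barrier z0 z" and "norm z = 1 \<Longrightarrow> 1 - r \<le> barrier z0 z"
proof -
  have le: "Re (z0 / z) \<le> r / norm z"
    using complex_Re_le_cmod[of "z0 / z"] assms by (simp add: norm_divide)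
  also have "\<dots> \<le> 1" using assms r_pos by (simp add: divide_le_eq)
  finally show "0 \<le> barrier z0 z" by (simp add: barrier_def)
  show "1 - r \<le> barrier z0 z" if "norm z = 1" using le that by (simp add: barrier_def)
qed

lemma barrier_circle:
  assumes "norm z0 = r" "norm z = r"
  shows "(dist z z0)\<^sup>2 = 2 * r\<^sup>2 * barrier z0 z"
proof -
  have "z0 / z = z0 * cnj z / of_real (r\<^sup>2)"
    using complex_div_cnj[of z0 z] assms by simp
  then have "Re (z0 / z) = Re (z0 * cnj z) / r\<^sup>2" by (simp only: Re_divide_of_real)
  moreover have "Re (z0 * cnj z) = Re (z * cnj z0)" by simp
  ultimately show ?thesis
    unfolding norm_diff_circle[OF assms(2,1)] barrier_def using r_pos by (simp add: field_simps)
qed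

section \<open>The Perron solution for given boundary values\<close>

context
  fixes \<phi> :: "complex \<Rightarrow> real" and M :: real
  assumes \<phi>_cont: "continuous_on (sphere 0 r) \<phi>" and \<phi>_bound: "\<And>z. norm z = r \<Longrightarrow> \<bar>\<phi> z\<bar> \<le> M"
begin

lemma perron_family_le:
  assumes "f \<in> perron_family \<phi>" "p \<in> cl_ext"
  shows "f p \<le> M"
proof (rule exterior_maximum_principle[OF perron_familyD(1,2)[OF assms(1)] _ assms(2)])
  fix z :: complex assume "norm z = r"
  then show "f (\<delta> z) \<le> M"
    using perron_familyD(3)[OF assms(1)] \<phi>_bound[of z] by fastforce
qed

lemma perron_family_const: "(\<lambda>_. - M) \<in> perron_family \<phi>"
  using \<phi>_bound by (force simp: perron_family_def abs_le_iff intro: harmonic_imp_subharmonic)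

lemma bdd_perron_family: "p \<in> cl_ext \<Longrightarrow> bdd_above ((\<lambda>f. f p) ` perron_family \<phi>)"
  using perron_family_le by (auto simp: bdd_above_def)

lemma perron_ge: "f \<in> perron_family \<phi> \<Longrightarrow> p \<in> cl_ext \<Longrightarrow> f p \<le> perron \<phi> p"
  unfolding perron_def by (rule cSUP_upper[OF _ bdd_perron_family])

lemma perron_le: "(\<And>f. f \<in> perron_family \<phi> \<Longrightarrow> f p \<le> B) \<Longrightarrow> perron \<phi> p \<le> B"
  unfolding perron_def using perron_family_const by (intro cSUP_least) auto

text \<open>
  By Harnack's inequality a Poisson-modified member of the family that is almost maximal at the
  centre of a disc is uniformly almost maximal on the disc of half the radius.
\<close>

lemma harmonic_perron:
  assumes p: "p \<in> ext"
  shows "harmonic_at (perron \<phi>) p"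
proof -
  obtain U u where U: "(U, u) \<in> A" "p \<in> U" using charts_cover by blast
  obtain V' \<kappa>' \<delta>' where D: "coordinate_disc A V' \<kappa>' \<delta>'" "V' \<subseteq> ext" "\<delta>' 0 = p"
    using coordinate_disc_exists[OF U open_ext p] by metis
  interpret D: coordinate_disc A V' \<kappa>' \<delta>' by fact
  have in_ext: "\<delta>' z \<in> cl_ext" if "norm z < 2" for z
    using D(2) D.delta_in[OF that] ext_subset by blast
  have image_cl_ext: "\<delta>' ` cball 0 1 \<subseteq> cl_ext"
    by (rule image_subsetI, rule in_ext) auto
  have cf: "continuous_on (\<delta>' ` cball 0 1) f" if "f \<in> perron_family \<phi>" for f
    using perron_familyD(1)[OF that] image_cl_ext by (rule continuous_on_subset)
  have circ: "continuous_on (sphere 0 1) (f \<circ> \<delta>')" if "f \<in> perron_family \<phi>" for f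
    by (rule D.continuous_on_comp_delta(1)[OF cf[OF that]])
  \<comment> \<open>Rescales the half-size disc to the unit disc, the setting of
    \<open>poisson_uniform_approx\<close>.\<close>
  define g where "g z = perron \<phi> (\<delta>' (z / 2))" for z
  have approx: "\<exists>F. continuous_on (cball 0 1) F \<and> F holomorphic_on ball 0 1 \<and>
      (\<forall>z. norm z \<le> 1 \<longrightarrow> \<bar>g z - Re (F z)\<bar> \<le> e)" if e: "e > 0" for e
  proof -
    \<comment> \<open>The third of e makes up for Harnack's factor (1 + 1/2) / (1 - 1/2) = 3 at
      radius 1/2.\<close>
    have "perron \<phi> p - e / 3 < perron \<phi> p" using e by simp
    then obtain f0 where f0: "f0 \<in> perron_family \<phi>" "perron \<phi> p - e / 3 < f0 p"
      unfolding perron_def using perron_family_const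
      by (subst (asm) less_cSUP_iff) (use p ext_subset bdd_perron_family in auto)
    let ?F = "\<lambda>z. schwarz_integral (f0 \<circ> \<delta>') (z / 2)"
    have "(schwarz_integral (f0 \<circ> \<delta>') \<circ> (\<lambda>z. z / 2)) holomorphic_on ball 0 2"
      by (rule holomorphic_on_compose_gen[OF _ holomorphic_schwarz_integral[OF circ[OF f0(1)]]])
         (auto intro!: holomorphic_intros simp: norm_divide)
    then have holo: "?F holomorphic_on ball 0 2" by (simp add: o_def)
    have ReF: "Re (?F z) = D.poisson_mod f0 (\<delta>' (z / 2))" if "norm z < 2" for z
      using that poisson_integral_eq_Re[OF circ[OF f0(1)], of "z / 2"]
      by (simp add: D.poisson_mod_delta norm_divide)
    have "\<bar>g z - Re (?F z)\<bar> \<le> e" if z: "norm z \<le> 1" for z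
    proof -
      have n: "norm (z / 2) \<le> 1 / 2" using z by (simp add: norm_divide)
      then have n1: "norm (z / 2) < 1" by linarith
      have lower: "Re (?F z) \<le> g z"
        unfolding g_def using ReF[of z] z n1
          perron_ge[OF perron_family_poisson_mod[OF D(1,2) f0(1)] in_ext[of "z / 2"]] by simp
      have upper: "f (\<delta>' (z / 2)) \<le> Re (?F z) + e" if f: "f \<in> perron_family \<phi>" for f
      proof -
        \<comment> \<open>Taking the maximum with f0 makes h - f0 nonnegative, as Harnack's
          inequality requires, while h stays in the family.\<close>
        define h where "h = (\<lambda>q. max (f0 q) (f q))"
        have h: "h \<in> perron_family \<phi>" unfolding h_def by (rule perron_family_max[OF f0(1) f])
        have mh: "D.poisson_mod h \<in> perron_family \<phi>" by (rule perron_family_poisson_mod[OF D(1,2) h])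
        \<comment> \<open>At the centre P is at most e/3: the modification of h is a member of the
          family, and f0 misses the supremum at p by less than e/3.\<close>
        define P where "P = poisson_integral (\<lambda>w. (h \<circ> \<delta>') w - (f0 \<circ> \<delta>') w)"
        have P: "P w = poisson_integral (h \<circ> \<delta>') w - poisson_integral (f0 \<circ> \<delta>') w" if "norm w < 1" for w
          unfolding P_def by (rule poisson_integral_diff[OF circ[OF h] circ[OF f0(1)] that])
        have subf: "subharmonic_at f' q" if "f' \<in> perron_family \<phi>" "q \<in> \<delta>' ` ball 0 1" for f' q
          using that(2) D(2) by (intro perron_familyD(2)[OF that(1)]) auto
        have "poisson_integral (h \<circ> \<delta>') 0 \<le> perron \<phi> p"
          using perron_ge[OF mh, of p] p ext_subset D.poisson_mod_delta[of 0 h] D(3) by auto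
        moreover have "f0 p \<le> poisson_integral (f0 \<circ> \<delta>') 0"
          using D.poisson_mod_ge[OF cf[OF f0(1)] subf[OF f0(1)], of p] D.poisson_mod_delta[of 0 f0] D(3)
          by simp
        ultimately have P0: "P 0 \<le> e / 3" using P[of 0] f0(2) by simp
        have "P (z / 2) \<le> (1 + norm (z / 2)) / (1 - norm (z / 2)) * P 0"
          unfolding P_def
          by (rule poisson_integral_harnack[OF continuous_on_diff[OF circ[OF h] circ[OF f0(1)]] n1])
             (simp add: h_def)
        also have "\<dots> \<le> 3 * (e / 3)"
        proof (rule mult_mono)
          show "(1 + norm (z / 2)) / (1 - norm (z / 2)) \<le> 3"
            using n by (simp add: pos_divide_le_eq)
          have "poisson_integral (\<lambda>_. 0) 0 \<le> P 0"
            unfolding P_def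
            by (rule poisson_integral_mono[OF _ continuous_on_diff[OF circ[OF h] circ[OF f0(1)]]])
               (auto simp: h_def)
          then show "0 \<le> P 0" by simp
        qed (use P0 in auto)
        finally have "P (z / 2) \<le> e" by simp
        moreover have "f (\<delta>' (z / 2)) \<le> h (\<delta>' (z / 2))" by (simp add: h_def)
        moreover have "h (\<delta>' (z / 2)) \<le> poisson_integral (h \<circ> \<delta>') (z / 2)"
          using D.poisson_mod_ge[OF cf[OF h] subf[OF h], of "\<delta>' (z / 2)"] D.poisson_mod_delta[OF n1, of h]
          by simp
        moreover have "Re (?F z) = poisson_integral (f0 \<circ> \<delta>') (z / 2)"
          using ReF[of z] z D.poisson_mod_delta[OF n1, of f0] by simp
        ultimately show ?thesis using P[OF n1] by linarith
      qed
      then have "g z \<le> Re (?F z) + e" unfolding g_def by (rule perron_le)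
      then show ?thesis using lower by linarith
    qed
    moreover have "continuous_on (cball 0 1) ?F"
      by (rule holomorphic_on_imp_continuous_on, rule holomorphic_on_subset[OF holo]) auto
    moreover have "?F holomorphic_on ball 0 1"
      by (rule holomorphic_on_subset[OF holo]) auto
    ultimately show ?thesis by blast
  qed
  have gc: "continuous_on (sphere 0 1) g"
    by (rule continuous_on_subset[OF poisson_uniform_approx(1)[OF approx]]) auto
  have "harmonic_at (perron \<phi>) (\<delta>' 0)"
  proof (rule D.harmonic_at_deltaI[of "ball 0 (1/2)"])
    have "(schwarz_integral g \<circ> (\<lambda>x. 2 * x)) holomorphic_on ball 0 (1/2)"
      by (rule holomorphic_on_compose_gen[OF _ holomorphic_schwarz_integral[OF gc]])
         (auto intro!: holomorphic_intros simp: norm_mult)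
    then show "(\<lambda>x. schwarz_integral g (2 * x)) holomorphic_on ball 0 (1/2)" by (simp add: o_def)
    fix x :: complex assume "x \<in> ball 0 (1/2)"
    then have x: "norm (2 * x) < 1" by (simp add: norm_mult)
    have "perron \<phi> (\<delta>' x) = g (2 * x)" by (simp add: g_def)
    also have "\<dots> = poisson_integral g (2 * x)"
      using poisson_uniform_approx(2)[OF approx x] by simp
    also have "\<dots> = Re (schwarz_integral g (2 * x))" by (rule poisson_integral_eq_Re[OF gc x])
    finally show "perron \<phi> (\<delta>' x) = Re (schwarz_integral g (2 * x))" .
  qed auto
  then show ?thesis by (simp add: D(3))
qed

text \<open>From above, each member of the family is compared with \<phi> z0 + e + C * barrier on
  the annulus. From below, the mirror image of that function, cut off at - M, is itself a member of
  the family. As the barrier vanishes at \<open>z0\<close>, continuity of the Perron solution there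
  follows.\<close>

lemma perron_boundary:
  assumes z0: "norm z0 = r" and e: "e > 0"
  obtains C where "C \<ge> 0" "\<And>z. norm z = r \<Longrightarrow> \<bar>\<phi> z - \<phi> z0\<bar> \<le> e + C * barrier z0 z"
    "\<And>z. r \<le> norm z \<Longrightarrow> norm z \<le> 1 \<Longrightarrow> \<bar>perron \<phi> (\<delta> z) - \<phi> z0\<bar> \<le> e + C * barrier z0 z"
proof -
  obtain C0 where C0: "C0 \<ge> 0" "\<And>w. norm w = r \<Longrightarrow> \<bar>\<phi> w - \<phi> z0\<bar> \<le> e + C0 * (dist w z0)\<^sup>2"
    using dominated_by_square[OF compact_sphere \<phi>_cont, of z0 e] z0 e by auto
  have M: "M \<ge> 0" "\<bar>\<phi> z0\<bar> \<le> M" using \<phi>_bound[OF z0] by linarith+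
  \<comment> \<open>The first summand dominates the oscillation of \<phi> on the inner circle
    through \<open>barrier_circle\<close>. The second lifts C * barrier to at least 2 M + 1 on the
    unit circle, where the barrier is at least 1 - r.\<close>
  define C where "C = C0 * (2 * r\<^sup>2) + (2 * M + 1) / (1 - r)"
  have C: "C \<ge> 0" unfolding C_def using C0 M r_less by (intro add_nonneg_nonneg mult_nonneg_nonneg divide_nonneg_pos) auto
  have bound: "\<bar>\<phi> z - \<phi> z0\<bar> \<le> e + C * barrier z0 z" if z: "norm z = r" for z
  proof -
    have "C0 * (dist z z0)\<^sup>2 = C0 * (2 * r\<^sup>2) * barrier z0 z"
      using barrier_circle[OF z0 z] by simp
    also have "\<dots> \<le> C * barrier z0 z"
      unfolding C_def using barrier_ge(1)[OF z0, of z] z M r_less by (intro mult_right_mono) auto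
    finally show ?thesis using C0(2)[OF z] by linarith
  qed
  have outer: "2 * M + 1 \<le> C * barrier z0 z" if z: "norm z = 1" for z
  proof -
    have "2 * M + 1 = (2 * M + 1) / (1 - r) * (1 - r)" using r_less by simp
    also have "\<dots> \<le> C * barrier z0 z"
      unfolding C_def using barrier_ge(2)[OF z0 _ z] r_less z M C0
      by (intro mult_mono) auto
    finally show ?thesis .
  qed
  have nz: "z \<noteq> 0" if "r \<le> norm z" for z using that r_pos by auto
  have cont_b: "continuous_on S (barrier z0)" if "0 \<notin> S" for S
    unfolding barrier_def using that by (auto intro!: continuous_intros)
  have cont_bk: "continuous_on (\<delta> ` (cball 0 1 - ball 0 r)) (\<lambda>p. a + b * barrier z0 (\<kappa> p))" for a b
    by (intro continuous_intros continuous_on_compose2[OF cont_b continuous_on_kappa, of "cball 0 1 - ball 0 r"])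
       (use r_pos in auto)
  have harm: "harmonic_at (\<lambda>p. a + b * barrier z0 (\<kappa> p)) (\<delta> z)" if "r < norm z" "norm z < 2" for a b z
    by (rule harmonic_at_deltaI[of "- {0}" z "\<lambda>z. of_real a + of_real b * (1 - z0 / z)"])
       (use that r_pos in \<open>auto intro!: holomorphic_intros simp: barrier_def\<close>)
  have upper: "f (\<delta> z) \<le> \<phi> z0 + e + C * barrier z0 z"
    if f: "f \<in> perron_family \<phi>" and z: "r \<le> norm z" "norm z \<le> 1" for f z
  proof -
    have "f (\<delta> z) \<le> (\<lambda>p. (\<phi> z0 + e) + C * barrier z0 (\<kappa> p)) (\<delta> z)"
    proof (rule annulus_maximum_principle[OF _ _ harm cont_bk _ _ z])
      show "continuous_on (\<delta> ` (cball 0 1 - ball 0 r)) f"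
        by (rule continuous_on_subset[OF perron_familyD(1)[OF f]]) (auto simp: delta_in_cl_ext)
      show "subharmonic_at f (\<delta> w)" if "r < norm w" "norm w < 1" for w
        using that delta_in_ext[of w] by (intro perron_familyD(2)[OF f]) auto
      show "f (\<delta> w) \<le> \<phi> z0 + e + C * barrier z0 (\<kappa> (\<delta> w))" if w: "norm w = r" for w
      proof -
        have "f (\<delta> w) \<le> \<phi> w" by (rule perron_familyD(3)[OF f w])
        then show ?thesis using bound[OF w] w r_less by simp
      qed
      show "f (\<delta> w) \<le> \<phi> z0 + e + C * barrier z0 (\<kappa> (\<delta> w))" if w: "norm w = 1" for w
      proof -
        have "f (\<delta> w) \<le> M" by (rule perron_family_le[OF f]) (use w r_less in \<open>simp add: delta_in_cl_ext\<close>)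
        then show ?thesis using outer[OF w] w M e by simp
      qed
    qed auto
    then show ?thesis using z by simp
  qed
  define L where "L z = (\<phi> z0 - e) + (- C) * barrier z0 z" for z
  \<comment> \<open>The cut-off makes the extension by - M continuous, because L lies below - M on
    the unit circle.\<close>
  define v where "v p = (if p \<in> \<delta> ` cball 0 1 then max (L (\<kappa> p)) (- M) else - M)" for p
  have L1: "L z < - M" if "norm z = 1" for z using outer[OF that] M e by (simp add: L_def)
  have v_delta: "v (\<delta> z) = max (L z) (- M)" if "norm z \<le> 1" for z
    using that by (auto simp: v_def)
  have v_outer: "v p = - M" if "p \<notin> \<delta> ` ball 0 1" for p
  proof (cases "p \<in> \<delta> ` cball 0 1")
    case True
    then obtain z where "p = \<delta> z" "norm z = 1" using \<open>p \<notin> \<delta> ` ball 0 1\<close> by force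
    then show ?thesis using v_delta[of z] L1[of z] by simp
  qed (simp add: v_def)
  have v: "v \<in> perron_family \<phi>"
  proof -
    have "continuous_on (\<delta> ` (cball 0 1 - ball 0 r) \<union> (cl_ext - \<delta> ` ball 0 1)) v"
    proof (rule continuous_on_closed_Un)
      show "closed (\<delta> ` (cball 0 1 - ball 0 r))" by (intro closed_delta compact_diff) auto
      show "closed (cl_ext - \<delta> ` ball 0 1)" by (intro closed_Diff closed_cl_ext open_delta) auto
      have "continuous_on (\<delta> ` (cball 0 1 - ball 0 r)) (\<lambda>p. max (L (\<kappa> p)) (- M))"
        unfolding L_def by (intro continuous_on_max cont_bk continuous_on_const)
      then show "continuous_on (\<delta> ` (cball 0 1 - ball 0 r)) v"
        by (rule continuous_on_eq) (auto simp: v_def)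
      show "continuous_on (cl_ext - \<delta> ` ball 0 1) v"
        by (rule continuous_on_eq[OF continuous_on_const[of _ "- M"]]) (use v_outer in auto)
    qed
    moreover have "cl_ext \<subseteq> \<delta> ` (cball 0 1 - ball 0 r) \<union> (cl_ext - \<delta> ` ball 0 1)"
      unfolding cl_ext_def by auto
    ultimately have "continuous_on cl_ext v" by (rule continuous_on_subset)
    moreover have "subharmonic_at v p" if p: "p \<in> ext" for p
    proof (cases "p \<in> \<delta> ` ball 0 1")
      case True
      then obtain z where z: "p = \<delta> z" "norm z < 1" by auto
      have rz: "r < norm z" using p z delta_in_ext[of z] by simp
      have "subharmonic_at (\<lambda>p. max (L (\<kappa> p)) (- M)) p"
        unfolding L_def
        by (intro subharmonic_at_max harmonic_imp_subharmonic harmonic_at_const)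
           (use z rz harm[of z "\<phi> z0 - e" "- C"] in simp)
      moreover have "\<forall>\<^sub>F q in nhds p. q \<in> \<delta> ` ball 0 1"
        using True by (intro eventually_nhds_in_open open_delta) auto
      then have "\<forall>\<^sub>F q in nhds p. max (L (\<kappa> q)) (- M) = v q"
        by eventually_elim (auto simp: v_def)
      ultimately show ?thesis by (rule subharmonic_at_cong[rotated])
    next
      case False
      show ?thesis
      \<comment> \<open>Outside the open unit disc, and in particular along the gluing circle, v
        touches the constant - M from above.\<close>
      proof (rule subharmonic_at_touch[OF harmonic_imp_subharmonic[OF harmonic_at_const[of "- M"]]])
        show "v p = - M" by (rule v_outer[OF False])
        show "\<forall>\<^sub>F q in nhds p. - M \<le> v q" by (intro always_eventually) (auto simp: v_def)
      qed
    qed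
    moreover have "v (\<delta> z) \<le> \<phi> z" if z: "norm z = r" for z
      using v_delta[of z] bound[OF z] \<phi>_bound[OF z] z r_less by (auto simp: L_def)
    ultimately show ?thesis by (auto simp: perron_family_def)
  qed
  show thesis
  proof (rule that[OF C bound])
    fix z :: complex assume z: "r \<le> norm z" "norm z \<le> 1"
    have "perron \<phi> (\<delta> z) \<le> \<phi> z0 + e + C * barrier z0 z"
      by (rule perron_le) (rule upper[OF _ z])
    moreover have "v (\<delta> z) \<le> perron \<phi> (\<delta> z)"
      by (rule perron_ge[OF v]) (use z delta_in_cl_ext in auto)
    then have "L z \<le> perron \<phi> (\<delta> z)" using v_delta[OF z(2)] by linarith
    ultimately show "\<bar>perron \<phi> (\<delta> z) - \<phi> z0\<bar> \<le> e + C * barrier z0 z"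
      by (simp add: L_def abs_le_iff)
  qed
qed

end

theorem exterior_dirichlet:
  assumes \<phi>: "continuous_on (sphere 0 r) \<phi>"
  obtains H where "continuous_on cl_ext H" "\<And>p. p \<in> ext \<Longrightarrow> harmonic_at H p"
    "\<And>z. norm z = r \<Longrightarrow> H (\<delta> z) = \<phi> z"
proof -
  obtain M where "\<forall>x\<in>\<phi> ` sphere 0 r. norm x \<le> M"
    using compact_imp_bounded[OF compact_continuous_image[OF \<phi> compact_sphere]]
    unfolding bounded_iff by blast
  then have M: "\<bar>\<phi> z\<bar> \<le> M" if "norm z = r" for z using that by simp
  \<comment> \<open>The boundary values are inserted by hand on the small circle;
    \<open>perron_boundary\<close> shows that they fit continuously.\<close>
  define H where "H p = (if p \<in> ext then perron \<phi> p else \<phi> (\<kappa> p))" for p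
  have H_ext: "\<forall>\<^sub>F q in nhds p. H q = perron \<phi> q" if "p \<in> ext" for p
    using eventually_nhds_in_open[OF open_ext that] by eventually_elim (simp add: H_def)
  have harm: "harmonic_at H p" if p: "p \<in> ext" for p
    using harmonic_perron[OF \<phi> M p] harmonic_at_cong[OF H_ext[OF p]] by simp
  have H_bd: "H (\<delta> z) = \<phi> z" if "norm z = r" for z
    using that r_less delta_in_ext[of z] by (simp add: H_def)
  have "continuous_on cl_ext H"
    unfolding continuous_on_def
  proof
    fix p assume p: "p \<in> cl_ext"
    show "(H \<longlongrightarrow> H p) (at p within cl_ext)"
    proof (cases "p \<in> ext")
      case True
      have "(H \<longlongrightarrow> H p) (at p)" using harmonic_at_isCont[OF harm[OF True]] by (rule isContD)
      then show ?thesis by (rule filterlim_mono) (simp_all add: at_le)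
    next
      case False
      then obtain z0 where z0: "p = \<delta> z0" "norm z0 = r" using boundaryE p by blast
      show ?thesis
      proof (rule tendstoI)
        fix e :: real assume e: "e > 0"
        obtain C where C: "C \<ge> 0" "\<And>z. norm z = r \<Longrightarrow> \<bar>\<phi> z - \<phi> z0\<bar> \<le> e / 2 + C * barrier z0 z"
          "\<And>z. r \<le> norm z \<Longrightarrow> norm z \<le> 1 \<Longrightarrow> \<bar>perron \<phi> (\<delta> z) - \<phi> z0\<bar> \<le> e / 2 + C * barrier z0 z"
          using perron_boundary[OF \<phi> M z0(2), of "e/2"] e by auto
        have cont: "isCont (\<lambda>z. e / 2 + C * barrier z0 z) z0"
          unfolding barrier_def by (intro isCont_add isCont_mult isCont_diff isCont_Re isCont_divide)
            (use z0 r_pos in auto)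
        have lt: "e / 2 + C * barrier z0 z0 < e" using e z0 r_pos by (auto simp: barrier_def)
        have "\<forall>\<^sub>F z in nhds z0. e / 2 + C * barrier z0 z < e"
          using order_tendstoD(2)[OF isContD[OF cont] lt] lt by (simp add: eventually_nhds_conv_at)
        moreover have "\<forall>\<^sub>F z in nhds z0. z \<in> ball 0 1"
          using z0 r_less by (intro eventually_nhds_in_open) auto
        ultimately have "\<forall>\<^sub>F z in nhds z0. \<delta> z \<in> cl_ext \<longrightarrow> dist (H (\<delta> z)) (H p) < e"
        proof eventually_elim
          case (elim z)
          show ?case
          proof
            assume "\<delta> z \<in> cl_ext"
            then have rz: "r \<le> norm z" using elim delta_in_cl_ext[of z] by simp
            have "\<bar>H (\<delta> z) - \<phi> z0\<bar> \<le> e / 2 + C * barrier z0 z"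
            proof (cases "norm z = r")
              case True
              then show ?thesis using C(2) H_bd by simp
            next
              case False
              then have "\<delta> z \<in> ext" using rz elim delta_in_ext[of z] by simp
              then show ?thesis using C(3)[OF rz] elim by (simp add: H_def)
            qed
            then show "dist (H (\<delta> z)) (H p) < e"
              using elim z0 H_bd by (simp add: dist_real_def)
          qed
        qed
        then have "\<forall>\<^sub>F q in nhds p. q \<in> cl_ext \<longrightarrow> dist (H q) (H p) < e"
          using delta_eventually_nhds[of z0 "\<lambda>q. q \<in> cl_ext \<longrightarrow> dist (H q) (H p) < e"] z0 r_less by simp
        then show "\<forall>\<^sub>F q in at p within cl_ext. dist (H q) (H p) < e"
          unfolding eventually_at_filter by eventually_elim auto
      qed
    qed
  qed
  then show thesis using that harm H_bd by blast
qed

end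

section \<open>A harmonic function with a dipole singularity\<close>

text \<open>Banach's fixed point theorem for the supremum norm on S, phrased for total functions of
  which only the restriction to S is controlled. The iterates converge uniformly by the M-test for
  their telescoping series.\<close>

lemma uniform_contraction_fixed_point:
  fixes G :: "('b::topological_space \<Rightarrow> real) \<Rightarrow> 'b \<Rightarrow> real"
  assumes S: "compact S" and c: "0 \<le> c" "c < 1"
    and G: "\<And>f. continuous_on S f \<Longrightarrow> continuous_on S (G f)"
    and contr: "\<And>f g m. continuous_on S f \<Longrightarrow> continuous_on S g \<Longrightarrow> (\<And>x. x \<in> S \<Longrightarrow> \<bar>f x - g x\<bar> \<le> m) \<Longrightarrow>
      (\<And>x. x \<in> S \<Longrightarrow> \<bar>G f x - G g x\<bar> \<le> c * m)"
  obtains f where "continuous_on S f" "\<And>x. x \<in> S \<Longrightarrow> G f x = f x"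
proof -
  define \<phi> where "\<phi> n = (G ^^ n) (\<lambda>_. 0)" for n
  have \<phi>_Suc: "\<phi> (Suc n) = G (\<phi> n)" for n by (simp add: \<phi>_def)
  have cont: "continuous_on S (\<phi> n)" for n
    by (induction n) (auto simp: \<phi>_def intro: G)
  obtain M where M: "\<forall>y\<in>\<phi> 1 ` S. norm y \<le> M"
    using compact_imp_bounded[OF compact_continuous_image[OF cont S]] unfolding bounded_iff by blast
  have step: "\<bar>\<phi> (Suc n) x - \<phi> n x\<bar> \<le> c ^ n * M" if "x \<in> S" for n x
    using that
  proof (induction n arbitrary: x)
    case 0
    then show ?case using M by (auto simp: \<phi>_def)
  next
    case (Suc n)
    then show ?case
      using contr[OF cont cont Suc.IH, of x] by (simp add: \<phi>_Suc mult.assoc)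
  qed
  define f where "f x = (\<Sum>i. \<phi> (Suc i) x - \<phi> i x)" for x
  have "uniform_limit S (\<lambda>n x. \<Sum>i<n. \<phi> (Suc i) x - \<phi> i x) f sequentially"
    unfolding f_def
  proof (rule Weierstrass_m_test)
    show "summable (\<lambda>n. c ^ n * M)" using c by (intro summable_mult2 summable_geometric) auto
  qed (use step in auto)
  moreover have "(\<Sum>i<n. \<phi> (Suc i) x - \<phi> i x) = \<phi> n x" for n x
    using sum_lessThan_telescope[of "\<lambda>n. \<phi> n x" n] by (simp add: \<phi>_def)
  ultimately have lim: "uniform_limit S \<phi> f sequentially" by simp
  have contf: "continuous_on S f"
    by (rule uniform_limit_theorem[OF _ lim]) (use cont in auto)
  have "G f x = f x" if x: "x \<in> S" for x
  proof -
    have "\<bar>G f x - f x\<bar> \<le> 0 + e" if e: "e > 0" for e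
    proof -
      have "\<forall>\<^sub>F n in sequentially. \<forall>x\<in>S. dist (\<phi> n x) (f x) < e / 2"
        by (rule uniform_limitD[OF lim]) (use e in simp)
      then obtain N where "\<forall>n\<ge>N. \<forall>x\<in>S. dist (\<phi> n x) (f x) < e / 2"
        unfolding eventually_sequentially by (elim exE)
      then have N: "\<bar>\<phi> n x - f x\<bar> < e / 2" if "n \<ge> N" "x \<in> S" for n x
        using that by (simp add: dist_real_def)
      have "\<bar>G f x - G (\<phi> N) x\<bar> \<le> c * (e / 2)"
        by (rule contr[OF contf cont _ x]) (use less_imp_le[OF N[OF order_refl]] in \<open>simp add: abs_minus_commute\<close>)
      also have "\<dots> \<le> 1 * (e / 2)" using c e by (intro mult_right_mono) auto
      finally have "\<bar>G f x - \<phi> (Suc N) x\<bar> \<le> e / 2" by (simp add: \<phi>_Suc)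
      then show ?thesis using N[of "Suc N" x] x by linarith
    qed
    then have "\<bar>G f x - f x\<bar> \<le> 0" by (rule field_le_epsilon)
    then show ?thesis by simp
  qed
  then show thesis using that contf by blast
qed

section \<open>Alternating between the exterior and the disc\<close>

context disc_exterior
begin

text \<open>In the ball around z of radius norm z the quotient x / z avoids the slit of
  \<open>Ln\<close>, so Ln (x / z) + ln (norm z) is a holomorphic branch with real part ln (norm
  x).\<close>

lemma harmonic_at_ln_norm:
  assumes "z \<noteq> 0" "norm z < 2"
  shows "harmonic_at (\<lambda>p. ln (norm (\<kappa> p))) (\<delta> z)"
proof (rule harmonic_at_deltaI[of "ball z (norm z)"])
  have nonpos: "x / z \<notin> \<real>\<^sub>\<le>\<^sub>0" if "x \<in> ball z (norm z)" for x
  proof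
    assume "x / z \<in> \<real>\<^sub>\<le>\<^sub>0"
    then have "1 \<le> norm (1 - x / z)"
      using complex_Re_le_cmod[of "1 - x / z"] by (auto simp: complex_nonpos_Reals_iff)
    also have "1 - x / z = (z - x) / z" using assms by (simp add: field_simps)
    finally have "norm z \<le> norm (z - x)" using assms by (simp add: norm_divide le_divide_eq)
    then show False using that by (simp add: dist_norm)
  qed
  then show "(\<lambda>x. Ln (x / z) + of_real (ln (norm z))) holomorphic_on ball z (norm z)"
    using assms by (intro holomorphic_intros) auto
  fix x assume x: "x \<in> ball z (norm z)" "norm x < 2"
  then have "x \<noteq> 0" by auto
  then show "ln (norm (\<kappa> (\<delta> x))) = Re (Ln (x / z) + of_real (ln (norm z)))"
    using x assms by (simp add: norm_divide ln_div)
qed (use assms in auto)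

text \<open>Choosing one solution for each \<phi> turns the exterior Dirichlet problem into an
  operator, which can then be iterated.\<close>

definition exterior_solution :: "(complex \<Rightarrow> real) \<Rightarrow> 'a \<Rightarrow> real" where
  "exterior_solution \<phi> = (SOME H. continuous_on cl_ext H \<and> (\<forall>p\<in>ext. harmonic_at H p) \<and>
     (\<forall>z. norm z = r \<longrightarrow> H (\<delta> z) = \<phi> z))"

lemma exterior_solution:
  assumes "continuous_on (sphere 0 r) \<phi>"
  shows "continuous_on cl_ext (exterior_solution \<phi>)"
    and "\<And>p. p \<in> ext \<Longrightarrow> harmonic_at (exterior_solution \<phi>) p"
    and "\<And>z. norm z = r \<Longrightarrow> exterior_solution \<phi> (\<delta> z) = \<phi> z"
proof -
  have "\<exists>H. continuous_on cl_ext H \<and> (\<forall>p\<in>ext. harmonic_at H p) \<and>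
     (\<forall>z. norm z = r \<longrightarrow> H (\<delta> z) = \<phi> z)"
    using exterior_dirichlet[OF assms] by metis
  from someI_ex[OF this]
  show "continuous_on cl_ext (exterior_solution \<phi>)"
    "\<And>p. p \<in> ext \<Longrightarrow> harmonic_at (exterior_solution \<phi>) p"
    "\<And>z. norm z = r \<Longrightarrow> exterior_solution \<phi> (\<delta> z) = \<phi> z"
    unfolding exterior_solution_def by blast+
qed

text \<open>The exterior half of the alternating step does not increase the supremum norm; the
  contraction comes from the interior half.\<close>

lemma exterior_solution_diff_le:
  assumes f: "continuous_on (sphere 0 r) f" and g: "continuous_on (sphere 0 r) g"
    and le: "\<And>z. norm z = r \<Longrightarrow> \<bar>f z - g z\<bar> \<le> m" and p: "p \<in> cl_ext"
  shows "\<bar>exterior_solution f p - exterior_solution g p\<bar> \<le> m"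
proof -
  note F = exterior_solution[OF f] and G = exterior_solution[OF g]
  have "exterior_solution f p - exterior_solution g p \<le> m"
    by (rule exterior_maximum_principle[OF continuous_on_diff[OF F(1) G(1)]
          harmonic_imp_subharmonic[OF harmonic_at_diff[OF F(2) G(2)]] _ p])
       (use F(3) G(3) le in \<open>auto simp: abs_le_iff\<close>)
  moreover have "exterior_solution g p - exterior_solution f p \<le> m"
    by (rule exterior_maximum_principle[OF continuous_on_diff[OF G(1) F(1)]
          harmonic_imp_subharmonic[OF harmonic_at_diff[OF G(2) F(2)]] _ p])
       (use F(3) G(3) le in \<open>auto simp: abs_le_iff\<close>)
  ultimately show ?thesis by linarith
qed

lemma exterior_solution_circle:
  assumes "continuous_on (sphere 0 r) \<phi>"
  shows "continuous_on (sphere 0 1) (\<lambda>z. exterior_solution \<phi> (\<delta> z))"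
  by (rule continuous_on_compose2[OF exterior_solution(1)[OF assms] continuous_on_delta])
     (use r_less in \<open>auto simp: delta_in_cl_ext\<close>)

lemma annulus_unique:
  assumes cont: "continuous_on (\<delta> ` (cball 0 1 - ball 0 r)) f"
      "continuous_on (\<delta> ` (cball 0 1 - ball 0 r)) h"
    and harm: "\<And>z. r < norm z \<Longrightarrow> norm z < 1 \<Longrightarrow> harmonic_at f (\<delta> z)"
      "\<And>z. r < norm z \<Longrightarrow> norm z < 1 \<Longrightarrow> harmonic_at h (\<delta> z)"
    and bd: "\<And>z. norm z = r \<Longrightarrow> f (\<delta> z) = h (\<delta> z)" "\<And>z. norm z = 1 \<Longrightarrow> f (\<delta> z) = h (\<delta> z)"
    and z: "r \<le> norm z" "norm z \<le> 1"
  shows "f (\<delta> z) = h (\<delta> z)"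
proof (rule antisym)
  show "f (\<delta> z) \<le> h (\<delta> z)"
    by (rule annulus_maximum_principle[OF cont(1) harmonic_imp_subharmonic[OF harm(1)] harm(2) cont(2) _ _ z])
       (use bd in auto)
  show "h (\<delta> z) \<le> f (\<delta> z)"
    by (rule annulus_maximum_principle[OF cont(2) harmonic_imp_subharmonic[OF harm(2)] harm(1) cont(1) _ _ z])
       (use bd in auto)
qed

text \<open>
  Schwarz's alternating method: solve the exterior problem with boundary values \<open>\<phi>\<close> on the small
  circle, then the interior problem in the unit disc with the resulting boundary values, restrict
  to the small circle and normalise at the centre. As \<open>Re (1/z - z)\<close> vanishes on the unit circle,
  a fixed point gives an exterior and an interior solution which agree on the unit circle and
  differ by a constant on the small circle. Their difference on the annulus is a multiple of
  \<open>ln \<bar>z\<bar>\<close>, which is added to the interior solution.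
\<close>

theorem dipole_exists:
  assumes r3: "r < 1 / 3"
  obtains v G k where "\<And>p. p \<noteq> \<delta> 0 \<Longrightarrow> harmonic_at v p" "G holomorphic_on ball 0 1"
    "\<And>z. z \<noteq> 0 \<Longrightarrow> norm z < 1 \<Longrightarrow> v (\<delta> z) = Re (1 / z + G z) + k * ln (norm z)"
proof -
  define s where "s z = Re (1 / z - z)" for z :: complex
  define Q where "Q \<phi> = poisson_integral (\<lambda>z. exterior_solution \<phi> (\<delta> z))" for \<phi> :: "complex \<Rightarrow> real"
  have contQ: "continuous_on (ball 0 1) (Q \<phi>)" if "continuous_on (sphere 0 r) \<phi>" for \<phi>
    unfolding Q_def
    by (rule continuous_on_eq[OF continuous_on_subset[OF
          continuous_on_poisson_extension[OF exterior_solution_circle[OF that]]]]) auto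
  have conts: "continuous_on S s" if "0 \<notin> S" for S :: "complex set"
    unfolding s_def using that by (auto intro!: continuous_intros)
  obtain \<phi> where \<phi>: "continuous_on (sphere 0 r) \<phi>"
      and fixp: "\<And>z::complex. norm z = r \<Longrightarrow> s z + Q \<phi> z - Q \<phi> 0 = \<phi> z"
  proof (rule uniform_contraction_fixed_point[of "sphere (0::complex) r" "2 * r / (1 - r)"
        "\<lambda>\<phi> z. s z + Q \<phi> z - Q \<phi> 0"])
    \<comment> \<open>This is where r < 1/3 enters. The constant is that of
      \<open>poisson_integral_center_diff\<close> at norm z = r.\<close>
    show "2 * r / (1 - r) < 1" using r3 r_pos by (simp add: pos_divide_less_eq)
    fix f :: "complex \<Rightarrow> real" assume f: "continuous_on (sphere 0 r) f"
    show "continuous_on (sphere 0 r) (\<lambda>z. s z + Q f z - Q f 0)"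
      by (intro continuous_intros conts continuous_on_subset[OF contQ[OF f]]) (use r_pos r_less in auto)
    fix g :: "complex \<Rightarrow> real" and m :: real and z :: complex
    assume g: "continuous_on (sphere 0 r) g"
      and fg: "\<And>x. x \<in> sphere 0 r \<Longrightarrow> \<bar>f x - g x\<bar> \<le> m" and "z \<in> sphere 0 r"
    then have z: "norm z = r" "norm z < 1" using r_less by auto
    let ?d = "\<lambda>z. exterior_solution f (\<delta> z) - exterior_solution g (\<delta> z)"
    have d: "Q f w - Q g w = poisson_integral ?d w" if "norm w < 1" for w
      unfolding Q_def
      using poisson_integral_diff[OF exterior_solution_circle[OF f] exterior_solution_circle[OF g] that] by simp
    have "\<bar>poisson_integral ?d z - poisson_integral ?d 0\<bar> \<le> 2 * norm z / (1 - norm z) * m"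
    proof (rule poisson_integral_center_diff[OF _ z(2)])
      show "continuous_on (sphere 0 1) ?d"
        by (intro continuous_on_diff exterior_solution_circle f g)
      show "\<bar>?d w\<bar> \<le> m" if "norm w = 1" for w
        by (rule exterior_solution_diff_le[OF f g fg]) (use that r_less in \<open>auto simp: delta_in_cl_ext\<close>)
    qed
    then show "\<bar>s z + Q f z - Q f 0 - (s z + Q g z - Q g 0)\<bar> \<le> 2 * r / (1 - r) * m"
      using d[of z] d[of 0] z by (simp add: algebra_simps)
  qed (use r_pos r_less in auto)
  define H where "H = exterior_solution \<phi>"
  note H = exterior_solution[OF \<phi>, folded H_def]
  define g where "g z = H (\<delta> z)" for z
  have gc: "continuous_on (sphere 0 1) g"
    unfolding g_def H_def by (rule exterior_solution_circle[OF \<phi>])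
  have Qg: "Q \<phi> = poisson_integral g" by (simp add: Q_def g_def[abs_def] H_def)
  define E where "E z = (if norm z < 1 then Q \<phi> z else g z)" for z
  have Ec: "continuous_on (cball 0 1) E"
    unfolding E_def Qg by (rule continuous_on_poisson_extension[OF gc])
  \<comment> \<open>Chosen so that k ln r = - Q \<phi> 0, the constant by which the two solutions
    differ on the small circle. On the unit circle the logarithm vanishes and the agreement there is
    kept.\<close>
  define k where "k = - Q \<phi> 0 / ln r"
  have lnr: "ln r \<noteq> 0" using r_pos r_less by simp
  define h where "h p = s (\<kappa> p) + E (\<kappa> p) + k * ln (norm (\<kappa> p))" for p
  have harm_h: "harmonic_at h (\<delta> z)" if z: "z \<noteq> 0" "norm z < 1" for z
    unfolding h_def
  proof (intro harmonic_at_add)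
    show "harmonic_at (\<lambda>p. s (\<kappa> p)) (\<delta> z)"
      by (rule harmonic_at_deltaI[of "- {0}" _ "\<lambda>z. 1 / z - z"])
         (use z in \<open>auto intro!: holomorphic_intros simp: s_def\<close>)
    show "harmonic_at (\<lambda>p. E (\<kappa> p)) (\<delta> z)"
      by (rule harmonic_at_deltaI[OF _ _ _ holomorphic_schwarz_integral[OF gc]])
         (use z in \<open>auto simp: E_def Qg poisson_integral_eq_Re[OF gc]\<close>)
    obtain F where F: "F analytic_on {z}" "\<forall>\<^sub>F x in nhds z. ln (norm (\<kappa> (\<delta> x))) = Re (F x)"
      using harmonic_at_ln_norm[of z] harmonic_at_delta[of z "\<lambda>p. ln (norm (\<kappa> p))"] z by auto
    have "(\<lambda>x. of_real k * F x) analytic_on {z}" by (intro analytic_intros F)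
    moreover from F(2) have "\<forall>\<^sub>F x in nhds z. k * ln (norm (\<kappa> (\<delta> x))) = Re (of_real k * F x)"
      by eventually_elim simp
    ultimately show "harmonic_at (\<lambda>p. k * ln (norm (\<kappa> p))) (\<delta> z)"
      using harmonic_at_delta[of z "\<lambda>p. k * ln (norm (\<kappa> p))"] z by auto
  qed
  have H_eq_h: "H (\<delta> z) = h (\<delta> z)" if z: "r \<le> norm z" "norm z \<le> 1" for z
  proof (rule annulus_unique[OF _ _ _ _ _ _ z])
    show "continuous_on (\<delta> ` (cball 0 1 - ball 0 r)) H"
      by (rule continuous_on_subset[OF H(1)]) (auto simp: delta_in_cl_ext)
    have "continuous_on (cball 0 1 - ball 0 r) (\<lambda>z. s z + E z + k * ln (norm z))"
      by (intro continuous_intros conts continuous_on_subset[OF Ec]) (use r_pos in auto)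
    then show "continuous_on (\<delta> ` (cball 0 1 - ball 0 r)) h"
      unfolding h_def by (rule continuous_on_compose2[OF _ continuous_on_kappa]) auto
    show "harmonic_at H (\<delta> w)" if "r < norm w" "norm w < 1" for w
      using that by (intro H(2)) (simp add: delta_in_ext)
    show "harmonic_at h (\<delta> w)" if "r < norm w" "norm w < 1" for w
      using that r_pos by (intro harm_h) auto
    show "H (\<delta> w) = h (\<delta> w)" if "norm w = r" for w
      using that r_less H(3)[OF that] fixp[OF that] lnr by (simp add: h_def E_def k_def)
    show "H (\<delta> w) = h (\<delta> w)" if "norm w = 1" for w
    proof -
      have "1 / w = cnj w" using complex_div_cnj[of 1 w] that by simp
      then have "s w = 0" by (simp add: s_def)
      then show ?thesis using that by (simp add: h_def E_def g_def)
    qed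
  qed
  \<comment> \<open>The two pieces agree on the overlap by \<open>H_eq_h\<close>, so v is locally
    one of the harmonic functions H and h away from the centre.\<close>
  define v where "v p = (if p \<in> \<delta> ` ball 0 1 then h p else H p)" for p
  have v_ext: "v p = H p" if "p \<in> ext" for p
  proof (cases "p \<in> \<delta> ` ball 0 1")
    case True
    then obtain z where "p = \<delta> z" "norm z < 1" by auto
    then show ?thesis using H_eq_h[of z] that delta_in_ext[of z] by (simp add: v_def)
  qed (simp add: v_def)
  show thesis
  proof
    fix p assume p: "p \<noteq> \<delta> 0"
    show "harmonic_at v p"
    proof (cases "p \<in> ext")
      case True
      have "\<forall>\<^sub>F q in nhds p. q \<in> ext" by (rule eventually_nhds_in_open[OF open_ext True])
      then have "\<forall>\<^sub>F q in nhds p. v q = H q" by eventually_elim (rule v_ext)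
      then show ?thesis using harmonic_at_cong H(2)[OF True] by blast
    next
      case False
      then obtain z where z: "p = \<delta> z" "norm z \<le> r" unfolding ext_def by auto
      then have "z \<noteq> 0" "norm z < 1" using p r_less by auto
      have "\<forall>\<^sub>F q in nhds p. q \<in> \<delta> ` ball 0 1"
        using z \<open>norm z < 1\<close> by (intro eventually_nhds_in_open open_delta) auto
      then have "\<forall>\<^sub>F q in nhds p. v q = h q" by eventually_elim (simp add: v_def)
      then show ?thesis using harmonic_at_cong harm_h[OF \<open>z \<noteq> 0\<close> \<open>norm z < 1\<close>] z by blast
    qed
  next
    show "(\<lambda>z. schwarz_integral g z - z) holomorphic_on ball 0 1"
      by (intro holomorphic_intros holomorphic_schwarz_integral[OF gc])
    fix z :: complex assume z: "z \<noteq> 0" "norm z < 1"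
    then show "v (\<delta> z) = Re (1 / z + (schwarz_integral g z - z)) + k * ln (norm z)"
      by (simp add: v_def h_def s_def E_def Qg poisson_integral_eq_Re[OF gc])
  qed
qed

end

section \<open>Meromorphic functions on a Riemann surface\<close>

text \<open>Gives openness of the set of points near which a meromorphic function equals, or avoids,
  a constant.\<close>

lemma eventually_at_eventually_at:
  fixes p :: "'a::t1_space"
  assumes "\<forall>\<^sub>F q in at p. P q"
  shows "\<forall>\<^sub>F x in nhds p. \<forall>\<^sub>F q in at x. P q"
proof -
  obtain S where S: "open S" "p \<in> S" "\<And>q. q \<in> S \<Longrightarrow> q \<noteq> p \<Longrightarrow> P q"
    using assms unfolding eventually_at_topological by blast
  have "\<forall>\<^sub>F x in nhds p. x \<in> S" using S by (intro eventually_nhds_in_open)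
  then show ?thesis
  proof eventually_elim
    case (elim x)
    show ?case
    proof (cases "x = p")
      case True
      then show ?thesis using assms by simp
    next
      case False
      then have "\<forall>\<^sub>F q in at x. q \<in> S - {p}"
        using S elim by (intro eventually_at_in_open') auto
      then show ?thesis by eventually_elim (use S in auto)
    qed
  qed
qed

text \<open>Turns an identity near p, with p excluded, into identities on full neighbourhoods of
  nearby points, where both sides can be differentiated.\<close>

lemma eventually_at_eventually_nhds:
  fixes p :: "'a::t1_space"
  assumes "\<forall>\<^sub>F q in at p. P q"
  shows "\<forall>\<^sub>F x in at p. \<forall>\<^sub>F q in nhds x. P q"
proof -
  obtain S where S: "open S" "p \<in> S" "\<And>q. q \<in> S \<Longrightarrow> q \<noteq> p \<Longrightarrow> P q"
    using assms unfolding eventually_at_topological by blast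
  have "\<forall>\<^sub>F x in at p. x \<in> S - {p}" using S by (intro eventually_at_in_open) auto
  then show ?thesis
  proof eventually_elim
    case (elim x)
    have "\<forall>\<^sub>F q in nhds x. q \<in> S - {p}" using S elim by (intro eventually_nhds_in_open) auto
    then show ?case by eventually_elim (use S in auto)
  qed
qed

lemma meromorphic_at_dichotomy:
  assumes "f meromorphic_on {z}"
  shows "(\<forall>\<^sub>F w in at z. f w = c) \<or> (\<forall>\<^sub>F w in at z. f w \<noteq> c)"
proof -
  have "(\<lambda>w. f w - c) meromorphic_on {z}" using assms by (intro meromorphic_intros)
  then have i: "isolated_singularity_at (\<lambda>w. f w - c) z" "not_essential (\<lambda>w. f w - c) z"
    by (auto simp: meromorphic_at_iff)
  show ?thesis
    using not_essential_frequently_0_imp_eventually_0[OF i]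
    by (auto simp: frequently_def)
qed

lemma meromorphic_at_cong:
  assumes "\<forall>\<^sub>F w in at z. f w = g w" "f meromorphic_on {z}"
  shows "g meromorphic_on {z}"
  using meromorphic_on_cong[of "{z}" f g "{z}"] assms by simp

text \<open>Separates meromorphy of the germs from the normalisation of values, so that the two can
  be treated independently on the surface.\<close>

lemma nicely_meromorphic_on_iff:
  "f nicely_meromorphic_on S \<longleftrightarrow> f meromorphic_on S \<and> (\<forall>z\<in>S. remove_sings f z = f z)"
proof (intro iffI conjI ballI)
  fix z assume f: "f nicely_meromorphic_on S" "z \<in> S"
  then have "(is_pole f z \<and> f z = 0) \<or> f \<midarrow>z\<rightarrow> f z" by (auto simp: nicely_meromorphic_on_def)
  then show "remove_sings f z = f z" by auto
next
  assume f: "f meromorphic_on S \<and> (\<forall>z\<in>S. remove_sings f z = f z)"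
  have "(is_pole f z \<and> f z = 0) \<or> f \<midarrow>z\<rightarrow> f z" if "z \<in> S" for z
  proof (cases "is_pole f z")
    case True
    then show ?thesis using f that remove_sings_at_pole[OF True] by auto
  next
    case False
    moreover have "not_essential f z"
      using f that meromorphic_on_meromorphic_at[of f S] by (auto simp: meromorphic_at_iff)
    ultimately obtain c where "f \<midarrow>z\<rightarrow> c" unfolding not_essential_def by auto
    then show ?thesis using f that remove_sings_eqI[of f c z] by auto
  qed
  then show "f nicely_meromorphic_on S" using f by (auto simp: nicely_meromorphic_on_def)
qed (auto simp: nicely_meromorphic_on_def)

section \<open>Meromorphic germs and the identity theorem\<close>

context riemann_surface
begin

lemma at_neq_bot': "at (p :: 'a) \<noteq> bot"
proof -
  obtain U u where U: "(U, u) \<in> A" "p \<in> U" using charts_cover by blast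
  show ?thesis
    using chart_eventually_at[OF U, of "\<lambda>_. False"] by (simp flip: trivial_limit_def)
qed

lemma chart_tendsto:
  assumes "(U, u) \<in> A" "p \<in> U"
  shows "(f \<longlongrightarrow> l) (at p) \<longleftrightarrow> ((\<lambda>w. f (inv_into U u w)) \<longlongrightarrow> l) (at (u p))"
  unfolding tendsto_def using chart_eventually_at[OF assms] by simp

lemma remove_sings_surface_eqI:
  assumes "(f \<longlongrightarrow> c) (at (p :: 'a))"
  shows "remove_sings_surface f p = c"
  unfolding remove_sings_surface_def using assms tendsto_Lim[OF at_neq_bot' assms] by auto

lemma remove_sings_surface_chart:
  assumes "(U, u) \<in> A" "p \<in> U"
  shows "remove_sings_surface f p = remove_sings (\<lambda>w. f (inv_into U u w)) (u p)"
proof (cases "\<exists>c. (f \<longlongrightarrow> c) (at p)")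
  case True
  then obtain c where "(f \<longlongrightarrow> c) (at p)" by blast
  then show ?thesis
    using remove_sings_surface_eqI[of f c p] remove_sings_eqI[of "\<lambda>w. f (inv_into U u w)" c "u p"]
    by (simp add: chart_tendsto[OF assms])
next
  case False
  then show ?thesis
    unfolding remove_sings_surface_def remove_sings_def by (simp add: chart_tendsto[OF assms])
qed

lemma remove_sings_surface_isCont: "isCont f (p :: 'a) \<Longrightarrow> remove_sings_surface f p = f p"
  by (intro remove_sings_surface_eqI) (simp add: isCont_def)

lemma remove_sings_surface_cong:
  assumes "\<forall>\<^sub>F q in at (p :: 'a). f q = g q"
  shows "remove_sings_surface f p = remove_sings_surface g p"
proof -
  have eq: "(f \<longlongrightarrow> c) (at p) \<longleftrightarrow> (g \<longlongrightarrow> c) (at p)" for c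
    by (rule filterlim_cong) (use assms in auto)
  show ?thesis
  proof (cases "\<exists>c. (f \<longlongrightarrow> c) (at p)")
    case True
    then show ?thesis using remove_sings_surface_eqI eq by metis
  next
    case False
    then show ?thesis unfolding remove_sings_surface_def by (simp add: eq)
  qed
qed

text \<open>Meromorphy without a condition on the value at the point. This is stable under pointwise
  operations; \<open>remove_sings_surface\<close> restores the normal form afterwards.\<close>

definition merom_at :: "('a \<Rightarrow> complex) \<Rightarrow> 'a \<Rightarrow> bool" where
  "merom_at f p \<longleftrightarrow> (\<exists>(U, u)\<in>A. p \<in> U \<and> (\<lambda>w. f (inv_into U u w)) meromorphic_on {u p})"

lemma merom_atI:
  "(U, u) \<in> A \<Longrightarrow> p \<in> U \<Longrightarrow> (\<lambda>w. f (inv_into U u w)) meromorphic_on {u p} \<Longrightarrow> merom_at f p"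
  unfolding merom_at_def by blast

lemma merom_atD:
  assumes "merom_at f p" "(U, u) \<in> A" "p \<in> U"
  shows "(\<lambda>w. f (inv_into U u w)) meromorphic_on {u p}"
proof -
  obtain V v where V: "(V, v) \<in> A" "p \<in> V" "(\<lambda>w. f (inv_into V v w)) meromorphic_on {v p}"
    using assms(1) unfolding merom_at_def by auto
  have "(\<lambda>w. f (inv_into V v (v (inv_into U u w)))) meromorphic_on {u p}"
    by (rule meromorphic_on_compose[OF V(3) transition_analytic[OF assms(2) V(1) assms(3) V(2)]])
       (use assms chart_inv_into in simp)
  moreover have "\<forall>\<^sub>F q in nhds p. q \<in> V" using V chart_open by (intro eventually_nhds_in_open) auto
  then have "\<forall>\<^sub>F w in nhds (u p). inv_into U u w \<in> V"
    using chart_eventually_nhds[OF assms(2,3)] by simp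
  then have "\<forall>\<^sub>F w in at (u p). f (inv_into V v (v (inv_into U u w))) = f (inv_into U u w)"
    unfolding eventually_nhds_conv_at
    by (elim conjE eventually_mono) (simp add: chart_inv_into[OF V(1)])
  ultimately show ?thesis by (rule meromorphic_at_cong[rotated])
qed

lemma merom_at_cong:
  assumes "\<forall>\<^sub>F q in at p. f q = g q" "merom_at f p"
  shows "merom_at g p"
proof -
  obtain U u where U: "(U, u) \<in> A" "p \<in> U" using charts_cover by blast
  have "\<forall>\<^sub>F w in at (u p). f (inv_into U u w) = g (inv_into U u w)"
    using assms(1) chart_eventually_at[OF U] by simp
  then have "(\<lambda>w. g (inv_into U u w)) meromorphic_on {u p}"
    using merom_atD[OF assms(2) U] by (rule meromorphic_at_cong)
  then show ?thesis using merom_atI U by blast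
qed

lemma merom_at_binop:
  assumes "merom_at f p" "merom_at g p"
    and "\<And>f g z. f meromorphic_on {z} \<Longrightarrow> g meromorphic_on {z} \<Longrightarrow> (\<lambda>w. h (f w) (g w)) meromorphic_on {z}"
  shows "merom_at (\<lambda>q. h (f q) (g q)) p"
proof -
  obtain U u where U: "(U, u) \<in> A" "p \<in> U" using charts_cover by blast
  show ?thesis
    by (rule merom_atI[OF U], rule assms(3)[OF merom_atD[OF assms(1) U] merom_atD[OF assms(2) U]])
qed

lemma merom_at_add: "merom_at f p \<Longrightarrow> merom_at g p \<Longrightarrow> merom_at (\<lambda>q. f q + g q) p"
  by (rule merom_at_binop) (auto intro: meromorphic_intros)

lemma merom_at_mult: "merom_at f p \<Longrightarrow> merom_at g p \<Longrightarrow> merom_at (\<lambda>q. f q * g q) p"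
  by (rule merom_at_binop) (auto intro: meromorphic_intros)

lemma merom_at_uminus: "merom_at f p \<Longrightarrow> merom_at (\<lambda>q. - f q) p"
  by (rule merom_at_binop[where h = "\<lambda>x y. - x"]) (auto intro: meromorphic_intros)

lemma merom_at_inverse: "merom_at f p \<Longrightarrow> merom_at (\<lambda>q. inverse (f q)) p"
  by (rule merom_at_binop[where h = "\<lambda>x y. inverse x"]) (auto intro: meromorphic_intros)

lemma merom_at_dichotomy:
  assumes "merom_at f p"
  shows "(\<forall>\<^sub>F q in at p. f q = c) \<or> (\<forall>\<^sub>F q in at p. f q \<noteq> c)"
proof -
  obtain U u where U: "(U, u) \<in> A" "p \<in> U" using charts_cover by blast
  show ?thesis
    using meromorphic_at_dichotomy[OF merom_atD[OF assms U], of c] chart_eventually_at[OF U] by simp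
qed

lemma chart_isCont_iff:
  assumes "(U, u) \<in> A" "p \<in> U"
  shows "isCont f p \<longleftrightarrow> isCont (\<lambda>w. f (inv_into U u w)) (u p)"
  unfolding isCont_def chart_tendsto[OF assms] by (simp add: chart_inv_into[OF assms])

lemma chart_eventually_in:
  assumes "(U, u) \<in> A" "p \<in> U"
  shows "\<forall>\<^sub>F w in nhds (u p). w \<in> u ` U"
  using assms chart_open by (intro eventually_nhds_in_open) auto

lemma merom_at_eventually_isCont:
  assumes "merom_at f p"
  shows "\<forall>\<^sub>F q in at p. isCont f q"
proof -
  obtain U u where U: "(U, u) \<in> A" "p \<in> U" using charts_cover by blast
  let ?f = "\<lambda>w. f (inv_into U u w)"
  have "isolated_singularity_at ?f (u p)"
    using merom_atD[OF assms U] by (simp add: meromorphic_at_iff)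
  then obtain r where r: "r > 0" "?f analytic_on ball (u p) r - {u p}"
    by (auto simp: isolated_singularity_at_def)
  have "\<forall>\<^sub>F w in at (u p). w \<in> ball (u p) r - {u p}" using r by (intro eventually_at_in_open) auto
  moreover have "\<forall>\<^sub>F w in at (u p). w \<in> u ` U"
    using chart_eventually_in[OF U] by (simp add: eventually_nhds_conv_at)
  ultimately have "\<forall>\<^sub>F w in at (u p). isCont f (inv_into U u w)"
  proof eventually_elim
    case (elim w)
    then have "?f analytic_on {w}" by (intro analytic_on_subset[OF r(2)]) auto
    then have "isCont ?f w" by (rule analytic_at_imp_isCont)
    then have "isCont ?f (u (inv_into U u w))" using elim chart_inv_into'[OF U(1)] by simp
    then show ?case using elim chart_isCont_iff[OF U(1) inv_into_into, of w u f] by simp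
  qed
  then show ?thesis using chart_eventually_at[OF U] by blast
qed

lemma eventually_remove_sings_surface:
  assumes "merom_at f p"
  shows "\<forall>\<^sub>F q in at p. remove_sings_surface f q = f q"
  using merom_at_eventually_isCont[OF assms] by eventually_elim (rule remove_sings_surface_isCont)

lemma meromorphic_function_iff:
  "meromorphic_function A f \<longleftrightarrow> (\<forall>p. merom_at f p \<and> remove_sings_surface f p = f p)"
proof (intro iffI allI)
  fix p assume f: "meromorphic_function A f"
  obtain U u where U: "(U, u) \<in> A" "p \<in> U" using charts_cover by blast
  have "(\<lambda>w. f (inv_into U u w)) nicely_meromorphic_on {u p}"
    using f U unfolding meromorphic_function_def
    by (auto intro: nicely_meromorphic_on_subset[of _ "u ` U"])
  then show "merom_at f p \<and> remove_sings_surface f p = f p"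
    using U merom_atI remove_sings_surface_chart[OF U] chart_inv_into[OF U]
    by (auto simp: nicely_meromorphic_on_iff)
next
  assume f: "\<forall>p. merom_at f p \<and> remove_sings_surface f p = f p"
  have "(\<lambda>w. f (inv_into U u w)) nicely_meromorphic_on u ` U" if U: "(U, u) \<in> A" for U u
    unfolding nicely_meromorphic_on_iff
  proof
    show "(\<lambda>w. f (inv_into U u w)) meromorphic_on u ` U"
      by (subst meromorphic_on_meromorphic_at) (use f merom_atD[OF _ U] in auto)
    show "\<forall>z\<in>u ` U. remove_sings (\<lambda>w. f (inv_into U u w)) z = f (inv_into U u z)"
      using f by (auto simp: chart_inv_into[OF U] simp flip: remove_sings_surface_chart[OF U])
  qed
  then show "meromorphic_function A f" unfolding meromorphic_function_def by auto
qed

lemma meromorphic_function_remove_sings_surface: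
  assumes "\<And>p. merom_at f p"
  shows "meromorphic_function A (remove_sings_surface f)"
  unfolding meromorphic_function_iff
proof
  fix p
  have ev: "\<forall>\<^sub>F q in at p. remove_sings_surface f q = f q"
    by (rule eventually_remove_sings_surface[OF assms])
  then have "merom_at (remove_sings_surface f) p"
    by (intro merom_at_cong[OF _ assms]) (auto simp: eq_commute)
  then show "merom_at (remove_sings_surface f) p \<and>
      remove_sings_surface (remove_sings_surface f) p = remove_sings_surface f p"
    using remove_sings_surface_cong[OF ev] by simp
qed

lemma meromorphic_function_eqI:
  assumes "meromorphic_function A f" "meromorphic_function A g" "\<And>p. \<forall>\<^sub>F q in at p. f q = g q"
  shows "f = g"
  using assms remove_sings_surface_cong[OF assms(3)] by (auto simp: meromorphic_function_iff fun_eq_iff)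

lemma meromorphic_function_const: "meromorphic_function A (\<lambda>_. c)"
  unfolding meromorphic_function_def by (auto intro: nicely_meromorphic_on_const)

text \<open>By the dichotomy for meromorphic germs, the points near which f is c and those near
  which it avoids c form a partition into two open sets, and the surface is connected.\<close>

lemma meromorphic_identity_theorem:
  assumes f: "meromorphic_function A f" and p: "\<not> (\<forall>\<^sub>F q in at p. f q \<noteq> c)"
  shows "f = (\<lambda>_. c)"
proof -
  define S where "S = {p. \<forall>\<^sub>F q in at p. f q = c}"
  have m: "merom_at f q" for q using f by (simp add: meromorphic_function_iff)
  have "\<not> ((\<forall>\<^sub>F q in at p. f q = c) \<and> (\<forall>\<^sub>F q in at p. f q \<noteq> c))" for p
  proof
    assume "(\<forall>\<^sub>F q in at p. f q = c) \<and> (\<forall>\<^sub>F q in at p. f q \<noteq> c)"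
    then have "\<forall>\<^sub>F q in at p. f q = c \<and> f q \<noteq> c" by (intro eventually_conj) auto
    then show False using at_neq_bot'[of p] by simp
  qed
  then have compl: "- S = {p. \<forall>\<^sub>F q in at p. f q \<noteq> c}"
    using merom_at_dichotomy[OF m, of c] by (auto simp: S_def)
  have "open S" "open (- S)"
    unfolding compl unfolding S_def open_subopen[of "Collect _"]
    using eventually_at_eventually_at by (force simp: eventually_nhds)+
  then have "S = {} \<or> S = UNIV"
    using connected_surface connected_clopen[of "UNIV :: 'a set"] by (auto simp: closed_def)
  moreover have "p \<in> S" using p compl by blast
  ultimately have "\<forall>\<^sub>F q in at x. f q = c" for x by (auto simp: S_def)
  then show ?thesis
    by (intro meromorphic_function_eqI[OF f meromorphic_function_const])
qed

section \<open>The operations of the meromorphic field\<close>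

lemma meromorphic_field_simps:
  "carrier (meromorphic_field A) = {f. meromorphic_function A f}"
  "f \<otimes>\<^bsub>meromorphic_field A\<^esub> g = remove_sings_surface (\<lambda>p. f p * g p)"
  "f \<oplus>\<^bsub>meromorphic_field A\<^esub> g = remove_sings_surface (\<lambda>p. f p + g p)"
  "\<one>\<^bsub>meromorphic_field A\<^esub> = (\<lambda>_. 1)" "\<zero>\<^bsub>meromorphic_field A\<^esub> = (\<lambda>_. 0)"
  by (simp_all add: meromorphic_field_def)

text \<open>The inverse is a definite description over the carrier. Off isolated points the field
  operation is the pointwise one; uniqueness is seen there and extended by
  \<open>meromorphic_function_eqI\<close>.\<close>

lemma meromorphic_field_a_inv:
  assumes f: "meromorphic_function A f"
  shows "\<ominus>\<^bsub>meromorphic_field A\<^esub> f = remove_sings_surface (\<lambda>p. - f p)"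
  unfolding a_inv_def m_inv_def
proof (rule the_equality, goal_cases)
  case 1
  have m: "merom_at f p" "merom_at (\<lambda>p. - f p) p" for p
    using f merom_at_uminus by (auto simp: meromorphic_function_iff)
  have "\<forall>\<^sub>F q in at p. f q + remove_sings_surface (\<lambda>p. - f p) q = 0" for p
    using eventually_remove_sings_surface[OF m(2)] by eventually_elim simp
  then have "\<forall>\<^sub>F q in at p. remove_sings_surface (\<lambda>p. - f p) q + f q = 0"
      "\<forall>\<^sub>F q in at p. f q + remove_sings_surface (\<lambda>p. - f p) q = 0" for p
    by (simp_all add: add.commute)
  from this[THEN remove_sings_surface_cong] show ?case
    using meromorphic_function_remove_sings_surface[OF m(2)] remove_sings_surface_isCont[where f = "\<lambda>_. 0"]
    by (auto simp: meromorphic_field_simps fun_eq_iff)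
next
  case (2 y)
  then have y: "meromorphic_function A y" and eq: "remove_sings_surface (\<lambda>p. f p + y p) = (\<lambda>_. 0)"
    by (simp_all add: meromorphic_field_simps)
  have m: "merom_at f p" "merom_at y p" "merom_at (\<lambda>p. - f p) p" for p
    using f y merom_at_uminus by (auto simp: meromorphic_function_iff)
  show ?case
  proof (rule meromorphic_function_eqI[OF y meromorphic_function_remove_sings_surface[OF m(3)]])
    fix p
    show "\<forall>\<^sub>F q in at p. y q = remove_sings_surface (\<lambda>p. - f p) q"
      using eventually_remove_sings_surface[OF m(3), of p]
        eventually_remove_sings_surface[OF merom_at_add[OF m(1,2)], of p]
      by eventually_elim (use eq in \<open>auto simp: add_eq_0_iff fun_eq_iff\<close>)
  qed
qed

text \<open>A function other than 0 has isolated zeros by the identity theorem, so the convention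
  \<open>inverse 0 = 0\<close> affects only values that \<open>remove_sings_surface\<close>
  resets.\<close>

lemma meromorphic_field_m_inv:
  assumes f: "meromorphic_function A f" and nz: "f \<noteq> (\<lambda>_. 0)"
  shows "inv\<^bsub>meromorphic_field A\<^esub> f = remove_sings_surface (\<lambda>p. inverse (f p))"
  unfolding m_inv_def
proof (rule the_equality, goal_cases)
  case 1
  have m: "merom_at f p" "merom_at (\<lambda>p. inverse (f p)) p" for p
    using f merom_at_inverse by (auto simp: meromorphic_function_iff)
  have ev: "\<forall>\<^sub>F q in at p. f q * remove_sings_surface (\<lambda>p. inverse (f p)) q = 1" for p
  proof -
    have "\<forall>\<^sub>F q in at p. f q \<noteq> 0" using meromorphic_identity_theorem[OF f] nz by blast
    then show ?thesis using eventually_remove_sings_surface[OF m(2)] by eventually_elim simp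
  qed
  then have "\<forall>\<^sub>F q in at p. remove_sings_surface (\<lambda>p. inverse (f p)) q * f q = 1"
      "\<forall>\<^sub>F q in at p. f q * remove_sings_surface (\<lambda>p. inverse (f p)) q = 1" for p
    by (simp_all add: mult.commute)
  from this[THEN remove_sings_surface_cong] show ?case
    using meromorphic_function_remove_sings_surface[OF m(2)] remove_sings_surface_isCont[where f = "\<lambda>_. 1"]
    by (auto simp: meromorphic_field_simps fun_eq_iff)
next
  case (2 y)
  then have y: "meromorphic_function A y" and eq: "remove_sings_surface (\<lambda>p. f p * y p) = (\<lambda>_. 1)"
    by (simp_all add: meromorphic_field_simps)
  have m: "merom_at f p" "merom_at y p" "merom_at (\<lambda>p. inverse (f p)) p" for p
    using f y merom_at_inverse by (auto simp: meromorphic_function_iff)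
  show ?case
  proof (rule meromorphic_function_eqI[OF y meromorphic_function_remove_sings_surface[OF m(3)]])
    fix p
    show "\<forall>\<^sub>F q in at p. y q = remove_sings_surface (\<lambda>p. inverse (f p)) q"
      using eventually_remove_sings_surface[OF m(3), of p]
        eventually_remove_sings_surface[OF merom_at_mult[OF m(1,2)], of p]
    proof eventually_elim
      case (elim q)
      then have "f q * y q = 1" using eq by (auto simp: fun_eq_iff)
      then show ?case using elim inverse_unique[of "f q" "y q"] by simp
    qed
  qed
qed

text \<open>
  The compositum has to lie in the carrier, since a pointwise identity near \<open>p\<close> passes to the field
  operations only for functions whose singularities are isolated.
\<close>

lemma compositum_invariant:
  assumes \<sigma>: "filterlim \<sigma> (at p) (at p)"
    and sub: "compositum (meromorphic_field A) K L \<subseteq> carrier (meromorphic_field A)"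
    and inv: "\<And>f. f \<in> K \<union> L \<Longrightarrow> \<forall>\<^sub>F q in at p. f (\<sigma> q) = f q"
    and f: "f \<in> compositum (meromorphic_field A) K L"
  shows "\<forall>\<^sub>F q in at p. f (\<sigma> q) = f q"
proof -
  let ?F = "meromorphic_field A"
  have mero: "meromorphic_function A g" if "g \<in> generate_field ?F (K \<union> L)" for g
    using sub that by (auto simp: compositum_def meromorphic_field_simps)
  \<comment> \<open>Passing to the normal form changes g only at isolated points, and \<sigma>
    carries punctured neighbourhoods of p into punctured neighbourhoods of p.\<close>
  have rss: "\<forall>\<^sub>F q in at p. remove_sings_surface g (\<sigma> q) = remove_sings_surface g q"
    if "merom_at g p" "\<forall>\<^sub>F q in at p. g (\<sigma> q) = g q" for g
  proof -
    have ev: "\<forall>\<^sub>F q in at p. remove_sings_surface g q = g q"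
      by (rule eventually_remove_sings_surface[OF that(1)])
    from eventually_compose_filterlim[OF ev \<sigma>] ev that(2) show ?thesis
      by eventually_elim simp
  qed
  have m: "merom_at g p" if "g \<in> generate_field ?F (K \<union> L)" for g
    using mero[OF that] by (simp add: meromorphic_function_iff)
  from f have "f \<in> generate_field ?F (K \<union> L)" by (simp add: compositum_def)
  then show ?thesis
  proof (induction rule: generate_field.induct)
    case one
    then show ?case by (simp add: meromorphic_field_simps)
  next
    case (incl h)
    then show ?case by (rule inv)
  next
    case (a_inv h)
    have "\<forall>\<^sub>F q in at p. - h (\<sigma> q) = - h q" using a_inv.IH by eventually_elim simp
    then show ?case
      unfolding meromorphic_field_a_inv[OF mero[OF a_inv.hyps]]
      by (intro rss merom_at_uminus m a_inv.hyps)
  next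
    case (m_inv h)
    have "\<forall>\<^sub>F q in at p. inverse (h (\<sigma> q)) = inverse (h q)" using m_inv.IH by eventually_elim simp
    moreover have "h \<noteq> (\<lambda>_. 0)" using m_inv.hyps by (simp add: meromorphic_field_simps)
    ultimately show ?case
      using meromorphic_field_m_inv[OF mero[OF m_inv.hyps(1)]] rss[OF merom_at_inverse[OF m[OF m_inv.hyps(1)]]]
      by simp
  next
    case (eng_add g h)
    have "\<forall>\<^sub>F q in at p. g (\<sigma> q) + h (\<sigma> q) = g q + h q" using eng_add.IH by eventually_elim simp
    then show ?case
      unfolding meromorphic_field_simps by (intro rss merom_at_add m eng_add.hyps)
  next
    case (eng_mult g h)
    have "\<forall>\<^sub>F q in at p. g (\<sigma> q) * h (\<sigma> q) = g q * h q" using eng_mult.IH by eventually_elim simp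
    then show ?case
      unfolding meromorphic_field_simps by (intro rss merom_at_mult m eng_mult.hyps)
  qed
qed

end

section \<open>Local rotations\<close>

lemma analytic_nth_root:
  fixes N :: int
  assumes P: "P analytic_on {a}" "P a \<noteq> 0" and N: "N \<noteq> 0"
  obtains Q where "Q analytic_on {a}" "Q a \<noteq> 0" "\<forall>\<^sub>F w in nhds a. Q w powi N = P w"
proof -
  \<comment> \<open>Dividing by P a brings the argument of \<open>Ln\<close> close to 1, away from
    the slit, whatever the value of P a.\<close>
  define Q where "Q w = exp ((Ln (P w / P a) + Ln (P a)) / of_int N)" for w
  have "Q analytic_on {a}"
    unfolding Q_def using P N by (intro analytic_intros) auto
  moreover have "Q a \<noteq> 0" by (simp add: Q_def)
  moreover have "(P \<longlongrightarrow> P a) (nhds a)"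
    using analytic_at_imp_isCont[OF P(1)] unfolding isCont_def tendsto_at_iff_tendsto_nhds .
  then have "\<forall>\<^sub>F w in nhds a. P w \<noteq> 0" using P(2) by (rule tendsto_imp_eventually_ne)
  then have "\<forall>\<^sub>F w in nhds a. Q w powi N = P w"
    by eventually_elim (use P N in \<open>simp add: Q_def exp_power_int exp_add\<close>)
  ultimately show thesis by (rule that)
qed

text \<open>The nonvanishing factor beside the power of w - a has an analytic root, which is
  absorbed into the coordinate t. A negative order describes a pole.\<close>

lemma local_root_zorder:
  assumes g: "g meromorphic_on {a}" and nz: "\<exists>\<^sub>F w in at a. g w \<noteq> 0" and N: "zorder g a \<noteq> 0"
  obtains t where "t analytic_on {a}" "t a = 0" "deriv t a \<noteq> 0"
    "\<forall>\<^sub>F w in at a. g w = t w powi zorder g a"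
proof -
  define P where "P = zor_poly g a"
  obtain r where P: "P a \<noteq> 0" "r > 0" "P holomorphic_on cball a r"
      "\<And>w. w \<in> cball a r - {a} \<Longrightarrow> g w = P w * (w - a) powi zorder g a \<and> P w \<noteq> 0"
    using zorder_exist[of g a] g nz unfolding P_def meromorphic_at_iff by auto
  have anP: "P analytic_on {a}"
    unfolding analytic_at using P(2,3)
    by (intro exI[of _ "ball a r"]) (auto intro: holomorphic_on_subset)
  obtain Q where Q: "Q analytic_on {a}" "Q a \<noteq> 0" "\<forall>\<^sub>F w in nhds a. Q w powi zorder g a = P w"
    by (rule analytic_nth_root[OF anP P(1) N])
  define t where "t w = Q w * (w - a)" for w
  have "(Q has_field_derivative deriv Q a) (at a)"
    by (rule analytic_derivI[OF Q(1)])
  then have "(t has_field_derivative Q a) (at a)"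
    unfolding t_def by (auto intro!: derivative_eq_intros)
  then have "deriv t a \<noteq> 0" using DERIV_imp_deriv Q(2) by metis
  moreover have "t analytic_on {a}" unfolding t_def using Q by (intro analytic_intros)
  moreover have "\<forall>\<^sub>F w in at a. w \<in> ball a r - {a}" using P(2) by (intro eventually_at_in_open) auto
  then have "\<forall>\<^sub>F w in at a. g w = t w powi zorder g a"
    using Q(3)[unfolded eventually_nhds_conv_at, THEN conjunct1]
    by eventually_elim (use P(4) in \<open>auto simp: t_def power_int_mult_distrib\<close>)
  ultimately show thesis using that by (auto simp: t_def)
qed

text \<open>If the order is 0, the limit value is subtracted first and becomes c; nonconstancy then
  makes the order of the remainder positive. Otherwise c is 0.\<close>

lemma local_root:
  assumes g: "g meromorphic_on {a}" and nc: "\<And>c. \<exists>\<^sub>F w in at a. g w \<noteq> c"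
  obtains c N t where "N \<noteq> 0" "t analytic_on {a}" "t a = 0" "deriv t a \<noteq> 0"
    "\<forall>\<^sub>F w in at a. g w = c + t w powi N"
proof (cases "zorder g a = 0")
  case False
  then show thesis
    using local_root_zorder[OF g nc False] that[of "zorder g a" _ 0] by auto
next
  case True
  define P where "P = zor_poly g a"
  obtain r where P: "P a \<noteq> 0" "r > 0" "P holomorphic_on cball a r"
      "\<And>w. w \<in> cball a r - {a} \<Longrightarrow> g w = P w * (w - a) powi zorder g a \<and> P w \<noteq> 0"
    using zorder_exist[of g a] g nc unfolding P_def meromorphic_at_iff by auto
  define G where "G w = P w - P a" for w
  have G: "G analytic_on {a}"
    unfolding analytic_at G_def using P(2,3)
    by (intro exI[of _ "ball a r"]) (auto intro!: holomorphic_intros intro: holomorphic_on_subset)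
  have "\<forall>\<^sub>F w in at a. w \<in> ball a r - {a}" using P(2) by (intro eventually_at_in_open) auto
  then have gG: "\<forall>\<^sub>F w in at a. g w = P a + G w"
    by eventually_elim (use P(4) True in \<open>auto simp: G_def\<close>)
  have fG: "\<exists>\<^sub>F w in at a. G w \<noteq> 0"
  proof (rule ccontr)
    assume "\<not> (\<exists>\<^sub>F w in at a. G w \<noteq> 0)"
    then have "\<forall>\<^sub>F w in at a. G w = 0" by (simp add: frequently_def)
    with gG have "\<forall>\<^sub>F w in at a. g w = P a" by eventually_elim simp
    then show False using nc[of "P a"] by (simp add: frequently_def)
  qed
  have "zorder G a > 0"
    unfolding zorder_pos_iff'[OF G fG] by (simp add: G_def)
  then have NG: "zorder G a \<noteq> 0" by simp
  obtain t where t: "t analytic_on {a}" "t a = 0" "deriv t a \<noteq> 0" "\<forall>\<^sub>F w in at a. G w = t w powi zorder G a"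
    using local_root_zorder[OF analytic_on_imp_meromorphic_on[OF G] fG NG] by blast
  have "\<forall>\<^sub>F w in at a. g w = P a + t w powi zorder G a"
    using gG t(4) by eventually_elim simp
  then show thesis using that[OF NG t(1-3)] by blast
qed

lemma analytic_local_inverse:
  assumes t: "t analytic_on {a}" "deriv t a \<noteq> 0"
  obtains s r where "s analytic_on {t a}" "r > 0" "inj_on t (ball a r)"
    "\<And>w. w \<in> ball a r \<Longrightarrow> s (t w) = w" "\<forall>\<^sub>F z in nhds (t a). t (s z) = z"
proof -
  obtain S where S: "open S" "a \<in> S" "t holomorphic_on S" using t(1) by (auto simp: analytic_at)
  obtain r where r: "r > 0" "ball a r \<subseteq> S" "inj_on t (ball a r)"
    using has_complex_derivative_locally_injective[OF S(3,2,1) t(2)] by blast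
  have hol: "t holomorphic_on ball a r" using S r holomorphic_on_subset by blast
  obtain s where s: "s holomorphic_on (t ` ball a r)" "\<And>z. z \<in> ball a r \<Longrightarrow> s (t z) = z"
    by (rule holomorphic_has_inverse[OF hol open_ball r(3)]) (rule that)
  have op: "open (t ` ball a r)" by (rule open_mapping_thm3[OF hol open_ball r(3)])
  have ta: "t a \<in> t ` ball a r" using r by simp
  have "s analytic_on {t a}" unfolding analytic_at using s op ta by blast
  moreover have "\<forall>\<^sub>F z in nhds (t a). z \<in> t ` ball a r"
    using op ta by (rule eventually_nhds_in_open)
  then have "\<forall>\<^sub>F z in nhds (t a). t (s z) = z" by eventually_elim (use s in auto)
  ultimately show thesis using that r s by blast
qed

text \<open>\<sigma> is multiplication by \<omega> in the coordinate t. Differentiating t(\<sigma>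
  w) = \<omega> t(w) at the fixed point a yields its derivative.\<close>

lemma local_rotation_exists:
  assumes t: "t analytic_on {a}" "t a = 0" "deriv t a \<noteq> 0"
    and g: "\<forall>\<^sub>F w in at a. g w = c + t w ^ n" and \<omega>: "\<omega> ^ n = 1" "\<omega> \<noteq> 0"
  obtains \<sigma> where "\<sigma> analytic_on {a}" "\<sigma> a = a" "deriv \<sigma> a = \<omega>" "filterlim \<sigma> (at a) (at a)"
    "\<forall>\<^sub>F w in at a. g (\<sigma> w) = g w"
proof -
  obtain s r where s: "s analytic_on {t a}" "r > 0" "inj_on t (ball a r)"
    "\<And>w. w \<in> ball a r \<Longrightarrow> s (t w) = w" "\<forall>\<^sub>F z in nhds (t a). t (s z) = z"
    by (rule analytic_local_inverse[OF t(1,3)]) (rule that)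
  define \<sigma> where "\<sigma> w = s (\<omega> * t w)" for w
  have m: "(\<lambda>w. \<omega> * t w) analytic_on {a}" by (intro analytic_intros t)
  have "(s \<circ> (\<lambda>w. \<omega> * t w)) analytic_on {a}"
    by (rule analytic_on_compose[OF m]) (use s(1) t(2) in simp)
  then have an: "\<sigma> analytic_on {a}" by (simp add: o_def \<sigma>_def[abs_def])
  have fix_a: "\<sigma> a = a" using s(4)[of a] s(2) t(2) by (simp add: \<sigma>_def)
  have "((\<lambda>w. \<omega> * t w) \<longlongrightarrow> t a) (nhds a)"
    using analytic_at_imp_isCont[OF m] t(2)
    unfolding isCont_def tendsto_at_iff_tendsto_nhds[of "\<lambda>w. \<omega> * t w"] by simp
  from eventually_compose_filterlim[OF s(5) this]
  have ts: "\<forall>\<^sub>F w in nhds a. t (\<sigma> w) = \<omega> * t w" by (simp add: \<sigma>_def)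
  have dt: "(t has_field_derivative deriv t a) (at a)"
    by (rule analytic_derivI[OF t(1)])
  have d\<sigma>: "(\<sigma> has_field_derivative deriv \<sigma> a) (at a)"
    by (rule analytic_derivI[OF an])
  have "((\<lambda>w. t (\<sigma> w)) has_field_derivative deriv t a * deriv \<sigma> a) (at a)"
    using DERIV_chain2[of t "deriv t a" \<sigma> a "deriv \<sigma> a"] dt d\<sigma> fix_a by simp
  moreover have "((\<lambda>w. \<omega> * t w) has_field_derivative \<omega> * deriv t a) (at a)"
    by (intro DERIV_cmult dt)
  moreover have "((\<lambda>w. t (\<sigma> w)) has_field_derivative D) (at a) \<longleftrightarrow>
      ((\<lambda>w. \<omega> * t w) has_field_derivative D) (at a)" for D
    by (rule DERIV_cong_ev) (use ts in auto)
  ultimately have "deriv t a * deriv \<sigma> a = \<omega> * deriv t a" using DERIV_unique by blast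
  then have d: "deriv \<sigma> a = \<omega>" using t(3) by simp
  have ne: "\<forall>\<^sub>F w in at a. \<sigma> w \<noteq> a"
  proof -
    have "\<forall>\<^sub>F w in at a. w \<in> ball a r - {a}" using s(2) by (intro eventually_at_in_open) auto
    then show ?thesis using ts[unfolded eventually_nhds_conv_at, THEN conjunct1]
    proof eventually_elim
      case (elim w)
      then have "t w \<noteq> t a" using s(2,3) by (auto simp: inj_on_def)
      then show ?case using elim \<omega> t(2) by auto
    qed
  qed
  have "(\<sigma> \<longlongrightarrow> a) (at a)" using analytic_at_imp_isCont[OF an] fix_a by (simp add: isCont_def)
  then have lim: "filterlim \<sigma> (at a) (at a)" using ne by (simp add: filterlim_at)
  have "\<forall>\<^sub>F w in at a. g (\<sigma> w) = g w"
    using eventually_compose_filterlim[OF g lim] g ts[unfolded eventually_nhds_conv_at, THEN conjunct1]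
    by eventually_elim (simp add: power_mult_distrib \<omega>)
  then show thesis using that an fix_a d lim by blast
qed

text \<open>Invariance of g makes the quotient of t(\<sigma> w) by t(\<tau> w) a root of unity, and
  equal derivatives make it tend to 1. There are finitely many candidates, so the quotient is 1 near
  a, and t is injective.\<close>

lemma local_rotation_unique:
  assumes t: "t analytic_on {a}" "t a = 0" "deriv t a \<noteq> 0" and N: "N \<noteq> 0"
    and g: "\<forall>\<^sub>F w in at a. g w = c + t w powi N"
    and \<sigma>: "\<sigma> analytic_on {a}" "\<sigma> a = a" "deriv \<sigma> a = \<omega>" "filterlim \<sigma> (at a) (at a)"
      "\<forall>\<^sub>F w in at a. g (\<sigma> w) = g w"
    and \<tau>: "\<tau> analytic_on {a}" "\<tau> a = a" "deriv \<tau> a = \<omega>" "filterlim \<tau> (at a) (at a)"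
      "\<forall>\<^sub>F w in at a. g (\<tau> w) = g w"
    and \<omega>: "\<omega> \<noteq> 0"
  shows "\<forall>\<^sub>F w in at a. \<sigma> w = \<tau> w"
proof -
  obtain s r where s: "s analytic_on {t a}" "r > 0" "inj_on t (ball a r)"
    "\<And>w. w \<in> ball a r \<Longrightarrow> s (t w) = w" "\<forall>\<^sub>F z in nhds (t a). t (s z) = z"
    by (rule analytic_local_inverse[OF t(1,3)]) (rule that)
  have dt: "(t has_field_derivative deriv t a) (at a)"
    by (rule analytic_derivI[OF t(1)])
  have quot: "((\<lambda>w. t (\<rho> w) / (w - a)) \<longlongrightarrow> deriv t a * \<omega>) (at a)"
    if "\<rho> analytic_on {a}" "\<rho> a = a" "deriv \<rho> a = \<omega>" for \<rho>
  proof -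
    have "(\<rho> has_field_derivative \<omega>) (at a)"
      using analytic_derivI[OF that(1), of UNIV] that(3) by simp
    then have "((\<lambda>w. t (\<rho> w)) has_field_derivative deriv t a * \<omega>) (at a)"
      using DERIV_chain2[of t "deriv t a" \<rho> a \<omega>] dt that by simp
    then show ?thesis using that t(2) by (simp add: has_field_derivative_iff)
  qed
  have "((\<lambda>w. (t (\<sigma> w) / (w - a)) / (t (\<tau> w) / (w - a))) \<longlongrightarrow> (deriv t a * \<omega>) / (deriv t a * \<omega>)) (at a)"
    by (intro tendsto_divide quot \<sigma> \<tau>) (use t \<omega> in auto)
  then have "((\<lambda>w. (t (\<sigma> w) / (w - a)) / (t (\<tau> w) / (w - a))) \<longlongrightarrow> 1) (at a)" using t \<omega> by simp
  moreover have "\<forall>\<^sub>F w in at a. (t (\<sigma> w) / (w - a)) / (t (\<tau> w) / (w - a)) = t (\<sigma> w) / t (\<tau> w)"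
    unfolding eventually_at_filter by (intro always_eventually) auto
  ultimately have lim: "((\<lambda>w. t (\<sigma> w) / t (\<tau> w)) \<longlongrightarrow> 1) (at a)"
    by (rule Lim_transform_eventually)
  \<comment> \<open>N may be negative, at a pole of g; equality of the powers with exponent N is the
    same as with exponent |N|.\<close>
  define n where "n = nat \<bar>N\<bar>"
  have n: "n > 0" using N by (simp add: n_def)
  have "finite ({z::complex. z ^ n = 1} - {1})"
    using n finite_nth_roots[of n 1] by auto
  then have "open (- ({z::complex. z ^ n = 1} - {1}))"
    by (intro open_Compl finite_imp_closed)
  then have ev1: "\<forall>\<^sub>F w in at a. t (\<sigma> w) / t (\<tau> w) \<in> - ({z. z ^ n = 1} - {1})"
    by (rule topological_tendstoD[OF lim]) simp
  have inball: "\<forall>\<^sub>F w in at a. w \<in> ball a r - {a}" using s(2) by (intro eventually_at_in_open) auto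
  show ?thesis
    using ev1 eventually_compose_filterlim[OF inball \<sigma>(4)] eventually_compose_filterlim[OF inball \<tau>(4)]
      eventually_compose_filterlim[OF g \<sigma>(4)] eventually_compose_filterlim[OF g \<tau>(4)] \<sigma>(5) \<tau>(5)
  proof eventually_elim
    case (elim w)
    have nz: "t (\<sigma> w) \<noteq> 0" "t (\<tau> w) \<noteq> 0"
      using elim s(2,3) t(2) by (auto simp: inj_on_def)
    have "t (\<sigma> w) powi N = t (\<tau> w) powi N" using elim by simp
    then have "t (\<sigma> w) ^ n = t (\<tau> w) ^ n"
      unfolding n_def power_int_def by (auto split: if_splits simp: power_inverse abs_if)
    then have "(t (\<sigma> w) / t (\<tau> w)) ^ n = 1" using nz by (simp add: power_divide)
    then have "t (\<sigma> w) = t (\<tau> w)" using elim(1) nz by simp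
    then show ?case using elim s(3) by (auto simp: inj_on_def)
  qed
qed

text \<open>In the local form the derivative is N t^(N-1) t', and both t and t' are nonzero off a
  near a. This allows the factor H' to be cancelled later.\<close>

lemma eventually_deriv_nonzero:
  assumes t: "t analytic_on {a}" "t a = 0" "deriv t a \<noteq> 0" and N: "N \<noteq> 0"
    and g: "\<forall>\<^sub>F w in at a. g w = c + t w powi N"
  shows "\<forall>\<^sub>F w in at a. deriv g w \<noteq> 0"
proof -
  obtain s r where s: "s analytic_on {t a}" "r > 0" "inj_on t (ball a r)"
    "\<And>w. w \<in> ball a r \<Longrightarrow> s (t w) = w" "\<forall>\<^sub>F z in nhds (t a). t (s z) = z"
    by (rule analytic_local_inverse[OF t(1,3)]) (rule that)
  have inball: "\<forall>\<^sub>F w in at a. w \<in> ball a r - {a}" using s(2) by (intro eventually_at_in_open) auto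
  have ant: "\<forall>\<^sub>F w in at a. t analytic_on {w}"
    using eventually_analytic_at[OF t(1)] by (simp add: eventually_nhds_conv_at)
  have "(deriv t \<longlongrightarrow> deriv t a) (at a)"
    using analytic_at_imp_isCont[OF analytic_deriv[OF t(1)]] by (simp add: isCont_def)
  then have dt: "\<forall>\<^sub>F w in at a. deriv t w \<noteq> 0" using t(3) by (rule tendsto_imp_eventually_ne)
  show ?thesis
    using inball ant dt eventually_at_eventually_nhds[OF g]
  proof eventually_elim
    case (elim w)
    have "t w \<noteq> t a" using elim(1) s(2,3) by (auto simp: inj_on_def)
    then have tw: "t w \<noteq> 0" using t(2) by simp
    have "(t has_field_derivative deriv t w) (at w)" by (rule analytic_derivI[OF elim(2)])
    then have "((\<lambda>w. c + t w powi N) has_field_derivative of_int N * t w powi (N - 1) * deriv t w) (at w)"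
      using tw by (auto intro!: derivative_eq_intros)
    then have "(g has_field_derivative of_int N * t w powi (N - 1) * deriv t w) (at w)"
      using DERIV_cong_ev[OF refl elim(4) refl] by simp
    then have "deriv g w = of_int N * t w powi (N - 1) * deriv t w" by (rule DERIV_imp_deriv)
    then show ?case using N tw elim(3) by simp
  qed
qed

text \<open>
  Differentiating \<open>H \<circ> \<sigma> = H\<close> shows that invariance of \<open>\<phi> / H'\<close> under \<open>\<sigma>\<close> means
  invariance of the differential \<open>\<phi> dw\<close>, which fails for a double pole unless \<open>\<sigma>\<close> is tangent to the identity.
\<close>

lemma double_pole_not_invariant:
  assumes H: "H meromorphic_on {a}" and dH: "\<forall>\<^sub>F w in at a. deriv H w \<noteq> 0"
    and \<sigma>: "\<sigma> analytic_on {a}" "\<sigma> a = a" "deriv \<sigma> a = \<omega>" "filterlim \<sigma> (at a) (at a)" "\<omega> \<noteq> 0"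
    and inv: "\<forall>\<^sub>F w in at a. H (\<sigma> w) = H w"
    and quot: "\<forall>\<^sub>F w in at a. \<phi> (\<sigma> w) / deriv H (\<sigma> w) = \<phi> w / deriv H w"
    and lim: "((\<lambda>w. \<phi> w * (w - a)\<^sup>2) \<longlongrightarrow> L) (at a)" "L \<noteq> 0"
  shows "\<omega> = 1"
proof -
  have "isolated_singularity_at H a" using H by (simp add: meromorphic_at_iff)
  then obtain r where r: "r > 0" "H analytic_on ball a r - {a}"
    by (auto simp: isolated_singularity_at_def)
  have "\<forall>\<^sub>F w in at a. w \<in> ball a r - {a}" using r by (intro eventually_at_in_open) auto
  then have anH: "\<forall>\<^sub>F w in at a. H analytic_on {w}"
    by eventually_elim (rule analytic_on_subset[OF r(2)], auto)
  note inv' = eventually_at_eventually_nhds[OF inv]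
  have an\<sigma>: "\<forall>\<^sub>F w in at a. \<sigma> analytic_on {w}"
    using eventually_analytic_at[OF \<sigma>(1)] by (simp add: eventually_nhds_conv_at)
  have d\<sigma>: "(\<sigma> has_field_derivative \<omega>) (at a)"
    using analytic_derivI[OF \<sigma>(1), of UNIV] \<sigma>(3) by simp
  \<comment> \<open>The relation \<phi>(\<sigma> w) \<sigma>'(w) = \<phi>(w), multiplied by (w -
    a)^2 and split into factors with known limits L, \<omega> and \<omega>^2. In the limit it reads
    L \<omega> / \<omega>^2 = L.\<close>
  have ev: "\<forall>\<^sub>F w in at a. \<phi> (\<sigma> w) * (\<sigma> w - a)\<^sup>2 * deriv \<sigma> w / ((\<sigma> w - a) / (w - a))\<^sup>2 = \<phi> w * (w - a)\<^sup>2"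
    using anH eventually_compose_filterlim[OF anH \<sigma>(4)] inv' an\<sigma> dH quot
      eventually_compose_filterlim[OF dH \<sigma>(4)] \<sigma>(4)[unfolded filterlim_at, THEN conjunct1]
      eventually_neq_at_within[of a a UNIV]
  proof eventually_elim
    case (elim w)
    have D1: "(H has_field_derivative deriv H w) (at w)"
      by (rule analytic_derivI[OF elim(1)])
    have D2: "(H has_field_derivative deriv H (\<sigma> w)) (at (\<sigma> w))"
      by (rule analytic_derivI[OF elim(2)])
    have D3: "(\<sigma> has_field_derivative deriv \<sigma> w) (at w)"
      by (rule analytic_derivI[OF elim(4)])
    have "((\<lambda>x. H (\<sigma> x)) has_field_derivative deriv H (\<sigma> w) * deriv \<sigma> w) (at w)"
      by (rule DERIV_chain2[OF D2 D3])
    moreover have "((\<lambda>x. H (\<sigma> x)) has_field_derivative D) (at w) \<longleftrightarrow> (H has_field_derivative D) (at w)" for D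
      by (rule DERIV_cong_ev) (use elim(3) in auto)
    ultimately have eq: "deriv H w = deriv H (\<sigma> w) * deriv \<sigma> w"
      using D1 DERIV_unique by blast
    have "\<phi> (\<sigma> w) * deriv H w = \<phi> w * deriv H (\<sigma> w)" using elim by (simp add: field_simps)
    then have "\<phi> (\<sigma> w) * deriv \<sigma> w * deriv H (\<sigma> w) = \<phi> w * deriv H (\<sigma> w)"
      unfolding eq by (simp add: mult_ac)
    then have "\<phi> (\<sigma> w) * deriv \<sigma> w = \<phi> w" using elim by simp
    then show ?case using elim by (simp add: power_divide field_simps)
  qed
  have l1: "((\<lambda>w. \<phi> (\<sigma> w) * (\<sigma> w - a)\<^sup>2) \<longlongrightarrow> L) (at a)"
    using filterlim_compose[OF lim(1) \<sigma>(4)] .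
  have l2: "(deriv \<sigma> \<longlongrightarrow> \<omega>) (at a)"
    using analytic_at_imp_isCont[OF analytic_deriv[OF \<sigma>(1)]] \<sigma>(3) by (simp add: isCont_def)
  have l3: "((\<lambda>w. (\<sigma> w - a) / (w - a)) \<longlongrightarrow> \<omega>) (at a)"
    using d\<sigma> \<sigma>(2) by (simp add: has_field_derivative_iff)
  have "((\<lambda>w. \<phi> (\<sigma> w) * (\<sigma> w - a)\<^sup>2 * deriv \<sigma> w / ((\<sigma> w - a) / (w - a))\<^sup>2) \<longlongrightarrow> L * \<omega> / \<omega>\<^sup>2) (at a)"
    by (intro tendsto_intros l1 l2 l3) (use \<sigma> in auto)
  then have "((\<lambda>w. \<phi> w * (w - a)\<^sup>2) \<longlongrightarrow> L * \<omega> / \<omega>\<^sup>2) (at a)"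
    by (rule Lim_transform_eventually) (rule ev)
  then have "L * \<omega> / \<omega>\<^sup>2 = L" using lim(1) tendsto_unique[of "at a"] by auto
  then have "L = L * \<omega>" using \<sigma>(5) by (simp add: power2_eq_square field_simps)
  then show ?thesis using lim(2) by simp
qed

section \<open>The quotient of a harmonic differential by an exact one\<close>

context riemann_surface
begin

lemma transition_eventually_inverse:
  assumes U: "(U, u) \<in> A" "p \<in> U" and V: "(V, v) \<in> A" "p \<in> V"
  shows "\<forall>\<^sub>F w in nhds (u p). inv_into U u w \<in> V \<and> inv_into V v (v (inv_into U u w)) = inv_into U u w"
proof -
  have "\<forall>\<^sub>F q in nhds p. q \<in> V" using V chart_open by (intro eventually_nhds_in_open) auto
  then show ?thesis
    unfolding chart_eventually_nhds[OF U] by eventually_elim (auto simp: chart_inv_into[OF V(1)])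
qed

lemma analytic_change_chart:
  assumes U: "(U, u) \<in> A" "p \<in> U" and V: "(V, v) \<in> A" "p \<in> V"
    and h: "(\<lambda>w. h (inv_into V v w)) analytic_on {v p}"
  shows "(\<lambda>w. h (inv_into U u w)) analytic_on {u p}"
    and "deriv (\<lambda>w. h (inv_into U u w)) (u p) =
           deriv (\<lambda>w. h (inv_into V v w)) (v p) * deriv (\<lambda>w. v (inv_into U u w)) (u p)"
proof -
  let ?\<tau> = "\<lambda>w. v (inv_into U u w)"
  note \<tau> = transition_analytic[OF U(1) V(1) U(2) V(2)]
  have \<tau>p: "?\<tau> (u p) = v p" using chart_inv_into[OF U] by simp
  have eq: "\<forall>\<^sub>F w in nhds (u p). h (inv_into V v (?\<tau> w)) = h (inv_into U u w)"
    using transition_eventually_inverse[OF U V] by eventually_elim simp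
  have "((\<lambda>w. h (inv_into V v w)) \<circ> ?\<tau>) analytic_on {u p}"
    by (rule analytic_on_compose[OF \<tau>]) (use h \<tau>p in simp)
  then have "(\<lambda>w. h (inv_into V v (?\<tau> w))) analytic_on {u p}" by (simp add: o_def)
  then show "(\<lambda>w. h (inv_into U u w)) analytic_on {u p}"
    using analytic_at_cong[OF eq refl] by simp
  have "((\<lambda>w. h (inv_into V v w)) has_field_derivative deriv (\<lambda>w. h (inv_into V v w)) (v p)) (at (?\<tau> (u p)))"
    unfolding \<tau>p by (rule analytic_derivI[OF h])
  from DERIV_chain2[OF this analytic_derivI[OF \<tau>]]
  have "((\<lambda>w. h (inv_into V v (?\<tau> w))) has_field_derivative
      deriv (\<lambda>w. h (inv_into V v w)) (v p) * deriv ?\<tau> (u p)) (at (u p))" .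
  then have "((\<lambda>w. h (inv_into U u w)) has_field_derivative
      deriv (\<lambda>w. h (inv_into V v w)) (v p) * deriv ?\<tau> (u p)) (at (u p))"
    using DERIV_cong_ev[OF refl eq refl] by simp
  then show "deriv (\<lambda>w. h (inv_into U u w)) (u p) = deriv (\<lambda>w. h (inv_into V v w)) (v p) * deriv ?\<tau> (u p)"
    by (rule DERIV_imp_deriv)
qed

lemma transition_deriv_nonzero:
  assumes U: "(U, u) \<in> A" "p \<in> U" and V: "(V, v) \<in> A" "p \<in> V"
  shows "deriv (\<lambda>w. v (inv_into U u w)) (u p) \<noteq> 0"
proof -
  note an = transition_analytic[OF V(1) U(1) V(2) U(2)]
  have "\<forall>\<^sub>F w in nhds (u p). u (inv_into U u w) = w"
    using chart_eventually_in[OF U] by eventually_elim (rule chart_inv_into'[OF U(1)])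
  then have "deriv (\<lambda>w. u (inv_into U u w)) (u p) = deriv (\<lambda>w. w) (u p)"
    by (rule deriv_cong_ev[OF _ refl])
  then show ?thesis using analytic_change_chart(2)[OF U V an] by auto
qed

text \<open>With f = Re F in the coordinate u, F' du is twice the (1,0)-part of df, and this is its
  quotient by dh. By \<open>Re_eq_imp_deriv_eq\<close> F' does not depend on the choice of F, and a
  change of chart multiplies both derivatives by the same factor, so the chosen value is canonical
  wherever h is analytic.\<close>

definition diff_quot :: "('a \<Rightarrow> real) \<Rightarrow> ('a \<Rightarrow> complex) \<Rightarrow> 'a \<Rightarrow> complex" where
  "diff_quot f h p = (SOME c. \<exists>U u F. (U, u) \<in> A \<and> p \<in> U \<and> F analytic_on {u p} \<and>
     (\<forall>\<^sub>F q in nhds p. f q = Re (F (u q))) \<and>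
     c = deriv F (u p) / deriv (\<lambda>w. h (inv_into U u w)) (u p))"

lemma diff_quot_eq:
  assumes U: "(U, u) \<in> A" "p \<in> U" and F: "F analytic_on {u p}" "\<forall>\<^sub>F q in nhds p. f q = Re (F (u q))"
    and h: "(\<lambda>w. h (inv_into U u w)) analytic_on {u p}"
  shows "diff_quot f h p = deriv F (u p) / deriv (\<lambda>w. h (inv_into U u w)) (u p)"
  unfolding diff_quot_def
proof (rule some_equality, goal_cases)
  case 1
  then show ?case using U F by blast
next
  case (2 c)
  then obtain V v G where V: "(V, v) \<in> A" "p \<in> V" and G: "G analytic_on {v p}"
      "\<forall>\<^sub>F q in nhds p. f q = Re (G (v q))"
    and c: "c = deriv G (v p) / deriv (\<lambda>w. h (inv_into V v w)) (v p)" by blast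
  let ?\<tau> = "\<lambda>w. v (inv_into U u w)"
  note \<tau> = transition_analytic[OF U(1) V(1) U(2) V(2)]
  have \<tau>p: "?\<tau> (u p) = v p" using chart_inv_into[OF U] by simp
  have "(G \<circ> ?\<tau>) analytic_on {u p}"
    by (rule analytic_on_compose[OF \<tau>]) (use G \<tau>p in simp)
  then have G\<tau>: "(\<lambda>w. G (?\<tau> w)) analytic_on {u p}" by (simp add: o_def)
  have "\<forall>\<^sub>F w in nhds (u p). Re (F w) = Re (G (?\<tau> w))"
    using F(2)[unfolded chart_eventually_nhds[OF U]] G(2)[unfolded chart_eventually_nhds[OF U]]
      chart_eventually_in[OF U]
    by eventually_elim (use chart_inv_into'[OF U(1)] in simp)
  then have "deriv F (u p) = deriv (\<lambda>w. G (?\<tau> w)) (u p)"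
    by (rule Re_eq_imp_deriv_eq[OF F(1) G\<tau>])
  moreover have "(G has_field_derivative deriv G (v p)) (at (?\<tau> (u p)))"
    unfolding \<tau>p by (rule analytic_derivI[OF G(1)])
  from DERIV_imp_deriv[OF DERIV_chain2[OF this analytic_derivI[OF \<tau>]]]
  have "deriv (\<lambda>w. G (?\<tau> w)) (u p) = deriv G (v p) * deriv ?\<tau> (u p)" .
  ultimately have dF: "deriv F (u p) = deriv G (v p) * deriv ?\<tau> (u p)" by simp
  have dh: "deriv (\<lambda>w. h (inv_into U u w)) (u p) =
      deriv (\<lambda>w. h (inv_into V v w)) (v p) * deriv ?\<tau> (u p)"
    by (rule analytic_change_chart(2)[OF U V analytic_change_chart(1)[OF V U h]])
  show ?case
    unfolding c dF dh using transition_deriv_nonzero[OF U V] by simp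
qed

lemma merom_at_chart_fun:
  assumes U: "(U, u) \<in> A" "p \<in> U" and g: "g meromorphic_on {u p}"
  shows "merom_at (\<lambda>q. g (u q)) p"
proof (rule merom_atI[OF U])
  have "\<forall>\<^sub>F w in at (u p). g w = g (u (inv_into U u w))"
    using chart_eventually_in[OF U, unfolded eventually_nhds_conv_at, THEN conjunct1]
    by eventually_elim (simp add: chart_inv_into'[OF U(1)])
  then show "(\<lambda>w. g (u (inv_into U u w))) meromorphic_on {u p}" using g by (rule meromorphic_at_cong)
qed

lemma eventually_chart_analytic:
  assumes U: "(U, u) \<in> A" "p \<in> U" and h: "merom_at h p"
  shows "\<forall>\<^sub>F q in at p. (\<lambda>w. h (inv_into U u w)) analytic_on {u q}"
proof -
  let ?h = "\<lambda>w. h (inv_into U u w)"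
  have "isolated_singularity_at ?h (u p)" using merom_atD[OF h U] by (simp add: meromorphic_at_iff)
  then obtain r where r: "r > 0" "?h analytic_on ball (u p) r - {u p}"
    by (auto simp: isolated_singularity_at_def)
  have "\<forall>\<^sub>F w in at (u p). w \<in> ball (u p) r - {u p}" using r by (intro eventually_at_in_open) auto
  moreover have "\<forall>\<^sub>F w in at (u p). w \<in> u ` U"
    using chart_eventually_in[OF U] by (simp add: eventually_nhds_conv_at)
  ultimately have "\<forall>\<^sub>F w in at (u p). ?h analytic_on {u (inv_into U u w)}"
    by eventually_elim
      (use chart_inv_into'[OF U(1)] in \<open>auto intro!: analytic_on_subset[OF r(2)]\<close>)
  then show ?thesis using chart_eventually_at[OF U] by blast
qed

lemma eventually_chart_in:
  assumes U: "(U, u) \<in> A" "p \<in> U"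
  shows "\<forall>\<^sub>F q in at p. q \<in> U"
  using eventually_nhds_in_open[of U p] U chart_open[OF U(1)] by (simp add: eventually_nhds_conv_at)

lemma merom_at_diff_quot:
  assumes f: "harmonic_at f p" and h: "merom_at h p"
  shows "merom_at (diff_quot f h) p"
proof -
  obtain U u where U: "(U, u) \<in> A" "p \<in> U" using charts_cover by blast
  obtain F where F: "F analytic_on {u p}" "\<forall>\<^sub>F q in nhds p. f q = Re (F (u q))"
    by (rule harmonic_atE[OF f U])
  let ?h = "\<lambda>w. h (inv_into U u w)"
  have anF: "\<forall>\<^sub>F q in nhds p. F analytic_on {u q}"
    using eventually_analytic_at[OF F(1)] chart_isCont[OF U]
    unfolding isCont_def tendsto_at_iff_tendsto_nhds by (rule eventually_compose_filterlim)
  \<comment> \<open>h may have a pole at p itself, so the quotient is identified at nearby points q,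
    each of which requires the representation of f around q.\<close>
  have evF: "\<forall>\<^sub>F q in at p. \<forall>\<^sub>F x in nhds q. f x = Re (F (u x))"
    using F(2) by (intro eventually_at_eventually_nhds) (simp add: eventually_nhds_conv_at)
  have "\<forall>\<^sub>F q in at p. deriv F (u q) / deriv ?h (u q) = diff_quot f h q"
    using eventually_chart_in[OF U] eventually_chart_analytic[OF U h]
      anF[unfolded eventually_nhds_conv_at, THEN conjunct1] evF
    by eventually_elim (rule diff_quot_eq[OF U(1), symmetric])
  moreover have "merom_at (\<lambda>q. deriv F (u q) / deriv ?h (u q)) p"
    by (rule merom_at_chart_fun[OF U, of "\<lambda>w. deriv F w / deriv ?h w"])
       (intro meromorphic_intros analytic_on_imp_meromorphic_on F(1) merom_atD[OF h U])
  ultimately show ?thesis by (rule merom_at_cong)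
qed

end

context compact_riemann_surface
begin

text \<open>Supplies the function that a rotation cannot preserve. \<phi> is the coefficient of its
  numerator in the chart u, and the limit condition says that this coefficient has a pole of order
  exactly two.\<close>

theorem dipole_quotient:
  assumes U: "(U, u) \<in> A" "p \<in> U" and h: "meromorphic_function A h"
  obtains f \<phi> L where "meromorphic_function A f"
    "\<forall>\<^sub>F w in at (u p). f (inv_into U u w) = \<phi> w / deriv (\<lambda>w. h (inv_into U u w)) w"
    "((\<lambda>w. \<phi> w * (w - u p)\<^sup>2) \<longlongrightarrow> L) (at (u p))" "L \<noteq> 0"
proof -
  obtain V \<kappa> \<delta> \<rho> where D: "coordinate_disc A V \<kappa> \<delta>" "\<delta> 0 = p" "V \<subseteq> U" "\<rho> > 0"
    and u_eq: "\<And>q. q \<in> V \<Longrightarrow> u q = u p + of_real \<rho> * \<kappa> q"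
    by (rule coordinate_disc_exists[OF U open_UNIV UNIV_I]) (rule that)
  interpret D: coordinate_disc A V \<kappa> \<delta> by fact
  \<comment> \<open>The radius only has to be below the bound 1/3 of
    \<open>dipole_exists\<close>.\<close>
  interpret DE: disc_exterior A V \<kappa> \<delta> "1/4" by unfold_locales auto
  obtain v G k where v: "\<And>q. q \<noteq> \<delta> 0 \<Longrightarrow> harmonic_at v q" "G holomorphic_on ball 0 1"
    "\<And>z. z \<noteq> 0 \<Longrightarrow> norm z < 1 \<Longrightarrow> v (\<delta> z) = Re (1 / z + G z) + k * ln (norm z)"
    by (rule DE.dipole_exists) (simp, rule that)
  define Z where "Z w = (w - u p) / of_real \<rho>" for w
  \<comment> \<open>The derivative in w of 1/Z + G(Z) + k Log Z. It is single-valued although the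
    logarithm is not.\<close>
  define \<phi> where "\<phi> w = (- 1 / (Z w)\<^sup>2 + deriv G (Z w) + of_real k / Z w) / of_real \<rho>" for w
  let ?h = "\<lambda>w. h (inv_into U u w)"
  have mh: "merom_at h q" for q using h by (simp add: meromorphic_function_iff)
  have Zu: "Z (u q) = \<kappa> q" if "q \<in> V" for q using u_eq[OF that] D(4) by (simp add: Z_def)
  have \<phi>_eq: "diff_quot v h q = \<phi> (u q) / deriv ?h (u q)"
    if q: "q \<in> \<delta> ` (ball 0 1 - {0})" "?h analytic_on {u q}" for q
  proof -
    obtain z where "q = \<delta> z" "z \<in> ball 0 1 - {0}" using q(1) by blast
    then have z: "q = \<delta> z" "norm z < 1" "z \<noteq> 0" by auto
    have qV: "q \<in> V" using z by simp
    have Zq: "Z (u q) = z" using Zu[OF qV] z by simp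
    \<comment> \<open>Around a point with coordinate z, dividing by z selects a branch of the
      logarithm whose real part is ln |Z|.\<close>
    define F where "F w = 1 / Z w + G (Z w) + of_real k * (Ln (Z w / z) + of_real (ln (norm z)))" for w
    have Zan: "Z analytic_on {u q}" unfolding Z_def using D(4) by (intro analytic_intros) auto
    have "G analytic_on {z}"
      unfolding analytic_at using v(2) z(2) by (intro exI[of _ "ball 0 1"]) auto
    then have "(G \<circ> Z) analytic_on {u q}" by (intro analytic_on_compose[OF Zan]) (simp add: Zq)
    then have GZ: "(\<lambda>w. G (Z w)) analytic_on {u q}" by (simp add: o_def)
    have Fan: "F analytic_on {u q}"
      unfolding F_def using z(3) by (intro analytic_intros Zan GZ) (auto simp: Zq)
    have "\<forall>\<^sub>F x in nhds q. x \<in> \<delta> ` (ball 0 1 - {0})"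
      using q(1) by (intro eventually_nhds_in_open D.open_delta) auto
    then have ReF: "\<forall>\<^sub>F x in nhds q. v x = Re (F (u x))"
    proof eventually_elim
      case (elim x)
      then obtain y where "x = \<delta> y" "y \<in> ball 0 1 - {0}" by blast
      then have y: "x = \<delta> y" "norm y < 1" "y \<noteq> 0" by auto
      then have "Z (u x) = y" using Zu[of x] by simp
      then show ?case using y z v(3)[of y] by (simp add: F_def norm_divide ln_div)
    qed
    have dZ: "(Z has_field_derivative 1 / of_real \<rho>) (at (u q))"
      unfolding Z_def using D(4) by (auto intro!: derivative_eq_intros)
    have dG: "(G has_field_derivative deriv G z) (at (Z (u q)))"
      unfolding Zq by (rule analytic_derivI) fact
    have "((\<lambda>w. G (Z w)) has_field_derivative deriv G z * (1 / of_real \<rho>)) (at (u q))"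
      by (rule DERIV_chain2[OF dG dZ])
    moreover have "((\<lambda>w. 1 / Z w) has_field_derivative - 1 / z\<^sup>2 * (1 / of_real \<rho>)) (at (u q))"
      using dZ z(3) D(4) by (auto intro!: derivative_eq_intros simp: Zq power2_eq_square)
    moreover have "((\<lambda>w. of_real k * (Ln (Z w / z) + of_real (ln (norm z)))) has_field_derivative
        of_real k / z * (1 / of_real \<rho>)) (at (u q))"
      using dZ z(3) D(4) by (auto intro!: derivative_eq_intros simp: Zq)
    ultimately have "(F has_field_derivative - 1 / z\<^sup>2 * (1 / of_real \<rho>) + deriv G z * (1 / of_real \<rho>) +
        of_real k / z * (1 / of_real \<rho>)) (at (u q))"
      unfolding F_def by (intro DERIV_add)
    then have "deriv F (u q) = \<phi> (u q)"
      by (rule DERIV_imp_deriv[THEN trans]) (use D(4) in \<open>simp add: \<phi>_def Zq add_divide_distrib diff_divide_distrib\<close>)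
    then show ?thesis using diff_quot_eq[OF U(1) subsetD[OF D(3) qV] Fan ReF q(2)] by simp
  qed
  have near: "\<forall>\<^sub>F q in at p. q \<in> \<delta> ` (ball 0 1 - {0})"
  proof -
    have "\<forall>\<^sub>F q in at p. q \<in> \<delta> ` ball 0 1 - {p}"
      using D(2) by (intro eventually_at_in_open D.open_delta) force+
    then show ?thesis by eventually_elim (use D(2) in auto)
  qed
  have ev: "\<forall>\<^sub>F q in at p. \<phi> (u q) / deriv ?h (u q) = diff_quot v h q"
    using near eventually_chart_analytic[OF U mh] by eventually_elim (simp add: \<phi>_eq)
  have Gan: "G analytic_on {0}"
    unfolding analytic_at using v(2) by (intro exI[of _ "ball 0 1"]) auto
  have Zan: "Z analytic_on {u p}" unfolding Z_def using D(4) by (intro analytic_intros) auto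
  have "(deriv G \<circ> Z) analytic_on {u p}"
    by (rule analytic_on_compose[OF Zan]) (use analytic_deriv[OF Gan] in \<open>simp add: Z_def\<close>)
  then have dGZ: "(\<lambda>w. deriv G (Z w)) analytic_on {u p}" by (simp add: o_def)
  have "\<phi> meromorphic_on {u p}"
    unfolding \<phi>_def
    by (intro meromorphic_intros analytic_on_imp_meromorphic_on[OF Zan] analytic_on_imp_meromorphic_on[OF dGZ])
  then have "merom_at (\<lambda>q. \<phi> (u q) / deriv ?h (u q)) p"
    by (intro merom_at_chart_fun[OF U, of "\<lambda>w. \<phi> w / deriv ?h w"] meromorphic_intros merom_atD[OF mh U])
  then have "merom_at (diff_quot v h) p" by (rule merom_at_cong[OF ev])
  then have m: "merom_at (diff_quot v h) q" for q
    using merom_at_diff_quot[OF v(1) mh, of q] D(2) by (cases "q = p") auto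
  have ev': "\<forall>\<^sub>F q in at p. remove_sings_surface (diff_quot v h) q = \<phi> (u q) / deriv ?h (u q)"
    using eventually_remove_sings_surface[OF m] ev by eventually_elim simp
  show thesis
  proof
    show "meromorphic_function A (remove_sings_surface (diff_quot v h))"
      by (rule meromorphic_function_remove_sings_surface[OF m])
    show "\<forall>\<^sub>F w in at (u p). remove_sings_surface (diff_quot v h) (inv_into U u w) = \<phi> w / deriv ?h w"
      using ev'[unfolded chart_eventually_at[OF U]]
        chart_eventually_in[OF U, unfolded eventually_nhds_conv_at, THEN conjunct1]
      by eventually_elim (simp add: chart_inv_into'[OF U(1)])
    \<comment> \<open>This is \<phi> w (w - u p)^2 with the pole cancelled, using w - u p = \<rho>
      Z. At Z = 0 it is - \<rho>, the required L.\<close>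
    have "(\<lambda>w. of_real \<rho> * (- 1 + deriv G (Z w) * (Z w)\<^sup>2 + of_real k * Z w))
        \<midarrow>u p\<rightarrow> of_real \<rho> * (- 1 + deriv G (Z (u p)) * (Z (u p))\<^sup>2 + of_real k * Z (u p))"
      by (intro tendsto_intros isContD[OF analytic_at_imp_isCont[OF Zan]]
          isContD[OF analytic_at_imp_isCont[OF dGZ]])
    moreover have "Z (u p) = 0" by (simp add: Z_def)
    moreover have "of_real \<rho> * (- 1 + deriv G (Z w) * (Z w)\<^sup>2 + of_real k * Z w) = \<phi> w * (w - u p)\<^sup>2"
      if "w \<noteq> u p" for w
    proof -
      have nz: "Z w \<noteq> 0" and "w - u p = of_real \<rho> * Z w" using that D(4) by (auto simp: Z_def)
      then have "\<phi> w * (w - u p)\<^sup>2 =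
          (- 1 / (Z w)\<^sup>2 + deriv G (Z w) + of_real k / Z w) / of_real \<rho> * (of_real \<rho> * Z w)\<^sup>2"
        by (simp only: \<phi>_def)
      also have "\<dots> = of_real \<rho> * (- 1 + deriv G (Z w) * (Z w)\<^sup>2 + of_real k * Z w)"
        using nz D(4) by (simp add: field_simps power2_eq_square)
      finally show ?thesis by simp
    qed
    then have "\<forall>\<^sub>F w in at (u p). of_real \<rho> * (- 1 + deriv G (Z w) * (Z w)\<^sup>2 + of_real k * Z w) =
        \<phi> w * (w - u p)\<^sup>2"
      by (simp add: eventually_at_filter)
    ultimately show "((\<lambda>w. \<phi> w * (w - u p)\<^sup>2) \<longlongrightarrow> - of_real \<rho>) (at (u p))"
      by (simp add: Lim_transform_eventually)
    show "- complex_of_real \<rho> \<noteq> 0" using D(4) by simp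
  qed
qed

end

section \<open>Holomorphic maps with a common composite\<close>

lemma (in riemann_surface) chart_at_props:
  assumes "chart_at A p = (U, u)"
  shows "(U, u) \<in> A" "p \<in> U"
proof -
  have "\<exists>c. c \<in> A \<and> p \<in> fst c" using charts_cover[of p] by force
  from someI_ex[OF this] show "(U, u) \<in> A" "p \<in> U"
    using assms by (auto simp: chart_at_def)
qed

text \<open>In charts X minus its value at p is t^m with m the multiplicity, so a rotation of t by
  an m-th root of unity leaves X unchanged. It is expressed in the chart u chosen at p, so that
  rotations for different maps can be compared.\<close>

lemma local_rotation_of_map:
  fixes A :: "'a::t2_space atlas" and B :: "'b::t2_space atlas"
  assumes A: "riemann_surface A" and B: "riemann_surface B" and X: "holomorphic_map A B X"
    and U: "chart_at A p = (U, u)" and nc: "\<forall>\<^sub>F q in at p. X q \<noteq> X p"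
    and \<omega>: "\<omega> ^ map_mult A B X p = 1" "\<omega> \<noteq> 0"
  obtains \<sigma> where "\<sigma> analytic_on {u p}" "\<sigma> (u p) = u p" "deriv \<sigma> (u p) = \<omega>"
    "filterlim \<sigma> (at (u p)) (at (u p))"
    "\<forall>\<^sub>F w in at (u p). X (inv_into U u (\<sigma> w)) = X (inv_into U u w)"
proof -
  interpret A: riemann_surface A by fact
  interpret B: riemann_surface B by fact
  note U' = A.chart_at_props[OF U]
  obtain V v where V: "chart_at B (X p) = (V, v)" by fastforce
  note V' = B.chart_at_props[OF V]
  have contX: "continuous_on UNIV X" using X by (simp add: holomorphic_map_def)
  have openXV: "open (X -` V)" using contX B.chart_open[OF V'(1)] by (auto intro: open_vimage)
  define g where "g w = v (X (inv_into U u w)) - v (X p)" for w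
  have "(\<lambda>w. v (X (inv_into U u w))) holomorphic_on u ` (U \<inter> X -` V)"
    using X U'(1) V'(1) by (auto simp: holomorphic_map_def)
  moreover have "open (u ` (U \<inter> X -` V))"
    using A.chart_open_image[OF U'(1)] A.chart_open[OF U'(1)] openXV by blast
  moreover have "u p \<in> u ` (U \<inter> X -` V)" using U' V' by auto
  ultimately have "(\<lambda>w. v (X (inv_into U u w))) analytic_on {u p}" unfolding analytic_at by blast
  then have g: "g analytic_on {u p}" unfolding g_def by (intro analytic_intros)
  have evV: "\<forall>\<^sub>F q in at p. X q \<in> V"
    using eventually_nhds_in_open[OF openXV, of p] V'(2) by (simp add: eventually_nhds_conv_at)
  have inj: "v x = v y \<longleftrightarrow> x = y" if "x \<in> V" "y \<in> V" for x y
    using that B.chart_inv_into[OF V'(1)] by metis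
  have "\<forall>\<^sub>F q in at p. v (X q) \<noteq> v (X p)"
    using evV nc by eventually_elim (use inj V'(2) in auto)
  then have "\<forall>\<^sub>F w in at (u p). g w \<noteq> 0"
    unfolding A.chart_eventually_at[OF U'] by eventually_elim (simp add: g_def)
  then have fg: "\<exists>\<^sub>F w in at (u p). g w \<noteq> 0"
    by (rule eventually_frequently[OF at_neq_bot])
  \<comment> \<open>\<open>map_mult\<close> cuts the order off with \<open>nat\<close>; positivity
    shows that nothing is lost.\<close>
  have pos: "zorder g (u p) > 0"
    unfolding zorder_pos_iff'[OF g fg] by (simp add: g_def A.chart_inv_into[OF U'])
  have mult: "map_mult A B X p = nat (zorder g (u p))"
    by (simp add: map_mult_def U V g_def[abs_def])
  obtain t where t: "t analytic_on {u p}" "t (u p) = 0" "deriv t (u p) \<noteq> 0"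
    "\<forall>\<^sub>F w in at (u p). g w = t w powi zorder g (u p)"
    by (rule local_root_zorder[OF analytic_on_imp_meromorphic_on[OF g] fg]) (use pos in simp, rule that)
  have "\<forall>\<^sub>F w in at (u p). g w = 0 + t w ^ map_mult A B X p"
    using t(4) by eventually_elim (use pos in \<open>simp add: mult power_int_def\<close>)
  then obtain \<sigma> where \<sigma>: "\<sigma> analytic_on {u p}" "\<sigma> (u p) = u p" "deriv \<sigma> (u p) = \<omega>"
    "filterlim \<sigma> (at (u p)) (at (u p))" "\<forall>\<^sub>F w in at (u p). g (\<sigma> w) = g w"
    by (rule local_rotation_exists[OF t(1-3) _ \<omega>])
  have evV': "\<forall>\<^sub>F w in at (u p). X (inv_into U u w) \<in> V"
    using evV unfolding A.chart_eventually_at[OF U'] .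
  have "\<forall>\<^sub>F w in at (u p). X (inv_into U u (\<sigma> w)) = X (inv_into U u w)"
    using \<sigma>(5) evV' eventually_compose_filterlim[OF evV' \<sigma>(4)]
    by eventually_elim (use inj in \<open>simp add: g_def\<close>)
  then show thesis using that \<sigma>(1-4) by blast
qed

lemma primitive_root_of_unity_exists:
  assumes "d > (1::nat)"
  obtains \<omega> :: complex where "\<omega> ^ d = 1" "\<omega> \<noteq> 1" "\<omega> \<noteq> 0"
proof -
  let ?\<omega> = "exp (2 * of_real pi * \<i> * of_nat 1 / of_nat d)"
  have "?\<omega> ^ d = 1" using complex_root_unity[of d 1] assms by simp
  moreover have "?\<omega> \<noteq> 1"
    using complex_root_unity_eq[of d 1 0] assms by (simp add: cong_def)
  ultimately show thesis using that[of ?\<omega>] by simp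
qed

lemma common_composite_constant:
  fixes \<E> :: "'e::t2_space atlas" and \<R> :: "'r::t2_space atlas" and \<T> :: "'t::t2_space atlas"
  assumes E: "compact_riemann_surface \<E>" and R: "riemann_surface \<R>" and T: "riemann_surface \<T>"
    and X: "holomorphic_map \<E> \<R> X" and Y: "holomorphic_map \<E> \<T> Y"
    and comp: "compositum (meromorphic_field \<E>) (pullback_field X \<R>) (pullback_field Y \<T>)
           = carrier (meromorphic_field \<E>)"
    and gcd: "gcd (map_mult \<E> \<R> X z0) (map_mult \<E> \<T> Y z0) > 1"
    and hX: "h \<in> pullback_field X \<R>" and hY: "h \<in> pullback_field Y \<T>"
  shows "\<exists>c. h = (\<lambda>_. c)"
proof (rule ccontr)
  assume nconst: "\<nexists>c. h = (\<lambda>_. c)"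
  interpret E: compact_riemann_surface \<E> by fact
  obtain f0 where h_X: "h = f0 \<circ> X" using hX unfolding pullback_field_def by blast
  obtain g0 where h_Y: "h = g0 \<circ> Y" using hY unfolding pullback_field_def by blast
  \<comment> \<open>As a generator h lies in the compositum, and the hypothesis places it among the
    meromorphic functions.\<close>
  have "h \<in> carrier (meromorphic_field \<E>)"
    unfolding comp[symmetric] compositum_def using hX by (intro generate_field.incl) auto
  then have h: "meromorphic_function \<E> h" by (simp add: E.meromorphic_field_simps)
  obtain U u where U: "chart_at \<E> z0 = (U, u)" by fastforce
  note U' = E.chart_at_props[OF U]
  let ?h = "\<lambda>w. h (inv_into U u w)"
  have ne: "\<forall>\<^sub>F q in at z0. h q \<noteq> c" for c
    using E.meromorphic_identity_theorem[OF h] nconst by blast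
  \<comment> \<open>X is not locally constant at z0, since h factors through X and is not.\<close>
  have neX: "\<forall>\<^sub>F q in at z0. X q \<noteq> X z0"
    using ne[of "h z0"] by eventually_elim (auto simp: h_X)
  have neY: "\<forall>\<^sub>F q in at z0. Y q \<noteq> Y z0"
    using ne[of "h z0"] by eventually_elim (auto simp: h_Y)
  obtain \<omega> :: complex where \<omega>: "\<omega> ^ gcd (map_mult \<E> \<R> X z0) (map_mult \<E> \<T> Y z0) = 1" "\<omega> \<noteq> 1" "\<omega> \<noteq> 0"
    using primitive_root_of_unity_exists[OF gcd] by blast
  have \<omega>_pow: "\<omega> ^ n = 1" if "gcd (map_mult \<E> \<R> X z0) (map_mult \<E> \<T> Y z0) dvd n" for n
    using that \<omega>(1) by (auto simp: dvd_def power_mult)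
  obtain \<sigma> where \<sigma>: "\<sigma> analytic_on {u z0}" "\<sigma> (u z0) = u z0" "deriv \<sigma> (u z0) = \<omega>"
    "filterlim \<sigma> (at (u z0)) (at (u z0))"
    "\<forall>\<^sub>F w in at (u z0). X (inv_into U u (\<sigma> w)) = X (inv_into U u w)"
    by (rule local_rotation_of_map[OF E.riemann_surface_axioms R X U neX \<omega>_pow[OF gcd_dvd1] \<omega>(3)])
  obtain \<tau> where \<tau>: "\<tau> analytic_on {u z0}" "\<tau> (u z0) = u z0" "deriv \<tau> (u z0) = \<omega>"
    "filterlim \<tau> (at (u z0)) (at (u z0))"
    "\<forall>\<^sub>F w in at (u z0). Y (inv_into U u (\<tau> w)) = Y (inv_into U u w)"
    by (rule local_rotation_of_map[OF E.riemann_surface_axioms T Y U neY \<omega>_pow[OF gcd_dvd2] \<omega>(3)])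
  have h\<sigma>: "\<forall>\<^sub>F w in at (u z0). ?h (\<sigma> w) = ?h w"
    using \<sigma>(5) by eventually_elim (simp add: h_X)
  have h\<tau>: "\<forall>\<^sub>F w in at (u z0). ?h (\<tau> w) = ?h w"
    using \<tau>(5) by eventually_elim (simp add: h_Y)
  have mh: "?h meromorphic_on {u z0}"
    using h E.merom_atD[OF _ U'] by (simp add: E.meromorphic_function_iff)
  have "\<forall>\<^sub>F w in at (u z0). ?h w \<noteq> c" for c
    using ne[of c] unfolding E.chart_eventually_at[OF U'] .
  then have nch: "\<exists>\<^sub>F w in at (u z0). ?h w \<noteq> c" for c
    by (rule eventually_frequently[OF at_neq_bot])
  obtain c N t where t: "N \<noteq> 0" "t analytic_on {u z0}" "t (u z0) = 0" "deriv t (u z0) \<noteq> 0"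
    "\<forall>\<^sub>F w in at (u z0). ?h w = c + t w powi N"
    by (rule local_root[OF mh nch])
  \<comment> \<open>Both rotations preserve h and have the same derivative in the same chart, so the
    one built from X preserves Y as well.\<close>
  have "\<forall>\<^sub>F w in at (u z0). \<sigma> w = \<tau> w"
    by (rule local_rotation_unique[OF t(2-4,1,5) \<sigma>(1-4) h\<sigma> \<tau>(1-4) h\<tau> \<omega>(3)])
  then have Y\<sigma>: "\<forall>\<^sub>F w in at (u z0). Y (inv_into U u (\<sigma> w)) = Y (inv_into U u w)"
    using \<tau>(5) by eventually_elim simp
  define S where "S q = inv_into U u (\<sigma> (u q))" for q
  have inU: "\<forall>\<^sub>F w in at (u z0). u (inv_into U u w) = w"
    using E.chart_eventually_in[OF U', unfolded eventually_nhds_conv_at, THEN conjunct1]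
    by eventually_elim (rule E.chart_inv_into'[OF U'(1)])
  \<comment> \<open>The predicate has two arguments so that one equivalence carries over both the
    limit of S and the identities comparing values at S q and q.\<close>
  have transfer: "(\<forall>\<^sub>F q in at z0. P (S q) q) \<longleftrightarrow>
      (\<forall>\<^sub>F w in at (u z0). P (inv_into U u (\<sigma> w)) (inv_into U u w))" for P
    unfolding E.chart_eventually_at[OF U'] S_def
    by (rule eventually_subst) (use inU in \<open>auto elim!: eventually_mono\<close>)
  have limS: "filterlim S (at z0) (at z0)"
    unfolding filterlim_iff
  proof (intro allI impI)
    fix P assume "\<forall>\<^sub>F q in at z0. P q"
    then have "\<forall>\<^sub>F w in at (u z0). P (inv_into U u w)" unfolding E.chart_eventually_at[OF U'] .
    from eventually_compose_filterlim[OF this \<sigma>(4)] show "\<forall>\<^sub>F q in at z0. P (S q)"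
      using transfer[of "\<lambda>x _. P x"] by simp
  qed
  have XS: "\<forall>\<^sub>F q in at z0. X (S q) = X q"
    using \<sigma>(5) transfer[of "\<lambda>x y. X x = X y"] by simp
  have YS: "\<forall>\<^sub>F q in at z0. Y (S q) = Y q"
    using Y\<sigma> transfer[of "\<lambda>x y. Y x = Y y"] by simp
  have inv: "\<forall>\<^sub>F q in at z0. f (S q) = f q" if "f \<in> pullback_field X \<R> \<union> pullback_field Y \<T>" for f
  proof -
    from that consider k where "f = k \<circ> X" | k where "f = k \<circ> Y" by (auto simp: pullback_field_def)
    then show ?thesis
    proof cases
      case 1
      then show ?thesis using XS by (auto elim!: eventually_mono)
    next
      case 2
      then show ?thesis using YS by (auto elim!: eventually_mono)
    qed
  qed
  obtain f \<phi> L where f: "meromorphic_function \<E> f"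
    "\<forall>\<^sub>F w in at (u z0). f (inv_into U u w) = \<phi> w / deriv ?h w"
    "((\<lambda>w. \<phi> w * (w - u z0)\<^sup>2) \<longlongrightarrow> L) (at (u z0))" "L \<noteq> 0"
    by (rule E.dipole_quotient[OF U' h])
  have "f \<in> compositum (meromorphic_field \<E>) (pullback_field X \<R>) (pullback_field Y \<T>)"
    unfolding comp using f(1) by (simp add: E.meromorphic_field_simps)
  then have "\<forall>\<^sub>F q in at z0. f (S q) = f q"
    using E.compositum_invariant[OF limS _ inv] comp by blast
  then have "\<forall>\<^sub>F w in at (u z0). f (inv_into U u (\<sigma> w)) = f (inv_into U u w)"
    using transfer[of "\<lambda>x y. f x = f y"] by simp
  then have quot: "\<forall>\<^sub>F w in at (u z0). \<phi> (\<sigma> w) / deriv ?h (\<sigma> w) = \<phi> w / deriv ?h w"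
    using f(2) eventually_compose_filterlim[OF f(2) \<sigma>(4)] by eventually_elim simp
  have "\<omega> = 1"
    by (rule double_pole_not_invariant[OF mh eventually_deriv_nonzero[OF t(2-4,1,5)] \<sigma>(1-4) \<omega>(3) h\<sigma> quot f(3,4)])
  then show False using \<omega>(2) by simp
qed

theorem theorem1p4:
  fixes \<E> :: "'e::t2_space atlas" and \<R> :: "'r::t2_space atlas" and \<T> :: "'t::t2_space atlas"
    and X :: "'e \<Rightarrow> 'r" and Y :: "'e \<Rightarrow> 't"
  assumes "compact_riemann_surface \<E>"
    and "compact_riemann_surface \<R>"
    and "compact_riemann_surface \<T>"
    and "holomorphic_map \<E> \<R> X" and "map_degree \<E> \<R> X \<ge> 2"
    and "holomorphic_map \<E> \<T> Y" and "map_degree \<E> \<T> Y \<ge> 2"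
    and "compositum (meromorphic_field \<E>) (pullback_field X \<R>) (pullback_field Y \<T>)
           = carrier (meromorphic_field \<E>)"
    and "\<exists>z\<^sub>0. gcd (map_mult \<E> \<R> X z\<^sub>0) (map_mult \<E> \<T> Y z\<^sub>0) > 1"
  shows "pullback_field X \<R> \<inter> pullback_field Y \<T> = {(\<lambda>_. c) | c. True}"
proof -
  interpret R: compact_riemann_surface \<R> by fact
  interpret T: compact_riemann_surface \<T> by fact
  obtain z0 where z0: "gcd (map_mult \<E> \<R> X z0) (map_mult \<E> \<T> Y z0) > 1" using assms(9) by blast
  have "\<exists>c. h = (\<lambda>_. c)" if "h \<in> pullback_field X \<R>" "h \<in> pullback_field Y \<T>" for h
    by (rule common_composite_constant[OF assms(1) R.riemann_surface_axioms T.riemann_surface_axioms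
          assms(4,6,8) z0 that])
  moreover have "(\<lambda>_. c) \<in> pullback_field X \<R>" "(\<lambda>_. c) \<in> pullback_field Y \<T>" for c
    unfolding pullback_field_def R.meromorphic_field_simps T.meromorphic_field_simps
    using R.meromorphic_function_const[of c] T.meromorphic_function_const[of c] by (force simp: o_def)+
  ultimately show ?thesis by auto
qed

end
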